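(* Let $M$ be a symmetric nonsingular $n\times n$ matrix, $V\colon\mathbb{R}^n\to\mathbb{R}$, $g_i\colon\mathbb{R}^n\to\mathbb{R}^n$ ($1\le i\le k$) and $h=(h_1,\dots,h_l)\colon\mathbb{R}^n\to\mathbb{R}^l$ be smooth, and $$H(q,p,\lambda,\lambda^h)=\tfrac12\Big(p+\sum_{i=1}^k\lambda_ig_i(q)\Big)^TM^{-1}\Big(p+\sum_{i=1}^k\lambda_ig_i(q)\Big)+V(q)+\sum_{i=1}^l\lambda^h_ih_i(q),$$ and consider the system $\dot q=H_p$, $\dot p=-H_q$, $0=H_\lambda$, $0=H_{\lambda^h}=h(q)$ (the Hamiltonian form of the variational problem for $\int(\frac12\dot q^TM\dot q-V(q))\,dt$ with velocity constraints $g_i(q)\cdot\dot q=0$ and holonomic constraints $h_i(q)=0$). Assume the standard nondegeneracy assumptions: $g_1(q),\dots,g_k(q)$ are linearly independent for all $q$; the equations $H_\lambda(q,p,\lambda,0)=0$ have a unique solution $\lambda=\tilde\lambda(q,p)$ for all $(q,p)$; and, with $\tilde H(q,p):=H(q,p,\tilde\lambda(q,p),0)$, the $l\times l$ matrix $Dh(q)\,\tilde H_{pp}(q,p)\,Dh(q)^T$ is nonsingular on the constraint manifold. Then the following algorithm yields a convergent, second order integrator that is symplectic on the constraint manifold defined by the (primary) holonomic constraints and the secondary constraints induced by them: (i) apply RATTLE using the holonomic constraints; (ii) in the inner step of RATTLE, when a time step of the unconstrained system is required, apply the midpoint rule to the generalized Hamiltonian system with Hamiltonian $H(q,p,\lam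bda,0)$.
   Context: The constraint manifold is $$C=\{(q,p)\in\mathbb{R}^{2n}: h(q)=0,\ Dh(q)\tilde H_p(q,p)=0\},$$ consisting of the primary constraints $h(q)=0$ and the secondary constraints; under the stated nondegeneracy it is a symplectic submanifold of $(\mathbb{R}^{2n},dq\wedge dp)$, where $dq\wedge dp=\sum_i dq_i\wedge dp_i$. Inner step. One midpoint step of size $\Delta t$ for the generalized Hamiltonian system $\dot q=H_p(q,p,\lambda,0)$, $\dot p=-H_q(q,p,\lambda,0)$, $0=H_\lambda(q,p,\lambda,0)$ maps $(q,p)$ to $(q',p')$ where, for some $\bar\lambda\in\mathbb{R}^k$, $$q'-q=\Delta t\,H_p(\bar q,\bar p,\bar\lambda,0),\quad p'-p=-\Delta t\,H_q(\bar q,\bar p,\bar\lambda,0),\quad 0=H_\lambda(\bar q,\bar p,\bar\lambda,0),\qquad \bar q=\tfrac{q+q'}2,\ \bar p=\tfrac{p+p'}2.$$ RATTLE with this inner step maps $(q_0,p_0)\in C$ to $(q_1,p_1)\in C$ as follows: $p_0^+=p_0-\frac{\Delta t}2Dh(q_0)^T\mu_0$; $(q_1,p_1^-)$ is the result of the inner step applied to $(q_0,p_0^+)$; the multiplier $\mu_0\in\mathbb{R}^l$ is determined by requiring $h(q_1)=0$; then $p_1=p_1^--\frac{\Delta t}2Dh(q_1)^T\mu_1$ with $\mu_1\in\mathbb{R}^l$ determined by requiring $Dh(q_1)\tilde H_p(q_1,p_1)=0$. As usual the integrator is considered for sufficiently small $\Delta t$, with the locally unique solution of the implicit equations close to $(q_0,p_0)$.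 "Symplectic on $C$" means that the map $(q_0,p_0)\mapsto(q_1,p_1)$ on $C$ preserves the restriction of $dq\wedge dp$ to $C$. "Convergent, second order" means that, for initial values on $C$ and over bounded time intervals, the global error in $(q,p)$ is $O(\Delta t^2)$ as $\Delta t\to0$. *)

theory Defs
  imports "HOL-Analysis.Analysis"
begin

section \<open>Smooth maps and gradients\<close>

text \<open>For maps between finite-dimensional spaces this is the usual notion of class
  \<open>C\<^sup>r\<close> on the whole space: all iterated directional derivatives up to order \<open>r\<close> exist and
  are continuous.\<close>

primrec of_class_C :: "nat \<Rightarrow> ('a::real_normed_vector \<Rightarrow> 'b::real_normed_vector) \<Rightarrow> bool" where
  "of_class_C 0 f \<longleftrightarrow> continuous_on UNIV f"
| "of_class_C (Suc r) f \<longleftrightarrow>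
     (\<forall>x. f differentiable at x) \<and> (\<forall>v. of_class_C r (\<lambda>x. frechet_derivative f (at x) v))"

definition smooth :: "('a::real_normed_vector \<Rightarrow> 'b::real_normed_vector) \<Rightarrow> bool" where
  "smooth f \<longleftrightarrow> (\<forall>r. of_class_C r f)"

definition grad :: "(real^'m \<Rightarrow> real) \<Rightarrow> real^'m \<Rightarrow> real^'m" where
  "grad f x = (\<chi> i. frechet_derivative f (at x) (axis i 1))"


section \<open>Generalized Hamiltonian systems\<close>

type_synonym 'n phase = "(real^'n) \<times> (real^'n)"

text \<open>Arguments of a generalized Hamiltonian: \<open>q\<close>, \<open>p\<close>, \<open>\<lambda>\<close> (velocity constraints),
  \<open>\<lambda>\<^sup>h\<close> (holonomic constraints).\<close>

type_synonym ('n, 'k, 'l) hamiltonian =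
  "real^'n \<Rightarrow> real^'n \<Rightarrow> real^'k \<Rightarrow> real^'l \<Rightarrow> real"

definition D_q :: "('n::finite, 'k::finite, 'l::finite) hamiltonian \<Rightarrow> real^'n \<Rightarrow> real^'n \<Rightarrow> real^'k \<Rightarrow> real^'l \<Rightarrow> real^'n" where
  "D_q H q p lam lamh = grad (\<lambda>x. H x p lam lamh) q"

definition D_p :: "('n::finite, 'k::finite, 'l::finite) hamiltonian \<Rightarrow> real^'n \<Rightarrow> real^'n \<Rightarrow> real^'k \<Rightarrow> real^'l \<Rightarrow> real^'n" where
  "D_p H q p lam lamh = grad (\<lambda>x. H q x lam lamh) p"

definition D_lam :: "('n::finite, 'k::finite, 'l::finite) hamiltonian \<Rightarrow> real^'n \<Rightarrow> real^'n \<Rightarrow> real^'k \<Rightarrow> real^'l \<Rightarrow> real^'k" where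
  "D_lam H q p lam lamh = grad (\<lambda>x. H q p x lamh) lam"

definition D_lamh :: "('n::finite, 'k::finite, 'l::finite) hamiltonian \<Rightarrow> real^'n \<Rightarrow> real^'n \<Rightarrow> real^'k \<Rightarrow> real^'l \<Rightarrow> real^'l" where
  "D_lamh H q p lam lamh = grad (\<lambda>x. H q p lam x) lamh"

text \<open>\<open>lam_tilde\<close> is meaningful only when \<open>D_lam H q p lam 0 = 0\<close> is uniquely solvable for \<open>lam\<close>.\<close>

definition lam_tilde :: "('n::finite, 'k::finite, 'l::finite) hamiltonian \<Rightarrow> real^'n \<Rightarrow> real^'n \<Rightarrow> real^'k" where
  "lam_tilde H q p = (THE lam. D_lam H q p lam 0 = 0)"

definition H_tilde :: "('n::finite, 'k::finite, 'l::finite) hamiltonian \<Rightarrow> real^'n \<Rightarrow> real^'n \<Rightarrow> real" where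
  "H_tilde H q p = H q p (lam_tilde H q p) 0"

definition H_tilde_p :: "('n::finite, 'k::finite, 'l::finite) hamiltonian \<Rightarrow> real^'n \<Rightarrow> real^'n \<Rightarrow> real^'n" where
  "H_tilde_p H q p = grad (\<lambda>x. H_tilde H q x) p"

definition H_tilde_pp :: "('n::finite, 'k::finite, 'l::finite) hamiltonian \<Rightarrow> real^'n \<Rightarrow> real^'n \<Rightarrow> real^'n^'n" where
  "H_tilde_pp H q p = jacobian (\<lambda>x. H_tilde_p H q x) (at p)"

definition constraint_manifold ::
  "('n::finite, 'k::finite, 'l::finite) hamiltonian \<Rightarrow> (real^'n \<Rightarrow> real^'l) \<Rightarrow> ('n::finite phase) set" where
  "constraint_manifold H h =
     {(q, p). h q = 0 \<and> jacobian h (at q) *v H_tilde_p H q p = 0}"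

definition exact_solution ::
  "('n::finite, 'k::finite, 'l::finite) hamiltonian \<Rightarrow> real \<Rightarrow> (real \<Rightarrow> real^'n) \<Rightarrow> (real \<Rightarrow> real^'n)
    \<Rightarrow> (real \<Rightarrow> real^'k) \<Rightarrow> (real \<Rightarrow> real^'l) \<Rightarrow> bool" where
  "exact_solution H T q p lam lamh \<longleftrightarrow> (\<forall>t\<in>{0..T}.
     (q has_vector_derivative D_p H (q t) (p t) (lam t) (lamh t)) (at t within {0..T}) \<and>
     (p has_vector_derivative - D_q H (q t) (p t) (lam t) (lamh t)) (at t within {0..T}) \<and>
     D_lam H (q t) (p t) (lam t) (lamh t) = 0 \<and>
     D_lamh H (q t) (p t) (lam t) (lamh t) = 0)"


section \<open>RATTLE with the midpoint rule as inner step\<close>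

definition midpoint_step ::
  "('n::finite, 'k::finite, 'l::finite) hamiltonian \<Rightarrow> real \<Rightarrow> 'n phase \<Rightarrow> 'n phase \<Rightarrow> bool" where
  "midpoint_step H dt = (\<lambda>(q, p) (q', p'). \<exists>lam.
     q' - q = dt *\<^sub>R D_p H (midpoint q q') (midpoint p p') lam 0 \<and>
     p' - p = - dt *\<^sub>R D_q H (midpoint q q') (midpoint p p') lam 0 \<and>
     D_lam H (midpoint q q') (midpoint p p') lam 0 = 0)"

text \<open>The half-step momentum kick \<open>p \<mapsto> p - (dt/2) Dh(q)\<^sup>T \<mu>\<close>.\<close>

definition kick :: "(real^'n \<Rightarrow> real^'l) \<Rightarrow> real \<Rightarrow> real^'l \<Rightarrow> 'n phase \<Rightarrow> 'n phase" where
  "kick h dt \<mu> = (\<lambda>(q, p). (q, p - (dt / 2) *\<^sub>R (transpose (jacobian h (at q)) *v \<mu>)))"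

text \<open>\<open>rattle_step inner_step C h dt r z0 \<mu>0 zm \<mu>1 z1\<close>: the implicit RATTLE equations with step size
  \<open>dt\<close>, starting at \<open>z0 = (q0, p0)\<close> and ending at \<open>z1 = (q1, p1)\<close>, with \<open>zm = (q1, p1\<^sup>-)\<close> and
  multipliers \<open>\<mu>0\<close>, \<open>\<mu>1\<close>. Since kicks do not change the position, \<open>z1 \<in> C\<close> comprises both the
  condition on \<open>\<mu>0\<close> (that \<open>h q1 = 0\<close>) and the one on \<open>\<mu>1\<close> (the secondary constraint at
  \<open>z1\<close>). The radius \<open>r\<close> expresses that only solutions all of whose phase space points lie near
  \<open>z0\<close> are considered; the implicit equations may have other, spurious solutions.\<close>

definition rattle_step ::
  "(real \<Rightarrow> 'n::finite phase \<Rightarrow> 'n phase \<Rightarrow> bool) \<Rightarrow> ('n::finite phase) set \<Rightarrow> (real^'n \<Rightarrow> real^'l) \<Rightarrow>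
    real \<Rightarrow> real \<Rightarrow> 'n phase \<Rightarrow> real^'l \<Rightarrow> 'n phase \<Rightarrow> real^'l \<Rightarrow> 'n phase \<Rightarrow> bool" where
  "rattle_step inner_step C h dt r z0 \<mu>0 zm \<mu>1 z1 \<longleftrightarrow>
     inner_step dt (kick h dt \<mu>0 z0) zm \<and>
     z1 = kick h dt \<mu>1 zm \<and>
     z1 \<in> C \<and>
     kick h dt \<mu>0 z0 \<in> ball z0 r \<and> zm \<in> ball z0 r \<and> z1 \<in> ball z0 r"

text \<open>\<open>\<Phi> dt\<close> is the RATTLE map with step size \<open>dt\<close>: for all sufficiently small \<open>dt > 0\<close>, locally
  uniformly on the constraint manifold, the implicit equations have exactly one solution near the
  initial point, and \<open>\<Phi>\<close> returns its endpoint. Nothing is said about \<open>\<Phi>\<close> off the manifold or for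
  other step sizes.\<close>

definition rattle_midpoint_integrator ::
  "('n::finite, 'k::finite, 'l::finite) hamiltonian \<Rightarrow> (real^'n \<Rightarrow> real^'l) \<Rightarrow> (real \<Rightarrow> 'n phase \<Rightarrow> 'n phase) \<Rightarrow> bool" where
  "rattle_midpoint_integrator H h \<Phi> \<longleftrightarrow>
     (let C = constraint_manifold H h; step = rattle_step (midpoint_step H) C h in
      \<forall>K. compact K \<and> K \<subseteq> C \<longrightarrow>
        (\<exists>\<delta>>0. \<exists>r>0. \<forall>dt\<in>{0<..<\<delta>}. \<forall>z\<in>K.
           \<exists>\<mu>0 zm \<mu>1. step dt r z \<mu>0 zm \<mu>1 (\<Phi> dt z) \<and>
             (\<forall>\<mu>0' zm' \<mu>1' z1'. step dt r z \<mu>0' zm' \<mu>1' z1' \<longrightarrow>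
                \<mu>0' = \<mu>0 \<and> zm' = zm \<and> \<mu>1' = \<mu>1 \<and> z1' = \<Phi> dt z)))"


section \<open>Symplecticity on a submanifold and second order convergence\<close>

text \<open>The canonical two-form \<open>dq \<and> dp\<close>.\<close>

definition dq_wedge_dp :: "'n::finite phase \<Rightarrow> 'n phase \<Rightarrow> real" where
  "dq_wedge_dp u v = fst u \<bullet> snd v - fst v \<bullet> snd u"

text \<open>Velocities of curves in \<open>C\<close>; for an embedded submanifold \<open>C\<close>, its tangent space at \<open>z\<close>.\<close>

definition tangent_space :: "('a::real_normed_vector) set \<Rightarrow> 'a \<Rightarrow> 'a set" where
  "tangent_space C z = {v. \<exists>\<gamma>. \<gamma> 0 = z \<and> (\<forall>\<^sub>F t in nhds 0. \<gamma> t \<in> C) \<and>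
     (\<gamma> has_vector_derivative v) (at (0::real))}"

text \<open>The derivative within \<open>C\<close> is determined only on the tangent space of \<open>C\<close>, which is all that
  the pulled back form depends on.\<close>

definition symplectic_at :: "('n::finite phase) set \<Rightarrow> ('n phase \<Rightarrow> 'n phase) \<Rightarrow> 'n phase \<Rightarrow> bool" where
  "symplectic_at C f z \<longleftrightarrow> (\<exists>f'. (f has_derivative f') (at z within C) \<and>
     (\<forall>u\<in>tangent_space C z. \<forall>v\<in>tangent_space C z.
        dq_wedge_dp (f' u) (f' v) = dq_wedge_dp u v))"

definition symplectic_integrator_on ::
  "('n::finite phase) set \<Rightarrow> (real \<Rightarrow> 'n phase \<Rightarrow> 'n phase) \<Rightarrow> bool" where
  "symplectic_integrator_on C \<Phi> \<longleftrightarrow>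
     (\<forall>K. compact K \<and> K \<subseteq> C \<longrightarrow>
        (\<exists>\<delta>>0. \<forall>dt\<in>{0<..<\<delta>}. \<forall>z\<in>K. \<Phi> dt z \<in> C \<and> symplectic_at C (\<Phi> dt) z))"

definition second_order_convergent ::
  "('n::finite, 'k::finite, 'l::finite) hamiltonian \<Rightarrow> ('n::finite phase) set \<Rightarrow> (real \<Rightarrow> 'n phase \<Rightarrow> 'n phase) \<Rightarrow> bool" where
  "second_order_convergent H C \<Phi> \<longleftrightarrow>
     (\<forall>T>0. \<forall>q p lam lamh. exact_solution H T q p lam lamh \<and> (q 0, p 0) \<in> C \<longrightarrow>
        (\<exists>B. \<exists>\<delta>>0. \<forall>dt\<in>{0<..<\<delta>}. \<forall>j::nat. real j * dt \<le> T \<longrightarrow>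
           (\<Phi> dt ^^ j) (q 0, p 0) \<in> C \<and>
           dist ((\<Phi> dt ^^ j) (q 0, p 0)) (q (real j * dt), p (real j * dt)) \<le> B * dt ^ 2))"

end

theory Submission
  imports Defs
begin

text \<open>Eliminating \<open>\<lambda>\<close> turns the inner system into an ordinary Hamiltonian system: since
  \<open>H\<^sub>\<lambda> = 0\<close> is linear in \<open>\<lambda>\<close> with an invertible matrix, the reduced Hamiltonian is
  \<open>\<^bold>H(q, p) = \<onehalf> p \<cdot> A(q) p + V(q)\<close> with a smooth symmetric \<open>A\<close>, and \<open>H\<^sub>p\<close>, \<open>H\<^sub>q\<close> at the
  solution \<open>\<lambda>\<close> are the partial gradients \<open>A(q) p\<close> and \<open>f(q, p)\<close> of \<open>\<^bold>H\<close>. So the algorithm is RATTLE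
  with the midpoint rule for a smooth Hamiltonian with holonomic constraints.

  Existence and uniqueness. Take as unknowns the mean velocity \<open>v = (q\<^sub>1 - q\<^sub>0) / t\<close> and the
  midpoint momentum \<open>w\<close>. On the constraint manifold \<open>C\<close> the condition \<open>h(q\<^sub>1) = 0\<close>, divided by
  \<open>t\<^sup>2\<close>, and the secondary constraint at the endpoint, divided by \<open>t\<close>, determine both multipliers as
  smooth functions of \<open>t, q\<^sub>0, p\<^sub>0, v, w\<close>, with no singularity at \<open>t = 0\<close>. What remains is a fixed
  point equation \<open>y = \<Gamma>(t, z, y)\<close> for \<open>y = (v, w)\<close> whose right hand side is smooth and does not
  depend on \<open>y\<close> at \<open>t = 0\<close>. It is therefore a contraction for small \<open>t\<close>, uniformly for \<open>z\<close> in a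
  bounded set, and its solution is Lipschitz and differentiable in \<open>z\<close>
  (\<open>small_step_fixed_point.solution\<close>, \<open>reduced_system.integrator_flow\<close>).

  Symplecticity. Differentiating the equations of the step along tangent vectors, the midpoint rule
  preserves \<open>dq \<and> dp\<close> because the Hessian of \<open>\<^bold>H\<close> is symmetric, and so do the two kicks because the
  second derivative of \<open>h\<close> is symmetric and tangent vectors satisfy \<open>Dh(q) \<delta>q = 0\<close>, which removes
  the derivative of the multiplier (\<open>reduced_system.flow_preserves_form\<close>).

  Convergence. On \<open>C\<close> the exact solution follows a smooth vector field \<open>X\<close>, and the step is
  \<open>z \<mapsto> z + t X(z) + t\<^sup>2 D(z) + O(t\<^sup>3)\<close> with smooth \<open>D\<close>. The equations are invariant under exchanging
  the endpoints and reversing \<open>t\<close>, which forces \<open>2 D = X' X\<close>, the coefficient of the exact flow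
  (\<open>reduced_system.second_order_coefficient\<close>). The local error is thus \<open>O(t\<^sup>3)\<close>, and with the
  Lipschitz constant \<open>1 + O(t)\<close> of the step the global error is \<open>O(t\<^sup>2)\<close>.\<close>

section \<open>Calculus of smooth maps\<close>

lemma of_class_C_SucD: "of_class_C (Suc r) f \<Longrightarrow> of_class_C r f"
proof (induction r arbitrary: f)
  case 0
  then show ?case
    by (auto simp: continuous_on_eq_continuous_at differentiable_imp_continuous_within)
next
  case (Suc r)
  then show ?case by (metis of_class_C.simps(2))
qed

lemma of_class_C_Suc_I:
  assumes "\<And>x. (f has_derivative f' x) (at x)" and "\<And>v. of_class_C r (\<lambda>x. f' x v)"
  shows "of_class_C (Suc r) f"
proof -
  have "frechet_derivative f (at x) = f' x" for x
    using frechet_derivative_at[OF assms(1)] by simp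
  then show ?thesis
    using assms by (auto simp: differentiable_def)
qed

lemma of_class_C_has_derivative:
  "of_class_C (Suc r) f \<Longrightarrow> (f has_derivative frechet_derivative f (at x)) (at x)"
  using frechet_derivative_works by auto

lemma of_class_C_const [simp]: "of_class_C r (\<lambda>x. c)"
proof (induction r arbitrary: c)
  case (Suc r)
  show ?case by (rule of_class_C_Suc_I[where f' = "\<lambda>_ _. 0"]) (auto simp: Suc)
qed auto

lemma of_class_C_add:
  "of_class_C r f \<Longrightarrow> of_class_C r g \<Longrightarrow> of_class_C r (\<lambda>x. f x + g x)"
proof (induction r arbitrary: f g)
  case 0
  then show ?case by (auto intro: continuous_intros)
next
  case (Suc r)
  show ?case
    by (rule of_class_C_Suc_I, rule has_derivative_add)
      (use Suc in \<open>auto intro!: of_class_C_has_derivative Suc.IH\<close>)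
qed

lemma of_class_C_bounded_linear_compose:
  assumes "bounded_linear L"
  shows "of_class_C r f \<Longrightarrow> of_class_C r (\<lambda>x. L (f x))"
proof (induction r arbitrary: f)
  case 0
  then show ?case using assms by (auto intro: bounded_linear.continuous_on)
next
  case (Suc r)
  show ?case
    by (rule of_class_C_Suc_I, rule bounded_linear.has_derivative[OF assms])
      (use Suc in \<open>auto intro!: of_class_C_has_derivative Suc.IH\<close>)
qed

lemma of_class_C_bounded_bilinear:
  assumes "bounded_bilinear B"
  shows "of_class_C r f \<Longrightarrow> of_class_C r g \<Longrightarrow> of_class_C r (\<lambda>x. B (f x) (g x))"
proof (induction r arbitrary: f g)
  case 0
  then show ?case using assms by (auto intro: bounded_bilinear.continuous_on)
next
  case (Suc r)
  show ?case
    by (rule of_class_C_Suc_I, rule bounded_bilinear.FDERIV[OF assms])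
      (use Suc.prems of_class_C_SucD[OF Suc.prems(1)] of_class_C_SucD[OF Suc.prems(2)] in
        \<open>auto intro!: of_class_C_has_derivative of_class_C_add Suc.IH\<close>)
qed

lemma of_class_C_sum:
  assumes "\<And>i. i \<in> I \<Longrightarrow> of_class_C r (f i)"
  shows "of_class_C r (\<lambda>x. \<Sum>i\<in>I. f i x)"
  using assms by (induction I rule: infinite_finite_induct) (auto intro: of_class_C_add)

lemma has_derivative_eq_sum_Basis:
  fixes f :: "'a::euclidean_space \<Rightarrow> 'b::real_normed_vector"
  assumes "(f has_derivative f') F"
  shows "f' v = (\<Sum>b\<in>Basis. (v \<bullet> b) *\<^sub>R f' b)"
proof -
  have "linear f'" using assms has_derivative_linear by blast
  then have "f' (\<Sum>b\<in>Basis. (v \<bullet> b) *\<^sub>R b) = (\<Sum>b\<in>Basis. (v \<bullet> b) *\<^sub>R f' b)"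
    by (simp add: linear_sum linear_scale)
  then show ?thesis by (simp add: euclidean_representation)
qed

text \<open>The chain rule yields the derivative of \<open>f\<close> in a direction that varies with \<open>x\<close>. Expanding this
  direction in the standard basis leaves directional derivatives of \<open>f\<close> in fixed directions, to which
  the induction hypothesis applies.\<close>

lemma of_class_C_compose:
  fixes f :: "'a::euclidean_space \<Rightarrow> 'b::euclidean_space" and g :: "'c::euclidean_space \<Rightarrow> 'a"
  shows "of_class_C r f \<Longrightarrow> of_class_C r g \<Longrightarrow> of_class_C r (\<lambda>x. f (g x))"
proof (induction r arbitrary: f g)
  case 0
  then show ?case by (auto intro: continuous_on_compose2)
next
  case (Suc r)
  show ?case
  proof (rule of_class_C_Suc_I)
    show "((\<lambda>x. f (g x)) has_derivative
       (\<lambda>v. frechet_derivative f (at (g x)) (frechet_derivative g (at x) v))) (at x)" for x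
      using has_derivative_compose[OF of_class_C_has_derivative[OF Suc.prems(2)]
        of_class_C_has_derivative[OF Suc.prems(1)]] .
    fix v
    have "frechet_derivative f (at (g x)) (frechet_derivative g (at x) v) =
        (\<Sum>b\<in>Basis. (frechet_derivative g (at x) v \<bullet> b) *\<^sub>R frechet_derivative f (at (g x)) b)" for x
      using has_derivative_eq_sum_Basis[OF of_class_C_has_derivative[OF Suc.prems(1)]] .
    moreover have "of_class_C r (\<lambda>x. \<Sum>b\<in>Basis.
        (frechet_derivative g (at x) v \<bullet> b) *\<^sub>R frechet_derivative f (at (g x)) b)"
      by (intro of_class_C_sum of_class_C_bounded_bilinear[OF bounded_bilinear_scaleR]
         of_class_C_bounded_bilinear[OF bounded_bilinear_inner] Suc.IH)
        (use Suc.prems of_class_C_SucD in auto)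
    ultimately show "of_class_C r
        (\<lambda>x. frechet_derivative f (at (g x)) (frechet_derivative g (at x) v))" by simp
  qed
qed

lemma smooth_has_derivative:
  "smooth f \<Longrightarrow> (f has_derivative frechet_derivative f (at x)) (at x)"
  unfolding smooth_def using of_class_C_has_derivative by blast

lemma smooth_has_derivative_within:
  "smooth f \<Longrightarrow> (f has_derivative frechet_derivative f (at x)) (at x within S)"
  using smooth_has_derivative has_derivative_at_withinI by blast

lemma smooth_directional: "smooth f \<Longrightarrow> smooth (\<lambda>x. frechet_derivative f (at x) v)"
  unfolding smooth_def by (metis of_class_C.simps(2))

lemma smooth_I:
  assumes "\<And>x. (f has_derivative f' x) (at x)" and "\<And>v. smooth (\<lambda>x. f' x v)"
  shows "smooth f"
  using assms of_class_C_Suc_I of_class_C_SucD unfolding smooth_def by blast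

lemma smooth_continuous_on: "smooth f \<Longrightarrow> continuous_on S f"
  unfolding smooth_def by (metis of_class_C.simps(1) continuous_on_subset top_greatest)

lemma smooth_const: "smooth (\<lambda>x. c)"
  by (simp add: smooth_def)

lemma smooth_add: "smooth f \<Longrightarrow> smooth g \<Longrightarrow> smooth (\<lambda>x. f x + g x)"
  by (simp add: smooth_def of_class_C_add)

lemma smooth_bounded_linear_compose:
  "bounded_linear L \<Longrightarrow> smooth f \<Longrightarrow> smooth (\<lambda>x. L (f x))"
  by (simp add: smooth_def of_class_C_bounded_linear_compose)

lemma smooth_bounded_bilinear:
  "bounded_bilinear B \<Longrightarrow> smooth f \<Longrightarrow> smooth g \<Longrightarrow> smooth (\<lambda>x. B (f x) (g x))"
  by (simp add: smooth_def of_class_C_bounded_bilinear)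

lemma smooth_sum: "(\<And>i. i \<in> I \<Longrightarrow> smooth (f i)) \<Longrightarrow> smooth (\<lambda>x. \<Sum>i\<in>I. f i x)"
  by (simp add: smooth_def of_class_C_sum)

lemma smooth_compose:
  fixes f :: "'a::euclidean_space \<Rightarrow> 'b::euclidean_space" and g :: "'c::euclidean_space \<Rightarrow> 'a"
  shows "smooth f \<Longrightarrow> smooth g \<Longrightarrow> smooth (\<lambda>x. f (g x))"
  by (simp add: smooth_def of_class_C_compose)

lemma smooth_ident: "smooth (\<lambda>x. x)"
  by (rule smooth_I[OF has_derivative_ident]) (rule smooth_const)

lemma smooth_Pair:
  fixes f :: "'a::real_normed_vector \<Rightarrow> 'b::real_normed_vector"
    and g :: "'a \<Rightarrow> 'c::real_normed_vector"
  shows "smooth f \<Longrightarrow> smooth g \<Longrightarrow> smooth (\<lambda>x. (f x, g x))"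
proof -
  assume "smooth f" "smooth g"
  moreover have "bounded_linear (\<lambda>a::'b. (a, 0::'c))" "bounded_linear (\<lambda>b::'c. (0::'b, b))"
    by (rule bounded_linear_Pair bounded_linear_ident bounded_linear_zero)+
  ultimately have "smooth (\<lambda>x. (f x, 0) + (0, g x))"
    by (intro smooth_add smooth_bounded_linear_compose[where L = "\<lambda>a. (a, 0)"]
        smooth_bounded_linear_compose[where L = "\<lambda>b. (0, b)"])
  then show ?thesis by simp
qed

lemmas smooth_fst = smooth_bounded_linear_compose[OF bounded_linear_fst]
lemmas smooth_snd = smooth_bounded_linear_compose[OF bounded_linear_snd]
lemmas smooth_minus = smooth_bounded_linear_compose[OF bounded_linear_minus[OF bounded_linear_ident]]
lemmas smooth_scaleR = smooth_bounded_bilinear[OF bounded_bilinear_scaleR]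
lemmas smooth_mult = smooth_bounded_bilinear[OF bounded_bilinear_mult]
lemmas smooth_inner = smooth_bounded_bilinear[OF bounded_bilinear_inner]
lemmas smooth_vec_nth = smooth_bounded_linear_compose[OF bounded_linear_vec_nth]

lemma smooth_diff: "smooth f \<Longrightarrow> smooth g \<Longrightarrow> smooth (\<lambda>x. f x - g x)"
  using smooth_add[of f "\<lambda>x. - g x"] smooth_minus[of g] by simp

lemma smooth_prod:
  fixes f :: "'i \<Rightarrow> 'a::real_normed_vector \<Rightarrow> real"
  shows "(\<And>i. i \<in> I \<Longrightarrow> smooth (f i)) \<Longrightarrow> smooth (\<lambda>x. \<Prod>i\<in>I. f i x)"
  by (induction I rule: infinite_finite_induct) (auto intro: smooth_const smooth_mult)

lemma smooth_inverse:
  fixes f :: "'a::real_normed_vector \<Rightarrow> real"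
  assumes f: "smooth f" and nz: "\<And>x. f x \<noteq> 0"
  shows "smooth (\<lambda>x. inverse (f x))"
  unfolding smooth_def
proof
  fix r show "of_class_C r (\<lambda>x. inverse (f x))"
  proof (induction r)
    case 0
    show ?case using smooth_continuous_on[OF f] nz by (auto intro!: continuous_intros)
  next
    case (Suc r)
    show ?case
    proof (rule of_class_C_Suc_I)
      show "((\<lambda>x. inverse (f x)) has_derivative
          (\<lambda>v. - (inverse (f x) * frechet_derivative f (at x) v * inverse (f x)))) (at x)" for x
        by (rule Deriv.has_derivative_inverse[OF nz smooth_has_derivative[OF f]])
      have "of_class_C r (\<lambda>x. frechet_derivative f (at x) v)" for v
        using smooth_directional[OF f] by (auto simp: smooth_def)
      then show "of_class_C r (\<lambda>x. - (inverse (f x) * frechet_derivative f (at x) v * inverse (f x)))" for v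
        by (intro of_class_C_bounded_linear_compose[OF bounded_linear_minus[OF bounded_linear_ident]]
            of_class_C_bounded_bilinear[OF bounded_bilinear_mult] Suc)
    qed
  qed
qed

lemma bounded_bilinear_matrix_vector_mult:
  "bounded_bilinear ((*v) :: real^'n^'m \<Rightarrow> real^'n \<Rightarrow> real^'m)"
  unfolding bilinear_conv_bounded_bilinear[symmetric]
  by (auto simp: bilinear_def matrix_vector_mult_def vec_eq_iff algebra_simps sum.distrib
      sum_distrib_left intro!: linearI)

lemma bounded_bilinear_matrix_matrix_mult:
  "bounded_bilinear ((**) :: real^'n^'m \<Rightarrow> real^'k^'n \<Rightarrow> real^'k^'m)"
  unfolding bilinear_conv_bounded_bilinear[symmetric]
  by (auto simp: bilinear_def matrix_matrix_mult_def vec_eq_iff algebra_simps sum.distrib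
      sum_distrib_left intro!: linearI)

lemma bounded_linear_transpose: "bounded_linear (transpose :: real^'n^'m \<Rightarrow> real^'m^'n)"
  unfolding linear_conv_bounded_linear[symmetric]
  by (auto intro!: linearI simp: transpose_def vec_eq_iff)

lemmas smooth_matrix_vector_mult = smooth_bounded_bilinear[OF bounded_bilinear_matrix_vector_mult]
lemmas smooth_matrix_matrix_mult = smooth_bounded_bilinear[OF bounded_bilinear_matrix_matrix_mult]
lemmas smooth_transpose = smooth_bounded_linear_compose[OF bounded_linear_transpose]

lemma smooth_vec:
  fixes f :: "'a::real_normed_vector \<Rightarrow> 'b::euclidean_space^'n"
  assumes "\<And>i. smooth (\<lambda>x. f x $ i)"
  shows "smooth f"
proof -
  have bl: "bounded_linear (axis i :: 'b \<Rightarrow> 'b^'n)" for i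
    unfolding linear_conv_bounded_linear[symmetric]
    by (auto intro!: linearI simp: axis_def vec_eq_iff)
  have "f x = (\<Sum>i\<in>UNIV. axis i (f x $ i))" for x
    by (simp add: vec_eq_iff axis_def if_distrib[of "\<lambda>y. y $ _"] if_distribR sum.delta)
  moreover have "smooth (\<lambda>x. \<Sum>i\<in>UNIV. (axis i (f x $ i) :: 'b^'n))"
    by (intro smooth_sum smooth_bounded_linear_compose[OF bl] assms)
  ultimately show ?thesis by presburger
qed

lemma smooth_det:
  fixes X :: "'a::real_normed_vector \<Rightarrow> real^'n^'n"
  assumes "\<And>i j. smooth (\<lambda>x. X x $ i $ j)"
  shows "smooth (\<lambda>x. det (X x))"
  unfolding det_def by (intro smooth_sum smooth_mult smooth_prod smooth_const assms)

lemma matrix_inv_works: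
  fixes A :: "real^'n^'n"
  assumes "invertible A"
  shows "A ** matrix_inv A = mat 1" "matrix_inv A ** A = mat 1"
  using someI_ex[OF assms[unfolded invertible_def]] unfolding matrix_inv_def by auto

text \<open>By Cramer's rule the entries of the inverse are quotients of determinants, and a determinant is a
  polynomial in the entries.\<close>

lemma smooth_matrix_inv:
  fixes X :: "'a::real_normed_vector \<Rightarrow> real^'n^'n"
  assumes X: "smooth X" and inv: "\<And>x. invertible (X x)"
  shows "smooth (\<lambda>x. matrix_inv (X x))"
proof (intro smooth_vec)
  fix i j
  have nz: "det (X x) \<noteq> 0" for x
    using inv invertible_det_nz by blast
  have entry: "matrix_inv (X x) $ i $ j =
      det (\<chi> i' j'. if j' = i then axis j 1 $ i' else X x $ i' $ j') * inverse (det (X x))" for x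
  proof -
    have "X x *v (matrix_inv (X x) *v axis j 1) = axis j 1"
      by (simp add: matrix_vector_mul_assoc matrix_inv_works[OF inv])
    then have "matrix_inv (X x) *v axis j 1 =
        (\<chi> k. det(\<chi> i' j'. if j' = k then axis j 1 $ i' else X x $ i' $ j') / det (X x))"
      using cramer[OF nz] by blast
    then have "(matrix_inv (X x) *v axis j 1) $ i =
        det (\<chi> i' j'. if j' = i then axis j 1 $ i' else X x $ i' $ j') / det (X x)"
      by simp
    then show ?thesis
      by (simp add: matrix_vector_mult_basis column_def divide_inverse)
  qed
  show "smooth (\<lambda>x. matrix_inv (X x) $ i $ j)"
    unfolding entry
  proof (intro smooth_mult smooth_inverse smooth_det nz)
    fix i' j'
    show "smooth (\<lambda>x. (\<chi> i' j'. if j' = i then axis j 1 $ i' else X x $ i' $ j') $ i' $ j')"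
      by (cases "j' = i") (simp_all add: smooth_const smooth_vec_nth X)
  qed (intro smooth_vec_nth X)
qed

text \<open>Differentiation under the integral sign. As the derivative of \<open>g\<close> in a fixed direction is again
  smooth, the lemma can be iterated.\<close>

lemma has_derivative_integral_parameter:
  fixes g :: "real \<times> 'a::euclidean_space \<Rightarrow> 'b::euclidean_space"
  assumes g: "smooth g"
  shows "((\<lambda>x. integral {0..1} (\<lambda>s. g (s, x))) has_derivative
     (\<lambda>v. integral {0..1} (\<lambda>s. frechet_derivative g (at (s, x)) (0, v)))) (at x)"
proof -
  have D: "(g has_derivative frechet_derivative g (at z)) (at z)" for z
    by (rule smooth_has_derivative[OF g])
  have lin: "bounded_linear (\<lambda>v. frechet_derivative g (at (s, x)) (0, v))" for s x
    using bounded_linear_compose[OF has_derivative_bounded_linear[OF D]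
        bounded_linear_Pair[OF bounded_linear_zero bounded_linear_ident]] .
  define fx where "fx x s = Blinfun (\<lambda>v. frechet_derivative g (at (s, x)) (0, v))" for x s
  have fx: "blinfun_apply (fx x s) v = frechet_derivative g (at (s, x)) (0, v)" for x s v
    by (simp add: fx_def bounded_linear_Blinfun_apply[OF lin])
  have cont_dir: "continuous_on S (\<lambda>s. frechet_derivative g (at (\<phi> s)) w)"
    if "continuous_on S \<phi>" for S :: "'c::topological_space set" and \<phi> w
    using continuous_on_compose2[OF smooth_continuous_on[OF smooth_directional[OF g], of UNIV] that]
    by auto
  have cont: "continuous_on (UNIV \<times> cbox 0 1) (\<lambda>(x, s). fx x s)"
    unfolding split_beta
    by (rule continuous_on_blinfun_componentwise)
       (simp add: fx, intro cont_dir continuous_intros)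
  have D_int: "((\<lambda>x. integral (cbox 0 1) (\<lambda>s. g (s, x))) has_derivative
      integral (cbox 0 1) (fx x)) (at x within UNIV)"
  proof (rule leibniz_rule[OF _ _ cont])
    show "((\<lambda>x. g (s, x)) has_derivative blinfun_apply (fx x s)) (at x within UNIV)" for x s
      using has_derivative_compose[OF has_derivative_Pair[OF has_derivative_const has_derivative_ident] D, of s x UNIV]
      by (simp add: fx[abs_def])
    show "(\<lambda>s. g (s, x)) integrable_on cbox 0 1" for x
      by (intro integrable_continuous continuous_on_compose2[OF smooth_continuous_on[OF g, of UNIV]]
          continuous_intros) auto
  qed auto
  have int: "fx x integrable_on cbox 0 1"
    by (intro integrable_continuous continuous_on_blinfun_componentwise)
       (simp add: fx, intro cont_dir continuous_intros)
  have "blinfun_apply (integral (cbox 0 1) (fx x)) =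
      (\<lambda>v. integral (cbox 0 1) (\<lambda>s. frechet_derivative g (at (s, x)) (0, v)))"
    by (rule ext) (simp only: blinfun_apply_integral[OF int] fx)
  with D_int show ?thesis by simp
qed

lemma smooth_integral_parameter:
  fixes g :: "real \<times> 'a::euclidean_space \<Rightarrow> 'b::euclidean_space"
  assumes "smooth g"
  shows "smooth (\<lambda>x. integral {0..1} (\<lambda>s. g (s, x)))"
proof -
  have "of_class_C r (\<lambda>x. integral {0..1} (\<lambda>s. g (s, x)))" for r
    using assms
  proof (induction r arbitrary: g)
    case 0
    then show ?case
      using has_derivative_continuous[OF has_derivative_integral_parameter[OF 0]]
      by (simp add: continuous_at_imp_continuous_on)
  next
    case (Suc r)
    show ?case
      by (rule of_class_C_Suc_I[OF has_derivative_integral_parameter[OF Suc.prems]])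
         (rule Suc.IH[OF smooth_directional[OF Suc.prems]])
  qed
  then show ?thesis by (simp add: smooth_def)
qed

lemma smooth_derivative_pair:
  fixes f :: "'a::euclidean_space \<Rightarrow> 'b::euclidean_space" and g :: "'c::euclidean_space \<Rightarrow> 'a"
  assumes f: "smooth f" and "smooth g" "smooth v"
  shows "smooth (\<lambda>x. frechet_derivative f (at (g x)) (v x))"
proof -
  have eq: "(\<lambda>x. frechet_derivative f (at (g x)) (v x)) =
      (\<lambda>x. \<Sum>b\<in>Basis. (v x \<bullet> b) *\<^sub>R frechet_derivative f (at (g x)) b)"
    by (rule ext, rule has_derivative_eq_sum_Basis[OF smooth_has_derivative[OF f]])
  have "smooth (\<lambda>x. \<Sum>b\<in>Basis. (v x \<bullet> b) *\<^sub>R frechet_derivative f (at (g x)) b)"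
    by (rule smooth_sum, rule smooth_scaleR, rule smooth_inner, rule assms(3), rule smooth_const,
        rule smooth_compose[OF smooth_directional[OF f] assms(2)])
  then show ?thesis by (subst eq)
qed

text \<open>Hadamard's quotient \<open>(f (x + t v) - f x) / t\<close>, as an integral that makes sense and is smooth at
  \<open>t = 0\<close> too.\<close>

definition divided_difference ::
    "('a::euclidean_space \<Rightarrow> 'b::euclidean_space) \<Rightarrow> real \<times> 'a \<times> 'a \<Rightarrow> 'b" where
  "divided_difference f = (\<lambda>(t, x, v).
     integral {0..1} (\<lambda>s. frechet_derivative f (at (x + (s * t) *\<^sub>R v)) v))"

lemma smooth_divided_difference:
  fixes f :: "'a::euclidean_space \<Rightarrow> 'b::euclidean_space"
  assumes f: "smooth f"
  shows "smooth (divided_difference f)"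
proof -
  define g where "g = (\<lambda>(s, t, x, v). frechet_derivative f (at (x + (s * t) *\<^sub>R v)) v)"
  have "smooth g"
    unfolding g_def split_beta
    by (intro smooth_derivative_pair smooth_add smooth_scaleR smooth_mult smooth_fst smooth_snd
        smooth_ident f)
  then have "smooth (\<lambda>z. integral {0..1} (\<lambda>s. g (s, z)))" by (rule smooth_integral_parameter)
  then show ?thesis by (simp add: divided_difference_def g_def case_prod_unfold)
qed

lemma divided_difference_eq:
  fixes f :: "'a::euclidean_space \<Rightarrow> 'b::euclidean_space"
  assumes f: "smooth f"
  shows "f (x + t *\<^sub>R v) = f x + t *\<^sub>R divided_difference f (t, x, v)"
proof -
  let ?g = "\<lambda>s. frechet_derivative f (at (x + (s * t) *\<^sub>R v)) v"
  have deriv: "((\<lambda>s. f (x + (s * t) *\<^sub>R v)) has_vector_derivative t *\<^sub>R ?g s) (at s within {0..1})" for s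
  proof -
    have "((\<lambda>s. x + (s * t) *\<^sub>R v) has_derivative (\<lambda>r. (r * t) *\<^sub>R v)) (at s within {0..1})"
      by (auto intro!: derivative_eq_intros)
    from has_derivative_compose[OF this smooth_has_derivative[OF f]]
    show ?thesis
      by (simp add: has_vector_derivative_def
          linear_scale[OF has_derivative_linear[OF smooth_has_derivative[OF f]]])
  qed
  have "integral {0..1} (\<lambda>s. t *\<^sub>R ?g s) = f (x + (1 * t) *\<^sub>R v) - f (x + (0 * t) *\<^sub>R v)"
    by (rule integral_unique[OF fundamental_theorem_of_calculus[OF zero_le_one deriv]])
  then show ?thesis by (simp add: divided_difference_def algebra_simps)
qed

lemma divided_difference_zero:
  "divided_difference f (0, x, v) = frechet_derivative f (at x) v"
  by (simp add: divided_difference_def)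

text \<open>The quotient \<open>(f (t, x) - f (0, x)) / t\<close>.\<close>

definition time_quotient ::
    "(real \<times> 'a::euclidean_space \<Rightarrow> 'b::euclidean_space) \<Rightarrow> real \<times> 'a \<Rightarrow> 'b" where
  "time_quotient f = (\<lambda>(t, x). divided_difference f (t, (0, x), (1, 0)))"

lemma smooth_time_quotient:
  fixes f :: "real \<times> 'a::euclidean_space \<Rightarrow> 'b::euclidean_space"
  shows "smooth f \<Longrightarrow> smooth (time_quotient f)"
  unfolding time_quotient_def split_beta
  by (intro smooth_compose[OF smooth_divided_difference] smooth_Pair smooth_ident smooth_const
      smooth_fst smooth_snd)

lemma time_quotient_eq:
  fixes f :: "real \<times> 'a::euclidean_space \<Rightarrow> 'b::euclidean_space"
  shows "smooth f \<Longrightarrow> f (t, x) = f (0, x) + t *\<^sub>R time_quotient f (t, x)"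
  using divided_difference_eq[of f "(0, x)" t "(1, 0)"] by (simp add: time_quotient_def)


section \<open>Symmetry of second derivatives and bounds on bounded sets\<close>

lemma tendsto_at_zero_smooth:
  assumes "smooth F"
  shows "((\<lambda>s::real. F s) \<longlongrightarrow> F 0) (at 0)"
  using smooth_continuous_on[OF assms, of UNIV]
  by (simp add: continuous_on_eq_continuous_at isCont_def)

text \<open>Dividing the second difference by \<open>s\<close> along \<open>v\<close> and again along \<open>u\<close> gives a smooth function of \<open>s\<close>
  whose value at \<open>0\<close> is the iterated derivative. Since the second difference is symmetric in \<open>u\<close> and
  \<open>v\<close>, so is its limit.\<close>

lemma second_difference_quotient_tendsto:
  fixes f :: "'a::euclidean_space \<Rightarrow> 'b::euclidean_space"
  assumes f: "smooth f"
  shows "((\<lambda>s. (1 / s\<^sup>2) *\<^sub>R (f (x + s *\<^sub>R u + s *\<^sub>R v) - f (x + s *\<^sub>R u) - f (x + s *\<^sub>R v) + f x))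
    \<longlongrightarrow> frechet_derivative (\<lambda>y. frechet_derivative f (at y) v) (at x) u) (at 0)"
proof -
  define Q where "Q = divided_difference f"
  have Q: "smooth Q" "\<And>t x v. f (x + t *\<^sub>R v) = f x + t *\<^sub>R Q (t, x, v)"
      "\<And>x v. Q (0, x, v) = frechet_derivative f (at x) v"
    unfolding Q_def
    by (rule smooth_divided_difference[OF f] divided_difference_eq[OF f] divided_difference_zero)+
  define R where "R = divided_difference Q"
  have R: "smooth R" "\<And>t z w. Q (z + t *\<^sub>R w) = Q z + t *\<^sub>R R (t, z, w)"
      "\<And>z w. R (0, z, w) = frechet_derivative Q (at z) w"
    unfolding R_def
    by (rule smooth_divided_difference[OF Q(1)] divided_difference_eq[OF Q(1)] divided_difference_zero)+
  have "((\<lambda>y. Q (0, y, v)) has_derivative (\<lambda>h. frechet_derivative Q (at (0, x, v)) (0, h, 0))) (at x)"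
    using has_derivative_compose[OF has_derivative_Pair[OF has_derivative_const
        has_derivative_Pair[OF has_derivative_ident has_derivative_const]]
        smooth_has_derivative[OF Q(1)], of 0 v x UNIV] by simp
  then have "frechet_derivative (\<lambda>y. frechet_derivative f (at y) v) (at x) u =
      frechet_derivative Q (at (0, x, v)) (0, u, 0)"
    unfolding Q(3) by (rule frechet_derivative_at[THEN fun_cong, symmetric])
  also have "\<dots> = R (0, (0, x, v), (0, u, 0))" by (simp add: R(3))
  finally have lim: "frechet_derivative (\<lambda>y. frechet_derivative f (at y) v) (at x) u
      = R (0, (0, x, v), (0, u, 0))" .
  have eq: "f (x + s *\<^sub>R u + s *\<^sub>R v) - f (x + s *\<^sub>R u) - f (x + s *\<^sub>R v) + f x =
      s\<^sup>2 *\<^sub>R R (s, (s, x, v), (0, u, 0))" for s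
  proof -
    have "Q (s, x + s *\<^sub>R u, v) = Q (s, x, v) + s *\<^sub>R R (s, (s, x, v), (0, u, 0))"
      using R(2)[of "(s, x, v)" s "(0, u, 0)"] by simp
    then show ?thesis
      by (simp add: Q(2)[of "x + s *\<^sub>R u"] Q(2)[of x s v] scaleR_add_right power2_eq_square)
  qed
  have "smooth (\<lambda>s. R (s, (s, x, v), (0, u, 0)))"
    by (intro smooth_compose[OF R(1)] smooth_Pair smooth_ident smooth_const)
  then have "((\<lambda>s. R (s, (s, x, v), (0, u, 0))) \<longlongrightarrow> R (0, (0, x, v), (0, u, 0))) (at 0)"
    by (rule tendsto_at_zero_smooth)
  moreover have "\<forall>\<^sub>F s in at 0. R (s, (s, x, v), (0, u, 0)) = (1 / s\<^sup>2) *\<^sub>R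
      (f (x + s *\<^sub>R u + s *\<^sub>R v) - f (x + s *\<^sub>R u) - f (x + s *\<^sub>R v) + f x)"
    unfolding eq by (simp add: eventually_at_filter)
  ultimately show ?thesis
    unfolding lim by (rule Lim_transform_eventually)
qed

lemma symmetric_second_derivative:
  fixes f :: "'a::euclidean_space \<Rightarrow> 'b::euclidean_space"
  assumes "smooth f"
  shows "frechet_derivative (\<lambda>y. frechet_derivative f (at y) v) (at x) u =
    frechet_derivative (\<lambda>y. frechet_derivative f (at y) u) (at x) v"
  by (rule LIM_unique[OF second_difference_quotient_tendsto[OF assms, of x u v]])
    (use second_difference_quotient_tendsto[OF assms, of x v u] in \<open>simp add: algebra_simps\<close>)

lemma smooth_bounded_on:
  fixes f :: "'a::euclidean_space \<Rightarrow> 'b::euclidean_space"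
  assumes "smooth f" "bounded S"
  obtains M where "M > 0" "\<And>x. x \<in> S \<Longrightarrow> norm (f x) \<le> M"
proof -
  have "compact (f ` closure S)"
    using assms by (intro compact_continuous_image smooth_continuous_on) (auto simp: compact_closure)
  then obtain M where "M > 0" "\<forall>y\<in>f ` closure S. norm y \<le> M"
    using compact_imp_bounded bounded_pos by metis
  then show ?thesis using that closure_subset by blast
qed

lemma smooth_derivative_bounded_on:
  fixes f :: "'a::euclidean_space \<Rightarrow> 'b::euclidean_space"
  assumes f: "smooth f" and S: "bounded S"
  obtains L where "L > 0" "\<And>x v. x \<in> S \<Longrightarrow> norm (frechet_derivative f (at x) v) \<le> L * norm v"
proof -
  have "\<exists>M>0. \<forall>x\<in>S. norm (frechet_derivative f (at x) b) \<le> M" for b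
    using smooth_bounded_on[OF smooth_directional[OF f] S] by metis
  then obtain M where M: "\<And>b. M b > 0" "\<And>b x. x \<in> S \<Longrightarrow> norm (frechet_derivative f (at x) b) \<le> M b"
    by metis
  show ?thesis
  proof (rule that)
    show "(\<Sum>b\<in>(Basis::'a set). M b) > 0" using M by (intro sum_pos) auto
    fix x v assume x: "x \<in> S"
    have "norm (frechet_derivative f (at x) v) =
        norm (\<Sum>b\<in>Basis. (v \<bullet> b) *\<^sub>R frechet_derivative f (at x) b)"
      using has_derivative_eq_sum_Basis[OF smooth_has_derivative[OF f]] by metis
    also have "\<dots> \<le> (\<Sum>b\<in>Basis. norm v * M b)"
      by (rule order_trans[OF norm_sum], rule sum_mono)
        (auto intro!: mult_mono Basis_le_norm M x)
    finally show "norm (frechet_derivative f (at x) v) \<le> (\<Sum>b\<in>Basis. M b) * norm v"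
      by (simp add: sum_distrib_left sum_distrib_right mult.commute)
  qed
qed

lemma smooth_lipschitz_on_bounded:
  fixes f :: "'a::euclidean_space \<Rightarrow> 'b::euclidean_space"
  assumes f: "smooth f" and S: "bounded S"
  obtains L where "L > 0" "\<And>x y. x \<in> S \<Longrightarrow> y \<in> S \<Longrightarrow> norm (f x - f y) \<le> L * norm (x - y)"
proof -
  obtain r where r: "S \<subseteq> cball 0 r"
    using S by (auto simp: bounded_iff subset_iff)
  obtain L where L: "L > 0"
      "\<And>x v. x \<in> cball 0 r \<Longrightarrow> norm (frechet_derivative f (at x) v) \<le> L * norm v"
    using smooth_derivative_bounded_on[OF f bounded_cball] by metis
  have "norm (f x - f y) \<le> L * norm (x - y)" if "x \<in> cball 0 r" "y \<in> cball 0 r" for x y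
    by (rule differentiable_bound[OF convex_cball smooth_has_derivative_within[OF f] _ that])
      (intro onorm_le L)
  then show ?thesis using that L(1) r by blast
qed

section \<open>Fixed points depending on a small step size\<close>

text \<open>Implicit differentiation: \<open>y' u = F' (u, y' u)\<close> is solvable because the partial derivative of \<open>F\<close> in
  \<open>y\<close> has norm at most \<open>1/2\<close>. The Lipschitz bound on \<open>y\<close> turns the error term of \<open>F\<close>, which is small
  compared with the norm of \<open>(z - z0, y z - y z0)\<close>, into one that is small compared with the norm of
  \<open>z - z0\<close>.\<close>

lemma fixed_point_has_derivative:
  fixes F :: "'z::euclidean_space \<times> 'y::euclidean_space \<Rightarrow> 'y" and y :: "'z \<Rightarrow> 'y"
  assumes fp: "\<forall>\<^sub>F z in nhds z0. y z = F (z, y z)"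
    and lip: "\<forall>\<^sub>F z in nhds z0. norm (y z - y z0) \<le> L * norm (z - z0)"
    and F: "(F has_derivative F') (at (z0, y z0))"
    and contr: "\<And>k. norm (F' (0, k)) \<le> 1/2 * norm k"
  obtains y' where "(y has_derivative y') (at z0)"
proof -
  have F': "bounded_linear F'" using F has_derivative_bounded_linear by blast
  then have linF': "linear F'" by (rule bounded_linear.linear)
  define T where "T k = k - F' (0, k)" for k
  have "linear (\<lambda>k. F' (0, k))"
    by (rule linear_compose[OF _ linF', unfolded o_def]) (auto intro: linearI)
  then have linT: "linear T"
    using linear_compose_sub[OF linear_ident] unfolding T_def by blast
  have Tlow: "norm k \<le> 2 * norm (T k)" for k
    using contr[of k] norm_triangle_ineq2[of k "F' (0, k)"] by (simp add: T_def)
  then have "inj T"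
    by (metis linT linear_injective_0 norm_zero mult_zero_right norm_le_zero_iff)
  then obtain Ti where linTi: "linear Ti" and Ti: "\<And>k. T (Ti k) = k" "\<And>k. Ti (T k) = k"
    using linear_injective_isomorphism[OF linT] by blast
  have Ti_le: "norm (Ti k) \<le> 2 * norm k" for k
    using Tlow[of "Ti k"] Ti by simp
  define y' where "y' u = Ti (F' (u, 0))" for u
  have "linear (\<lambda>u. F' (u, 0))"
    by (rule linear_compose[OF _ linF', unfolded o_def]) (auto intro: linearI)
  then have liny': "bounded_linear y'"
    unfolding y'_def linear_conv_bounded_linear[symmetric]
    by (rule linear_compose[OF _ linTi, unfolded o_def])
  define L' where "L' = 1 + \<bar>L\<bar>"
  have L': "L' > 0" by (simp add: L'_def)
  have "(y has_derivative y') (at z0)"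
    unfolding has_derivative_at_alt
  proof (intro conjI allI impI liny')
    fix e :: real assume e: "e > 0"
    then have "e / (2 * L') > 0" using L' by simp
    then obtain d where d: "d > 0" "\<And>x. norm (x - (z0, y z0)) < d \<Longrightarrow>
        norm (F x - F (z0, y z0) - F' (x - (z0, y z0))) \<le> e / (2 * L') * norm (x - (z0, y z0))"
      using F unfolding has_derivative_at_alt by metis
    obtain d1 where d1: "d1 > 0" "\<And>z. dist z z0 < d1 \<Longrightarrow> y z = F (z, y z)"
      using fp unfolding eventually_nhds_metric by blast
    obtain d2 where d2: "d2 > 0" "\<And>z. dist z z0 < d2 \<Longrightarrow> norm (y z - y z0) \<le> L * norm (z - z0)"
      using lip unfolding eventually_nhds_metric by blast
    show "\<exists>d>0. \<forall>z. norm (z - z0) < d \<longrightarrow> norm (y z - y z0 - y' (z - z0)) \<le> e * norm (z - z0)"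
    proof (intro exI conjI allI impI)
      show "min (d / L') (min d1 d2) > 0" using d d1 d2 L' by simp
      fix z assume z: "norm (z - z0) < min (d / L') (min d1 d2)"
      let ?x = "(z, y z) - (z0, y z0)"
      have "norm (y z - y z0) \<le> \<bar>L\<bar> * norm (z - z0)"
        using d2(2)[of z] z mult_right_mono[OF abs_ge_self[of L] norm_ge_zero[of "z - z0"]]
        by (simp add: dist_norm)
      then have x_le: "norm ?x \<le> L' * norm (z - z0)"
        using norm_Pair_le[of "z - z0" "y z - y z0"] by (simp add: L'_def algebra_simps)
      also have "\<dots> < d" using z L' by (simp add: field_simps)
      finally have "norm ?x < d" .
      then have rho: "norm (F (z, y z) - F (z0, y z0) - F' ?x) \<le> e / (2 * L') * norm ?x"
        by (rule d(2))
      have split: "F' ?x = F' (z - z0, 0) + F' (0, y z - y z0)"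
        using linear_add[OF linF', of "(z - z0, 0)" "(0, y z - y z0)"] by simp
      have "y z - y z0 - y' (z - z0) = Ti (T (y z - y z0) - F' (z - z0, 0))"
        by (simp add: linear_diff[OF linTi] Ti y'_def)
      also have "T (y z - y z0) - F' (z - z0, 0) = F (z, y z) - F (z0, y z0) - F' ?x"
        using d1(2)[of z] d1(2)[of z0] d1(1) z unfolding split
        by (simp add: T_def dist_norm)
      finally have "norm (y z - y z0 - y' (z - z0)) \<le> 2 * norm (F (z, y z) - F (z0, y z0) - F' ?x)"
        using Ti_le by metis
      also have "\<dots> \<le> 2 * (e / (2 * L') * norm ?x)"
        by (rule mult_left_mono[OF rho]) simp
      also have "\<dots> \<le> 2 * (e / (2 * L') * (L' * norm (z - z0)))"
        by (intro mult_left_mono x_le) (use e L' in auto)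
      also have "\<dots> = e * norm (z - z0)" using L' by simp
      finally show "norm (y z - y z0 - y' (z - z0)) \<le> e * norm (z - z0)" .
    qed
  qed
  then show ?thesis using that by blast
qed

text \<open>Since \<open>\<Gamma>\<close> is independent of \<open>y\<close> at \<open>t = 0\<close>, it has the form \<open>\<Gamma> (0, z, 0) + t \<Delta> (t, z, y)\<close> with
  smooth \<open>\<Delta>\<close>.\<close>

locale small_step_fixed_point =
  fixes \<Gamma> :: "real \<times> 'z::euclidean_space \<times> 'y::euclidean_space \<Rightarrow> 'y"
  assumes smooth_\<Gamma>: "smooth \<Gamma>" and \<Gamma>_zero: "\<Gamma> (0, z, y) = \<Gamma> (0, z, y')"
begin

lemma smooth_\<Gamma>_compose:
  "smooth a \<Longrightarrow> smooth b \<Longrightarrow> smooth c \<Longrightarrow> smooth (\<lambda>x. \<Gamma> (a x, b x, c x))"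
  for a :: "'a::euclidean_space \<Rightarrow> real"
  by (intro smooth_compose[OF smooth_\<Gamma>] smooth_Pair)

text \<open>On bounded sets \<open>\<Delta>\<close> and its derivative are bounded, so a small factor \<open>t\<close> makes \<open>\<Gamma> (t, z, _)\<close> a
  contraction of a ball. The lower bound \<open>Rmin\<close> on the radius of this ball is free, so that uniqueness
  extends to all fixed points obeying a bound known beforehand.\<close>

lemma solution:
  assumes K: "bounded K"
  obtains R \<delta> L Y where "R \<ge> Rmin" "\<delta> > 0" "L > 0"
    "\<And>t z. \<bar>t\<bar> < \<delta> \<Longrightarrow> z \<in> K \<Longrightarrow> norm (Y t z) \<le> R \<and> \<Gamma> (t, z, Y t z) = Y t z"
    "\<And>t z y. \<bar>t\<bar> < \<delta> \<Longrightarrow> z \<in> K \<Longrightarrow> norm y \<le> R \<Longrightarrow> \<Gamma> (t, z, y) = y \<Longrightarrow> y = Y t z"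
    "\<And>t z z'. \<bar>t\<bar> < \<delta> \<Longrightarrow> z \<in> K \<Longrightarrow> z' \<in> K \<Longrightarrow> norm (Y t z - Y t z') \<le> L * norm (z - z')"
    "\<And>t z. \<bar>t\<bar> < \<delta> \<Longrightarrow> z \<in> interior K \<Longrightarrow> \<exists>y'. (Y t has_derivative y') (at z)"
proof -
  define \<Delta> where "\<Delta> = time_quotient \<Gamma>"
  have \<Delta>: "smooth \<Delta>" "\<Gamma> (t, x) = \<Gamma> (0, x) + t *\<^sub>R \<Delta> (t, x)" for t x
    unfolding \<Delta>_def by (rule smooth_time_quotient time_quotient_eq smooth_\<Gamma>)+
  have \<Gamma>_eq: "\<Gamma> (t, z, y) = \<Gamma> (0, z, 0) + t *\<^sub>R \<Delta> (t, z, y)" for t z y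
    using \<Delta>(2)[of t "(z, y)"] \<Gamma>_zero[of z y 0] by simp
  have sm0: "smooth (\<lambda>z. \<Gamma> (0, z, 0))"
    by (intro smooth_\<Gamma>_compose smooth_ident smooth_const)
  obtain M0 where M0: "M0 > 0" "\<And>z. z \<in> K \<Longrightarrow> norm (\<Gamma> (0, z, 0)) \<le> M0"
    using smooth_bounded_on[OF sm0 K] by metis
  obtain L0 where L0: "L0 > 0" "\<And>z z'. z \<in> K \<Longrightarrow> z' \<in> K \<Longrightarrow>
      norm (\<Gamma> (0, z, 0) - \<Gamma> (0, z', 0)) \<le> L0 * norm (z - z')"
    using smooth_lipschitz_on_bounded[OF sm0 K] by metis
    define R where "R = max Rmin (M0 + 1)"
    have R: "R \<ge> Rmin" "R \<ge> M0 + 1" by (simp_all add: R_def)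
    define S where "S = {-1..1::real} \<times> K \<times> cball (0::'y) R"
    have S: "bounded S" unfolding S_def by (intro bounded_Times K bounded_cball) simp
    obtain M where M: "M > 0" "\<And>x. x \<in> S \<Longrightarrow> norm (\<Delta> x) \<le> M"
      using smooth_bounded_on[OF \<Delta>(1) S] by metis
    obtain L where L: "L > 0" "\<And>x y. x \<in> S \<Longrightarrow> y \<in> S \<Longrightarrow> norm (\<Delta> x - \<Delta> y) \<le> L * norm (x - y)"
      using smooth_lipschitz_on_bounded[OF \<Delta>(1) S] by metis
    obtain L' where L': "L' > 0" "\<And>x v. x \<in> S \<Longrightarrow> norm (frechet_derivative \<Delta> (at x) v) \<le> L' * norm v"
      using smooth_derivative_bounded_on[OF \<Delta>(1) S] by metis
    \<comment> \<open>the bounds needed for the ball to be mapped into itself, for the contraction and for the derivative\<close>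
    define \<delta> where "\<delta> = min 1 (min (1 / M) (min (1 / (2 * L)) (1 / (2 * L'))))"
    have \<delta>: "\<delta> > 0" using M L L' by (simp add: \<delta>_def)
    have t: "\<bar>t\<bar> \<le> 1" "\<bar>t\<bar> * M \<le> 1" "\<bar>t\<bar> * L \<le> 1/2" "\<bar>t\<bar> * L' \<le> 1/2" if "\<bar>t\<bar> < \<delta>" for t
    proof -
      have *: "\<bar>t\<bar> < 1 / M" "\<bar>t\<bar> < 1 / (2 * L)" "\<bar>t\<bar> < 1 / (2 * L')" "\<bar>t\<bar> < 1"
        using that by (simp_all add: \<delta>_def)
      from * M(1) L(1) L'(1)
      show "\<bar>t\<bar> \<le> 1" "\<bar>t\<bar> * M \<le> 1" "\<bar>t\<bar> * L \<le> 1/2" "\<bar>t\<bar> * L' \<le> 1/2"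
        by (simp_all add: pos_less_divide_eq)
    qed
    have mem: "(t, z, y) \<in> S" if "\<bar>t\<bar> < \<delta>" "z \<in> K" "norm y \<le> R" for t z y
      using t(1)[OF that(1)] that(2,3) by (simp add: S_def abs_le_iff)
    have into: "norm (\<Gamma> (t, z, y)) \<le> R" if "\<bar>t\<bar> < \<delta>" "z \<in> K" "norm y \<le> R" for t z y
    proof -
      have "norm (\<Gamma> (t, z, y)) \<le> norm (\<Gamma> (0, z, 0)) + \<bar>t\<bar> * norm (\<Delta> (t, z, y))"
        unfolding \<Gamma>_eq[of t z y] by (rule order_trans[OF norm_triangle_ineq]) simp
      also have "\<dots> \<le> M0 + \<bar>t\<bar> * M"
        by (intro add_mono mult_left_mono M0 M mem that) auto
      finally show ?thesis using t(2)[OF that(1)] R(2) by simp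
    qed
    have lip: "norm (\<Gamma> (t, z, y) - \<Gamma> (t, z', y')) \<le> (L0 + 1/2) * norm (z - z') + 1/2 * norm (y - y')"
      if tz: "\<bar>t\<bar> < \<delta>" "z \<in> K" "z' \<in> K" "norm y \<le> R" "norm y' \<le> R" for t z z' y y'
    proof -
      have "norm ((t, z, y) - (t, z', y')) \<le> norm (z - z') + norm (y - y')"
        using norm_Pair_le[of "z - z'" "y - y'"] by (simp add: norm_Pair[of 0])
      then have "\<bar>t\<bar> * norm (\<Delta> (t, z, y) - \<Delta> (t, z', y')) \<le> \<bar>t\<bar> * (L * (norm (z - z') + norm (y - y')))"
        using L(2)[OF mem[OF tz(1,2,4)] mem[OF tz(1,3,5)]] L(1)
        by (intro mult_left_mono) (auto intro: order_trans mult_left_mono)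
      also have "\<dots> \<le> 1/2 * (norm (z - z') + norm (y - y'))"
        using mult_right_mono[OF t(3)[OF tz(1)], of "norm (z - z') + norm (y - y')"]
        by (simp add: mult.assoc)
      finally have a: "\<bar>t\<bar> * norm (\<Delta> (t, z, y) - \<Delta> (t, z', y')) \<le> 1/2 * (norm (z - z') + norm (y - y'))" .
      have "\<Gamma> (t, z, y) - \<Gamma> (t, z', y') = (\<Gamma> (0, z, 0) - \<Gamma> (0, z', 0)) + t *\<^sub>R (\<Delta> (t, z, y) - \<Delta> (t, z', y'))"
        unfolding \<Gamma>_eq[of t] by (simp add: algebra_simps)
      then have "norm (\<Gamma> (t, z, y) - \<Gamma> (t, z', y')) \<le> norm (\<Gamma> (0, z, 0) - \<Gamma> (0, z', 0)) +
          \<bar>t\<bar> * norm (\<Delta> (t, z, y) - \<Delta> (t, z', y'))"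
        by (metis norm_triangle_ineq norm_scaleR)
      then show ?thesis using a L0(2)[OF tz(2,3)] by (simp add: algebra_simps)
    qed
    have ex: "\<exists>!y. norm y \<le> R \<and> \<Gamma> (t, z, y) = y" if tz: "\<bar>t\<bar> < \<delta>" "z \<in> K" for t z
    proof -
      have "\<exists>!y. y \<in> cball 0 R \<and> \<Gamma> (t, z, y) = y"
      proof (rule Banach_fix[where c = "1/2"])
        show "complete (cball (0::'y) R)" by (intro compact_imp_complete compact_cball)
        show "cball (0::'y) R \<noteq> {}" using R(2) M0(1) by simp
        show "(\<lambda>y. \<Gamma> (t, z, y)) ` cball 0 R \<subseteq> cball 0 R" using into[OF tz] by auto
        show "dist (\<Gamma> (t, z, x)) (\<Gamma> (t, z, y)) \<le> 1/2 * dist x y"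
          if "x \<in> cball 0 R" "y \<in> cball 0 R" for x y
          using lip[OF tz(1,2,2), of x y] that by (simp add: dist_norm)
      qed auto
      then show ?thesis by (metis mem_cball_0)
    qed
    have lipsol: "norm (y - y') \<le> (2 * L0 + 1) * norm (z - z')"
      if "\<bar>t\<bar> < \<delta> \<and> z \<in> K \<and> z' \<in> K \<and> norm y \<le> R \<and> norm y' \<le> R \<and>
        \<Gamma> (t, z, y) = y \<and> \<Gamma> (t, z', y') = y'" for t z z' y y'
      using lip[of t z z' y y'] that by (simp add: algebra_simps)
    have contr: "norm (frechet_derivative \<Gamma> (at (t, z, y)) (0, 0, k)) \<le> 1/2 * norm k"
      if "\<bar>t\<bar> < \<delta> \<and> z \<in> K \<and> norm y \<le> R" for t z y k
    proof -
      have D: "((\<lambda>y. \<phi> (t, z, y)) has_derivative (\<lambda>k. frechet_derivative \<phi> (at (t, z, y)) (0, 0, k))) (at y)"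
        if "smooth \<phi>" for \<phi> :: "real \<times> 'z \<times> 'y \<Rightarrow> 'y"
        using has_derivative_compose[OF has_derivative_Pair[OF has_derivative_const
          has_derivative_Pair[OF has_derivative_const has_derivative_ident]]
          smooth_has_derivative[OF that], of t z y UNIV] by simp
      have "((\<lambda>y. \<Gamma> (t, z, y)) has_derivative (\<lambda>k. t *\<^sub>R frechet_derivative \<Delta> (at (t, z, y)) (0, 0, k))) (at y)"
        unfolding \<Gamma>_eq[of t] by (rule derivative_eq_intros D[OF \<Delta>(1)] refl | simp)+
      from has_derivative_unique[OF D[OF smooth_\<Gamma>] this]
      have "frechet_derivative \<Gamma> (at (t, z, y)) (0, 0, k) = t *\<^sub>R frechet_derivative \<Delta> (at (t, z, y)) (0, 0, k)"
        by metis
      then have "norm (frechet_derivative \<Gamma> (at (t, z, y)) (0, 0, k)) \<le> \<bar>t\<bar> * (L' * norm k)"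
        using L'(2)[OF mem, of t z y "(0, 0, k)"] that by (simp add: mult_left_mono norm_Pair)
      also have "\<dots> \<le> 1/2 * norm k"
        using mult_right_mono[OF t(4), of t "norm k"] that by (simp add: mult.assoc)
      finally show ?thesis .
    qed
    define Y where "Y t z = (THE y. norm y \<le> R \<and> \<Gamma> (t, z, y) = y)" for t z
    have Y: "norm (Y t z) \<le> R \<and> \<Gamma> (t, z, Y t z) = Y t z" if "\<bar>t\<bar> < \<delta>" "z \<in> K" for t z
      unfolding Y_def by (rule theI'[OF ex[OF that]])
    have Y_unique: "y = Y t z" if "\<bar>t\<bar> < \<delta>" "z \<in> K" "norm y \<le> R" "\<Gamma> (t, z, y) = y" for t z y
      using ex[OF that(1,2)] Y[OF that(1,2)] that(3,4) by blast
    have Y_lip: "norm (Y t z - Y t z') \<le> (2 * L0 + 1) * norm (z - z')"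
      if "\<bar>t\<bar> < \<delta>" "z \<in> K" "z' \<in> K" for t z z'
      by (rule lipsol[of t]) (use that Y in auto)
    have Y_diff: "\<exists>y'. (Y t has_derivative y') (at z)" if t: "\<bar>t\<bar> < \<delta>" and z: "z \<in> interior K" for t z
    proof -
      have zK: "z \<in> K" using z interior_subset by blast
      have near: "\<forall>\<^sub>F z' in nhds z. z' \<in> K"
        using eventually_nhds_in_open[OF open_interior z] interior_subset
        by (auto elim!: eventually_mono)
      have F: "((\<lambda>x. \<Gamma> (t, x)) has_derivative (\<lambda>k. frechet_derivative \<Gamma> (at (t, z, Y t z)) (0, k)))
          (at (z, Y t z))"
        using has_derivative_compose[OF has_derivative_Pair[OF has_derivative_const
          has_derivative_ident] smooth_has_derivative[OF smooth_\<Gamma>], of t "(z, Y t z)" UNIV] by simp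
      obtain y' where "(Y t has_derivative y') (at z)"
      proof (rule fixed_point_has_derivative[where y = "Y t" and F = "\<lambda>x. \<Gamma> (t, x)", OF _ _ F])
        show "\<forall>\<^sub>F z' in nhds z. Y t z' = \<Gamma> (t, z', Y t z')"
          using near by eventually_elim (use Y[OF t] in simp)
        show "\<forall>\<^sub>F z' in nhds z. norm (Y t z' - Y t z) \<le> (2 * L0 + 1) * norm (z' - z)"
          using near by eventually_elim (use Y_lip[OF t _ zK] in simp)
        show "norm (frechet_derivative \<Gamma> (at (t, z, Y t z)) (0, (0, k))) \<le> 1/2 * norm k" for k
          using contr[of t z "Y t z" k] t zK Y by blast
      qed
      then show ?thesis by blast
    qed
    show ?thesis
      by (rule that[OF R(1) \<delta> _ Y Y_unique Y_lip Y_diff]) (use L0(1) in auto)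
qed

text \<open>Along fixed points, \<open>y\<close> may be replaced by \<open>\<Gamma> (t, z, y)\<close>, which removes \<open>y\<close> from the value at
  \<open>t = 0\<close>. Dividing the remainder by \<open>t\<close> and replacing \<open>y\<close> once more removes it from the next
  coefficient. The expansion needs no derivative of the fixed point with respect to \<open>t\<close>.\<close>

lemma expansion:
  fixes \<Theta> :: "real \<times> 'z \<times> 'y \<Rightarrow> 'b::euclidean_space"
  assumes \<Theta>: "smooth \<Theta>"
  obtains D \<Theta>2 where "smooth D" "smooth \<Theta>2"
    "\<And>t z y. y = \<Gamma> (t, z, y) \<Longrightarrow>
       \<Theta> (t, z, y) = \<Theta> (0, z, \<Gamma> (0, z, 0)) + t *\<^sub>R D z + t\<^sup>2 *\<^sub>R \<Theta>2 (t, z, y)"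
proof -
  have step: "\<exists>\<Psi>. smooth \<Psi> \<and> (\<forall>t z y. \<phi> (t, z, \<Gamma> (t, z, y)) = \<phi> (0, z, \<Gamma> (0, z, 0)) + t *\<^sub>R \<Psi> (t, z, y))"
    if \<phi>: "smooth \<phi>" for \<phi> :: "real \<times> 'z \<times> 'y \<Rightarrow> 'b"
  proof -
    define \<phi>' where "\<phi>' x = \<phi> (fst x, fst (snd x), \<Gamma> (fst x, fst (snd x), snd (snd x)))" for x
    have sm: "smooth \<phi>'"
      unfolding \<phi>'_def[abs_def]
      by (intro smooth_compose[OF \<phi>] smooth_Pair smooth_\<Gamma>_compose smooth_fst smooth_snd smooth_ident)
    define \<Psi> where "\<Psi> = time_quotient \<phi>'"
    have \<Psi>: "smooth \<Psi>" "\<phi>' (t, x) = \<phi>' (0, x) + t *\<^sub>R \<Psi> (t, x)" for t x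
      unfolding \<Psi>_def by (rule smooth_time_quotient time_quotient_eq sm)+
    have "\<phi>' (t, z, y) = \<phi> (t, z, \<Gamma> (t, z, y))" "\<phi>' (0, z, y) = \<phi> (0, z, \<Gamma> (0, z, 0))" for t z y
      using \<Gamma>_zero[of z y 0] by (simp_all add: \<phi>'_def)
    then show ?thesis using \<Psi> by metis
  qed
  obtain \<Psi> where \<Psi>: "smooth \<Psi>"
      "\<And>t z y. \<Theta> (t, z, \<Gamma> (t, z, y)) = \<Theta> (0, z, \<Gamma> (0, z, 0)) + t *\<^sub>R \<Psi> (t, z, y)"
    using step[OF \<Theta>] by blast
  obtain \<Theta>2 where \<Theta>2: "smooth \<Theta>2"
      "\<And>t z y. \<Psi> (t, z, \<Gamma> (t, z, y)) = \<Psi> (0, z, \<Gamma> (0, z, 0)) + t *\<^sub>R \<Theta>2 (t, z, y)"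
    using step[OF \<Psi>(1)] by blast
  show ?thesis
  proof (rule that)
    show "smooth (\<lambda>z. \<Psi> (0, z, \<Gamma> (0, z, 0)))"
      by (intro smooth_compose[OF \<Psi>(1)] smooth_Pair smooth_\<Gamma>_compose smooth_const smooth_ident)
    show "smooth \<Theta>2" by (rule \<Theta>2)
    fix t z y assume y: "y = \<Gamma> (t, z, y)"
    have "\<Theta> (t, z, y) = \<Theta> (0, z, \<Gamma> (0, z, 0)) + t *\<^sub>R \<Psi> (t, z, \<Gamma> (t, z, y))"
      using \<Psi>(2)[of t z y] unfolding y[symmetric] .
    then show "\<Theta> (t, z, y) = \<Theta> (0, z, \<Gamma> (0, z, 0)) + t *\<^sub>R \<Psi> (0, z, \<Gamma> (0, z, 0)) + t\<^sup>2 *\<^sub>R \<Theta>2 (t, z, y)"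
      by (simp add: \<Theta>2(2)[of t z y] scaleR_add_right power2_eq_square)
  qed
qed

end


section \<open>The RATTLE equations of the reduced system\<close>

lemmas matrix_vector_algebra =
  bounded_bilinear.add_left[OF bounded_bilinear_matrix_vector_mult]
  bounded_bilinear.add_right[OF bounded_bilinear_matrix_vector_mult]
  bounded_bilinear.diff_left[OF bounded_bilinear_matrix_vector_mult]
  bounded_bilinear.diff_right[OF bounded_bilinear_matrix_vector_mult]
  bounded_bilinear.minus_left[OF bounded_bilinear_matrix_vector_mult]
  bounded_bilinear.minus_right[OF bounded_bilinear_matrix_vector_mult]
  bounded_bilinear.zero_left[OF bounded_bilinear_matrix_vector_mult]
  bounded_bilinear.zero_right[OF bounded_bilinear_matrix_vector_mult]
  bounded_bilinear.scaleR_left[OF bounded_bilinear_matrix_vector_mult]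
  bounded_bilinear.scaleR_right[OF bounded_bilinear_matrix_vector_mult]

lemma jacobian_mult_eq_derivative:
  fixes h :: "real^'n \<Rightarrow> real^'l"
  assumes "smooth h"
  shows "jacobian h (at q) *v v = frechet_derivative h (at q) v"
  using smooth_has_derivative[OF assms, of q]
  by (simp add: jacobian_def matrix_works has_derivative_linear)

lemma smooth_jacobian:
  fixes h :: "real^'n \<Rightarrow> real^'l"
  assumes h: "smooth h"
  shows "smooth (\<lambda>q. jacobian h (at q))"
proof (intro smooth_vec)
  fix i j
  have "jacobian h (at q) $ i $ j = frechet_derivative h (at q) (axis j 1) $ i" for q
    by (simp add: jacobian_def matrix_def)
  then show "smooth (\<lambda>q. jacobian h (at q) $ i $ j)"
    by (simp add: smooth_vec_nth smooth_directional h)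
qed

text \<open>\<open>Hr\<close> is the Hamiltonian after elimination of the velocity multipliers, with position gradient \<open>f\<close>
  and momentum gradient \<open>A q *v p\<close>. The matrix \<open>Dh A Dh\<^sup>T\<close> may be singular away
  from the set \<open>h = 0\<close>; a function \<open>E\<close> that is smooth everywhere and inverts it on that set keeps all
  maps below smooth on the whole space.\<close>

locale reduced_system =
  fixes Hr :: "'n::finite phase \<Rightarrow> real"
    and f :: "'n phase \<Rightarrow> real^'n"
    and A :: "real^'n \<Rightarrow> real^'n^'n"
    and h :: "real^'n \<Rightarrow> real^'l::finite"
    and E :: "real^'n \<Rightarrow> real^'l^'l"
  assumes smooth_Hr: "smooth Hr" and smooth_f: "smooth f" and smooth_A: "smooth A"
    and smooth_h: "smooth h" and smooth_E: "smooth E"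
    and Hr_derivative: "frechet_derivative Hr (at (q, p)) (u, w) = f (q, p) \<bullet> u + (A q *v p) \<bullet> w"
    and E_inverse: "h q = 0 \<Longrightarrow> E q ** (jacobian h (at q) ** A q ** transpose (jacobian h (at q))) = mat 1"
begin

abbreviation B :: "real^'n \<Rightarrow> real^'n^'l" where "B q \<equiv> jacobian h (at q)"

definition BT :: "real^'n \<Rightarrow> real^'l \<Rightarrow> real^'n" where "BT q \<mu> = transpose (B q) *v \<mu>"

definition BA :: "real^'n \<Rightarrow> real^'n^'l" where "BA q = B q ** A q"

definition C :: "'n phase set" where "C = {(q, p). h q = 0 \<and> BA q *v p = 0}"

lemma smooth_B: "smooth B"
  by (rule smooth_jacobian[OF smooth_h])

lemma smooth_BA: "smooth BA"
  unfolding BA_def by (intro smooth_matrix_matrix_mult smooth_B smooth_A)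

text \<open>The remainder of the first order Taylor expansion of \<open>h\<close>, divided by \<open>t\<^sup>2\<close> and extended smoothly
  to \<open>t = 0\<close>.\<close>

definition h_rest :: "real \<times> (real^'n) \<times> (real^'n) \<Rightarrow> real^'l" where
  "h_rest = time_quotient (divided_difference h)"

lemma smooth_h_rest: "smooth h_rest"
  unfolding h_rest_def by (intro smooth_time_quotient smooth_divided_difference smooth_h)

lemma h_expansion: "h (q + t *\<^sub>R v) = h q + t *\<^sub>R (B q *v v) + t\<^sup>2 *\<^sub>R h_rest (t, q, v)"
  using divided_difference_eq[OF smooth_h, of q t v]
    time_quotient_eq[OF smooth_divided_difference[OF smooth_h], of t "(q, v)"]
  by (simp add: h_rest_def divided_difference_zero jacobian_mult_eq_derivative[OF smooth_h]
      scaleR_add_right power2_eq_square)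

text \<open>For \<open>t \<noteq> 0\<close> the multiplier of the first kick, obtained by solving \<open>h (q + t v) = 0\<close> in the form of
  \<open>multiplier0_identity\<close> below.\<close>

definition mu0 :: "real \<Rightarrow> real^'n \<Rightarrow> real^'n \<Rightarrow> real^'n \<Rightarrow> real^'l" where
  "mu0 t q v w = E q *v (B q *v (divided_difference A (t / 2, q, v) *v w)
     - BA q *v f (q + (t / 2) *\<^sub>R v, w) + 2 *\<^sub>R h_rest (t, q, v))"

text \<open>The multiplier of the second kick, obtained in the same way from the secondary constraint at the
  endpoint, see \<open>multiplier1_identity\<close>.\<close>

definition mu1 :: "real \<Rightarrow> real^'n \<Rightarrow> real^'n \<Rightarrow> real^'n \<Rightarrow> real^'n \<Rightarrow> real^'l" where
  "mu1 t q p v w = E (q + t *\<^sub>R v) *v (2 *\<^sub>R (divided_difference BA (t, q, v) *v p)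
     - BA (q + t *\<^sub>R v) *v (BT q (mu0 t q v w) + 2 *\<^sub>R f (q + (t / 2) *\<^sub>R v, w)))"

definition mid_p :: "real \<Rightarrow> real^'n \<Rightarrow> real^'n \<Rightarrow> real^'n \<Rightarrow> real^'n \<Rightarrow> real^'n" where
  "mid_p t q p v w = p - (t / 2) *\<^sub>R (BT q (mu0 t q v w) + f (q + (t / 2) *\<^sub>R v, w))"

text \<open>The unknowns of the fixed point equation are the mean velocity \<open>v\<close> and the midpoint momentum \<open>w\<close>.
  Using the updated momentum in the first component makes the map independent of \<open>(v, w)\<close> at \<open>t = 0\<close>.\<close>

definition \<Gamma> :: "real \<times> 'n phase \<times> 'n phase \<Rightarrow> 'n phase" where
  "\<Gamma> = (\<lambda>(t, (q, p), (v, w)). (A (q + (t / 2) *\<^sub>R v) *v mid_p t q p v w, mid_p t q p v w))"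

text \<open>The slope of the step: it leads from \<open>z\<close> to \<open>z + t \<Theta> (t, z, y)\<close>.\<close>

definition \<Theta> :: "real \<times> 'n phase \<times> 'n phase \<Rightarrow> 'n phase" where
  "\<Theta> = (\<lambda>(t, (q, p), (v, w)). (v, - ((1 / 2) *\<^sub>R (BT q (mu0 t q v w) +
      BT (q + t *\<^sub>R v) (mu1 t q p v w)) + f (q + (t / 2) *\<^sub>R v, w))))"

lemmas smooth_basic = smooth_Pair smooth_const smooth_ident smooth_add smooth_diff smooth_minus
  smooth_scaleR smooth_mult smooth_matrix_vector_mult smooth_transpose

lemma smooth_mu0:
  fixes a :: "'a::euclidean_space \<Rightarrow> real"
  assumes a: "smooth a" "smooth q" "smooth v" "smooth w"
  shows "smooth (\<lambda>x. mu0 (a x) (q x) (v x) (w x))"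
  unfolding mu0_def BT_def divide_inverse
  by (intro smooth_basic smooth_compose[OF smooth_E] smooth_compose[OF smooth_f]
      smooth_compose[OF smooth_B] smooth_compose[OF smooth_BA]
      smooth_compose[OF smooth_divided_difference[OF smooth_A]] smooth_compose[OF smooth_h_rest] a)

lemma smooth_mu1:
  fixes a :: "'a::euclidean_space \<Rightarrow> real"
  assumes a: "smooth a" "smooth q" "smooth p" "smooth v" "smooth w"
  shows "smooth (\<lambda>x. mu1 (a x) (q x) (p x) (v x) (w x))"
  unfolding mu1_def BT_def divide_inverse
  by (intro smooth_basic smooth_compose[OF smooth_E] smooth_compose[OF smooth_f]
      smooth_compose[OF smooth_B] smooth_compose[OF smooth_BA]
      smooth_compose[OF smooth_divided_difference[OF smooth_BA]] smooth_mu0 a)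

lemma smooth_mid_p:
  fixes a :: "'a::euclidean_space \<Rightarrow> real"
  assumes a: "smooth a" "smooth q" "smooth p" "smooth v" "smooth w"
  shows "smooth (\<lambda>x. mid_p (a x) (q x) (p x) (v x) (w x))"
  unfolding mid_p_def BT_def divide_inverse
  by (intro smooth_basic smooth_compose[OF smooth_f] smooth_compose[OF smooth_B] smooth_mu0 a)

lemma smooth_\<Gamma>: "smooth \<Gamma>"
  unfolding \<Gamma>_def case_prod_unfold divide_inverse
  by (intro smooth_basic smooth_compose[OF smooth_A] smooth_mid_p smooth_fst smooth_snd)

lemma smooth_\<Theta>: "smooth \<Theta>"
  unfolding \<Theta>_def BT_def case_prod_unfold divide_inverse
  by (intro smooth_basic smooth_compose[OF smooth_f] smooth_compose[OF smooth_B] smooth_mu0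
      smooth_mu1 smooth_fst smooth_snd)

lemma \<Gamma>_at_zero: "\<Gamma> (0, (q, p), y) = (A q *v p, p)"
  by (simp add: \<Gamma>_def mid_p_def split: prod.splits)

sublocale small_step_fixed_point \<Gamma>
proof
  show "\<Gamma> (0, z, y) = \<Gamma> (0, z, y')" for z y y'
    by (cases z) (simp add: \<Gamma>_at_zero)
qed (rule smooth_\<Gamma>)

text \<open>The equations of the step in the unknowns \<open>v\<close> and \<open>w\<close>, after elimination of the two intermediate
  momenta.\<close>

definition rattle_rel :: "real \<Rightarrow> 'n phase \<Rightarrow> 'n phase \<Rightarrow> real^'l \<Rightarrow> real^'l \<Rightarrow> 'n phase \<Rightarrow> bool" where
  "rattle_rel t = (\<lambda>(q, p) (v, w) \<mu>0 \<mu>1 (q', p').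
     q' = q + t *\<^sub>R v \<and> v = A (q + (t / 2) *\<^sub>R v) *v w \<and>
     w = p - (t / 2) *\<^sub>R (BT q \<mu>0 + f (q + (t / 2) *\<^sub>R v, w)) \<and>
     p' = w - (t / 2) *\<^sub>R (BT q' \<mu>1 + f (q + (t / 2) *\<^sub>R v, w)))"

text \<open>The midpoint \<open>q + (t / 2) v\<close>, the mean velocity and the midpoint momentum are common to the step
  and to its reverse.\<close>

lemma rattle_rel_symmetric:
  assumes "rattle_rel t z y \<mu>0 \<mu>1 z'"
  shows "rattle_rel (- t) z' y \<mu>1 \<mu>0 z"
proof -
  obtain q p v w q' p' where z: "z = (q, p)" "y = (v, w)" "z' = (q', p')" by (metis surj_pair)
  have r: "q' = q + t *\<^sub>R v" "v = A (q + (t / 2) *\<^sub>R v) *v w"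
     "w = p - (t / 2) *\<^sub>R (BT q \<mu>0 + f (q + (t / 2) *\<^sub>R v, w))"
     "p' = w - (t / 2) *\<^sub>R (BT q' \<mu>1 + f (q + (t / 2) *\<^sub>R v, w))"
    using assms by (auto simp: rattle_rel_def z)
  have mid: "q' + (- t / 2) *\<^sub>R v = q + (t / 2) *\<^sub>R v"
    unfolding r(1) by (simp add: scaleR_left.add[symmetric] algebra_simps scaleR_half_double)
  show ?thesis
    unfolding rattle_rel_def z split_conv mid
    using r by (auto simp: algebra_simps)
qed

lemma E_cancel: "h q = 0 \<Longrightarrow> E q *v (BA q *v BT q \<mu>) = \<mu>"
  using E_inverse[of q]
  by (simp add: BA_def BT_def matrix_vector_mul_assoc matrix_mul_assoc del: transpose_matrix_vector)

lemma E_cancel': "h q = 0 \<Longrightarrow> BA q *v BT q (E q *v x) = x"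
  using E_inverse[of q, THEN iffD1[OF matrix_left_right_inverse]]
  by (simp add: BA_def BT_def matrix_vector_mul_assoc matrix_mul_assoc del: transpose_matrix_vector)

text \<open>Because \<open>B A p = 0\<close>, the first order term \<open>t B v\<close> of \<open>h (q + t v)\<close> is itself of order \<open>t\<^sup>2\<close>. This
  is why the factor \<open>t\<^sup>2 / 2\<close> can be split off and the equation for the multiplier stays regular at
  \<open>t = 0\<close>.\<close>

lemma multiplier0_identity:
  assumes C: "BA q *v p = 0"
    and v: "v = A (q + (t / 2) *\<^sub>R v) *v w"
    and w: "w = p - (t / 2) *\<^sub>R (BT q \<mu> + f (q + (t / 2) *\<^sub>R v, w))"
  shows "h (q + t *\<^sub>R v) = h q + (t\<^sup>2 / 2) *\<^sub>R (B q *v (divided_difference A (t / 2, q, v) *v w)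
     - BA q *v f (q + (t / 2) *\<^sub>R v, w) + 2 *\<^sub>R h_rest (t, q, v) - BA q *v BT q \<mu>)"
proof -
  let ?f = "f (q + (t / 2) *\<^sub>R v, w)"
  have "B q *v v = B q *v (A q *v w) + (t / 2) *\<^sub>R (B q *v (divided_difference A (t / 2, q, v) *v w))"
    by (subst v, subst divided_difference_eq[OF smooth_A]) (simp add: matrix_vector_algebra)
  also have "B q *v (A q *v w) = BA q *v w"
    by (simp add: BA_def matrix_vector_mul_assoc)
  also have "BA q *v w = - (t / 2) *\<^sub>R (BA q *v BT q \<mu> + BA q *v ?f)"
    by (subst w) (simp add: matrix_vector_algebra C)
  finally have eq: "B q *v v = (t / 2) *\<^sub>R (B q *v (divided_difference A (t / 2, q, v) *v w)
      - BA q *v ?f - BA q *v BT q \<mu>)"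
    by (simp add: vec_eq_iff algebra_simps)
  show ?thesis
    unfolding h_expansion eq by (simp add: vec_eq_iff algebra_simps power2_eq_square)
qed

lemma multiplier1_identity:
  assumes C: "BA q *v p = 0"
    and w: "w = p - (t / 2) *\<^sub>R (BT q \<mu>0 + F)"
    and p': "p' = w - (t / 2) *\<^sub>R (BT q' \<mu>1 + F)" and q': "q' = q + t *\<^sub>R v"
  shows "BA q' *v p' = (t / 2) *\<^sub>R (2 *\<^sub>R (divided_difference BA (t, q, v) *v p)
     - BA q' *v (BT q \<mu>0 + 2 *\<^sub>R F) - BA q' *v BT q' \<mu>1)"
proof -
  have eq: "BA q' *v p = t *\<^sub>R (divided_difference BA (t, q, v) *v p)"
    unfolding q' by (subst divided_difference_eq[OF smooth_BA]) (simp add: matrix_vector_algebra C)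
  have p'_eq: "p' = p - (t / 2) *\<^sub>R (BT q \<mu>0 + 2 *\<^sub>R F + BT q' \<mu>1)"
    unfolding p' w by (simp add: vec_eq_iff algebra_simps)
  show ?thesis
    unfolding p'_eq by (simp add: matrix_vector_algebra eq vec_eq_iff algebra_simps)
qed

text \<open>Applying \<open>E\<close> to the two multiplier equations, on the constraint set, solves them for \<open>\<mu>0\<close> and
  \<open>\<mu>1\<close>; the other equations are then those of \<open>\<Gamma>\<close> and \<open>\<Theta>\<close>.\<close>

lemma rattle_rel_imp_fixed_point:
  assumes z: "z \<in> C" and z': "z' \<in> C" and t: "t \<noteq> 0"
    and r: "rattle_rel t z y \<mu>0 \<mu>1 z'"
  shows "\<mu>0 = mu0 t (fst z) (fst y) (snd y)" "\<mu>1 = mu1 t (fst z) (snd z) (fst y) (snd y)"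
    "\<Gamma> (t, z, y) = y" "z' = z + t *\<^sub>R \<Theta> (t, z, y)"
proof -
  obtain q p v w q' p' where zy: "z = (q, p)" "y = (v, w)" "z' = (q', p')" by (metis surj_pair)
  let ?f = "f (q + (t / 2) *\<^sub>R v, w)"
  have q': "q' = q + t *\<^sub>R v" and v: "v = A (q + (t / 2) *\<^sub>R v) *v w"
    and w: "w = p - (t / 2) *\<^sub>R (BT q \<mu>0 + ?f)"
    and p': "p' = w - (t / 2) *\<^sub>R (BT q' \<mu>1 + ?f)"
    using r by (auto simp: rattle_rel_def zy)
  have hq: "h q = 0" "BA q *v p = 0" "h q' = 0" "BA q' *v p' = 0"
    using z z' by (auto simp: C_def zy)
  have "BA q *v BT q \<mu>0 = B q *v (divided_difference A (t / 2, q, v) *v w)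
     - BA q *v ?f + 2 *\<^sub>R h_rest (t, q, v)"
    using multiplier0_identity[OF hq(2) v w] hq(1,3) t by (simp add: q')
  then have m0: "\<mu>0 = mu0 t q v w"
    using E_cancel[OF hq(1), of \<mu>0] by (simp add: mu0_def)
  have "BA q' *v BT q' \<mu>1 = 2 *\<^sub>R (divided_difference BA (t, q, v) *v p)
     - BA q' *v (BT q \<mu>0 + 2 *\<^sub>R ?f)"
    using multiplier1_identity[OF hq(2) w p' q'] hq(4) t by simp
  then have m1: "\<mu>1 = mu1 t q p v w"
    using E_cancel[OF hq(3), of \<mu>1] by (simp add: mu1_def q' m0)
  have mid: "mid_p t q p v w = w"
    using w by (simp add: mid_p_def m0)
  show "\<mu>0 = mu0 t (fst z) (fst y) (snd y)" "\<mu>1 = mu1 t (fst z) (snd z) (fst y) (snd y)"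
    by (simp_all add: zy m0 m1)
  show "\<Gamma> (t, z, y) = y" by (simp add: \<Gamma>_def zy mid v[symmetric])
  have "p' = p - (t / 2) *\<^sub>R (BT q \<mu>0 + ?f) - (t / 2) *\<^sub>R (BT q' \<mu>1 + ?f)"
    using p' w by simp
  then show "z' = z + t *\<^sub>R \<Theta> (t, z, y)"
    by (simp add: \<Theta>_def zy q' m0 m1 vec_eq_iff algebra_simps)
qed

lemma fixed_point_imp_rattle_rel:
  assumes y: "\<Gamma> (t, z, y) = y"
  shows "rattle_rel t z y (mu0 t (fst z) (fst y) (snd y)) (mu1 t (fst z) (snd z) (fst y) (snd y))
      (z + t *\<^sub>R \<Theta> (t, z, y))"
proof -
  obtain q p v w q' p' where zy: "z = (q, p)" "y = (v, w)" "z + t *\<^sub>R \<Theta> (t, z, y) = (q', p')"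
    by (metis surj_pair)
  let ?f = "f (q + (t / 2) *\<^sub>R v, w)"
  have "mid_p t q p v w = w" and v: "v = A (q + (t / 2) *\<^sub>R v) *v w"
    using y by (auto simp: \<Gamma>_def zy)
  then have w: "w = p - (t / 2) *\<^sub>R (BT q (mu0 t q v w) + ?f)"
    by (simp add: mid_p_def)
  have q': "q' = q + t *\<^sub>R v"
    using zy(3) by (simp add: zy(1,2) \<Theta>_def)
  have "p' = p - (t / 2) *\<^sub>R (BT q (mu0 t q v w) + ?f) - (t / 2) *\<^sub>R (BT q' (mu1 t q p v w) + ?f)"
    using zy(3) by (auto simp add: zy(1,2) \<Theta>_def q' vec_eq_iff algebra_simps)
  then have "p' = w - (t / 2) *\<^sub>R (BT q' (mu1 t q p v w) + ?f)"
    using w by simp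
  then show ?thesis
    unfolding zy(3) unfolding zy(1,2) using q' v w by (simp add: rattle_rel_def)
qed

text \<open>The multipliers \<open>mu0\<close> and \<open>mu1\<close> were chosen to make the right hand sides of the two identities
  above vanish.\<close>

lemma fixed_point_imp_in_C:
  assumes z: "z \<in> C" and y: "\<Gamma> (t, z, y) = y"
  shows "z + t *\<^sub>R \<Theta> (t, z, y) \<in> C"
proof -
  obtain q p v w q' p' where zy: "z = (q, p)" "y = (v, w)" "z + t *\<^sub>R \<Theta> (t, z, y) = (q', p')"
    by (metis surj_pair)
  let ?f = "f (q + (t / 2) *\<^sub>R v, w)"
  have r: "q' = q + t *\<^sub>R v" "v = A (q + (t / 2) *\<^sub>R v) *v w"
     "w = p - (t / 2) *\<^sub>R (BT q (mu0 t q v w) + ?f)"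
     "p' = w - (t / 2) *\<^sub>R (BT q' (mu1 t q p v w) + ?f)"
    using fixed_point_imp_rattle_rel[OF y] unfolding zy(3) unfolding zy(1,2)
    by (auto simp: rattle_rel_def)
  have hq: "h q = 0" "BA q *v p = 0" using z by (auto simp: C_def zy(1))
  have hq': "h q' = 0"
    using multiplier0_identity[OF hq(2) r(2,3)] hq(1) E_cancel'[OF hq(1)] by (simp add: r(1) mu0_def)
  have "BA q' *v BT q' (mu1 t q p v w) = 2 *\<^sub>R (divided_difference BA (t, q, v) *v p)
     - BA q' *v (BT q (mu0 t q v w) + 2 *\<^sub>R ?f)"
    using E_cancel'[OF hq'] unfolding mu1_def r(1)[symmetric] .
  then have "BA q' *v p' = 0"
    using multiplier1_identity[OF hq(2) r(3,4,1)] by simp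
  then show ?thesis unfolding zy(3) using hq' by (simp add: C_def)
qed

definition reduced_midpoint_step :: "real \<Rightarrow> 'n phase \<Rightarrow> 'n phase \<Rightarrow> bool" where
  "reduced_midpoint_step t = (\<lambda>(q, p) (q', p').
     q' - q = t *\<^sub>R (A (midpoint q q') *v midpoint p p') \<and>
     p' - p = - t *\<^sub>R f (midpoint q q', midpoint p p'))"

text \<open>The state after the inner step and before the second kick.\<close>

definition minus_state :: "real \<Rightarrow> 'n phase \<Rightarrow> 'n phase \<Rightarrow> 'n phase" where
  "minus_state t = (\<lambda>(q, p) (v, w). (q + t *\<^sub>R v, w - (t / 2) *\<^sub>R f (q + (t / 2) *\<^sub>R v, w)))"

lemma midpoint_shift: "midpoint q (q + t *\<^sub>R v) = q + (t / 2) *\<^sub>R v" for q v :: "real^'n"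
  by (simp add: midpoint_def vec_eq_iff field_simps)

lemma rattle_equations_imp_rattle_rel:
  assumes t: "t \<noteq> 0" and L: "reduced_midpoint_step t (kick h t \<mu>0 z) zm" "z' = kick h t \<mu>1 zm"
  shows "\<exists>y. rattle_rel t z y \<mu>0 \<mu>1 z' \<and> zm = minus_state t z y \<and>
      y = ((1 / t) *\<^sub>R (fst z' - fst z), midpoint (snd (kick h t \<mu>0 z)) (snd zm))"
proof -
  obtain q p qm pm q' p' where zz: "z = (q, p)" "zm = (qm, pm)" "z' = (q', p')" by (metis surj_pair)
  define P where "P = p - (t / 2) *\<^sub>R BT q \<mu>0"
  have k: "kick h t \<mu>0 z = (q, P)" by (simp add: kick_def zz P_def BT_def)
  define v w where "v = (1 / t) *\<^sub>R (q' - q)" and "w = midpoint P pm"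
  have L': "reduced_midpoint_step t (q, P) (qm, pm)" using L k zz(2) by simp
  moreover have "qm = q'" "p' = pm - (t / 2) *\<^sub>R BT q' \<mu>1"
    using L by (auto simp: zz kick_def BT_def)
  ultimately have L': "reduced_midpoint_step t (q, P) (qm, pm)" "qm = q'" "p' = pm - (t / 2) *\<^sub>R BT q' \<mu>1"
    by auto
  have q': "qm = q'" "q' = q + t *\<^sub>R v" using L' t by (auto simp: v_def)
  have *: "t *\<^sub>R v = t *\<^sub>R (A (q + (t / 2) *\<^sub>R v) *v w)" "pm = P - t *\<^sub>R f (q + (t / 2) *\<^sub>R v, w)"
  proof -
    have "reduced_midpoint_step t (q, P) (q + t *\<^sub>R v, pm)" using L'(1) unfolding q' .
    then have m: "q + t *\<^sub>R v - q = t *\<^sub>R (A (q + (t / 2) *\<^sub>R v) *v w)"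
      "pm - P = - t *\<^sub>R f (q + (t / 2) *\<^sub>R v, w)"
      unfolding reduced_midpoint_step_def split_conv midpoint_shift w_def[symmetric] by blast+
    show "t *\<^sub>R v = t *\<^sub>R (A (q + (t / 2) *\<^sub>R v) *v w)" using m(1) by simp
    show "pm = P - t *\<^sub>R f (q + (t / 2) *\<^sub>R v, w)" using m(2) by (simp add: diff_eq_eq)
  qed
  define F where "F = f (q + (t / 2) *\<^sub>R v, w)"
  have P: "P = pm + t *\<^sub>R F" using *(2) by (simp add: F_def)
  have w_eq: "w = pm + (t / 2) *\<^sub>R F"
    unfolding w_def P midpoint_def by (simp add: vec_eq_iff field_simps)
  have w: "w = P - (t / 2) *\<^sub>R f (q + (t / 2) *\<^sub>R v, w)"
    and pm: "pm = w - (t / 2) *\<^sub>R f (q + (t / 2) *\<^sub>R v, w)"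
    unfolding F_def[symmetric] unfolding w_eq P by (simp_all add: vec_eq_iff field_simps)
  have "v = A (q + (t / 2) *\<^sub>R v) *v w" using *(1) t by simp
  moreover have "w = p - (t / 2) *\<^sub>R (BT q \<mu>0 + f (q + (t / 2) *\<^sub>R v, w))"
    using w by (simp add: P_def algebra_simps)
  moreover have "p' = w - (t / 2) *\<^sub>R (BT q' \<mu>1 + f (q + (t / 2) *\<^sub>R v, w))"
    unfolding L'(3) pm by (simp add: algebra_simps)
  ultimately have "rattle_rel t z (v, w) \<mu>0 \<mu>1 z'"
    unfolding rattle_rel_def zz split_conv using q'(2) by blast
  moreover have "zm = minus_state t z (v, w)"
    unfolding minus_state_def zz split_conv q' pm by blast
  moreover have "(v, w) = ((1 / t) *\<^sub>R (fst z' - fst z), midpoint (snd (kick h t \<mu>0 z)) (snd zm))"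
    by (simp add: k) (simp add: zz v_def w_def)
  ultimately show ?thesis by blast
qed

lemma rattle_rel_imp_rattle_equations:
  assumes r: "rattle_rel t z (v, w) \<mu>0 \<mu>1 z'"
  shows "reduced_midpoint_step t (kick h t \<mu>0 z) (minus_state t z (v, w))" "z' = kick h t \<mu>1 (minus_state t z (v, w))"
proof -
  obtain q p qm pm q' p' where zz: "z = (q, p)" "minus_state t z (v, w) = (qm, pm)" "z' = (q', p')"
    by (metis surj_pair)
  define P where "P = p - (t / 2) *\<^sub>R BT q \<mu>0"
  have k: "kick h t \<mu>0 z = (q, P)" by (simp add: kick_def zz P_def BT_def)
  have q': "q' = q + t *\<^sub>R v" and v: "v = A (q + (t / 2) *\<^sub>R v) *v w"
    and w: "w = P - (t / 2) *\<^sub>R f (q + (t / 2) *\<^sub>R v, w)"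
    and p': "p' = w - (t / 2) *\<^sub>R (BT q' \<mu>1 + f (q + (t / 2) *\<^sub>R v, w))"
    and m: "qm = q + t *\<^sub>R v" "pm = w - (t / 2) *\<^sub>R f (q + (t / 2) *\<^sub>R v, w)"
    using r zz(2) by (auto simp: rattle_rel_def minus_state_def zz P_def algebra_simps)
  have P: "P = w + (t / 2) *\<^sub>R f (q + (t / 2) *\<^sub>R v, w)"
    using w by (simp add: algebra_simps)
  have "midpoint P pm = w"
    unfolding P m(2) by (simp add: midpoint_def vec_eq_iff field_simps)
  moreover have "pm - P = - t *\<^sub>R f (q + (t / 2) *\<^sub>R v, w)"
    unfolding P m(2) by (simp add: vec_eq_iff field_simps)
  ultimately show "reduced_midpoint_step t (kick h t \<mu>0 z) (minus_state t z (v, w))"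
    unfolding k zz(2) m(1) reduced_midpoint_step_def split_conv midpoint_shift using v by simp
  show "z' = kick h t \<mu>1 (minus_state t z (v, w))"
    unfolding zz(2) by (simp add: kick_def zz(3) m p' q' BT_def algebra_simps)
qed

end


section \<open>Existence and local uniqueness of the step\<close>

context reduced_system
begin

abbreviation step :: "real \<Rightarrow> real \<Rightarrow> 'n phase \<Rightarrow> real^'l \<Rightarrow> 'n phase \<Rightarrow> real^'l \<Rightarrow> 'n phase \<Rightarrow> bool" where
  "step \<equiv> rattle_step reduced_midpoint_step C h"

definition unique_step :: "real \<Rightarrow> real \<Rightarrow> 'n phase \<Rightarrow> 'n phase \<Rightarrow> bool" where
  "unique_step t r z z1 \<longleftrightarrow> (\<exists>\<mu>0 zm \<mu>1. step t r z \<mu>0 zm \<mu>1 z1 \<and>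
     (\<forall>\<mu>0' zm' \<mu>1' z1'. step t r z \<mu>0' zm' \<mu>1' z1' \<longrightarrow>
        \<mu>0' = \<mu>0 \<and> zm' = zm \<and> \<mu>1' = \<mu>1 \<and> z1' = z1))"

definition integrator :: "(real \<Rightarrow> 'n phase \<Rightarrow> 'n phase) \<Rightarrow> bool" where
  "integrator \<Phi> \<longleftrightarrow> (\<forall>K. compact K \<and> K \<subseteq> C \<longrightarrow>
     (\<exists>\<delta>>0. \<exists>r>0. \<forall>t\<in>{0<..<\<delta>}. \<forall>z\<in>K.
        unique_step t r z (\<Phi> t z)))"

lemma closed_C: "closed C"
proof -
  have "C = {z. h (fst z) = 0} \<inter> {z. BA (fst z) *v snd z = 0}"
    by (auto simp: C_def)
  moreover have "smooth (\<lambda>z::'n phase. h (fst z))" "smooth (\<lambda>z::'n phase. BA (fst z) *v snd z)"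
    by (intro smooth_matrix_vector_mult smooth_compose[OF smooth_h] smooth_compose[OF smooth_BA]
        smooth_fst smooth_snd smooth_ident)+
  then have "closed {z::'n phase. h (fst z) = 0}" "closed {z::'n phase. BA (fst z) *v snd z = 0}"
    by (auto intro!: closed_Collect_eq smooth_continuous_on continuous_on_const)
  ultimately show ?thesis by auto
qed

lemma step_mono: "step t r z \<mu>0 zm \<mu>1 z' \<Longrightarrow> r \<le> r' \<Longrightarrow> step t r' z \<mu>0 zm \<mu>1 z'"
  by (auto simp: rattle_step_def)

lemma step_imp_rattle_rel:
  assumes "t \<noteq> 0" "step t r z \<mu>0 zm \<mu>1 z'"
  shows "\<exists>y. rattle_rel t z y \<mu>0 \<mu>1 z' \<and> zm = minus_state t z y \<and>
      y = ((1 / t) *\<^sub>R (fst z' - fst z), midpoint (snd (kick h t \<mu>0 z)) (snd zm))"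
  using assms rattle_equations_imp_rattle_rel[OF assms(1)] by (auto simp: rattle_step_def)

lemma norm_midpoint_less:
  fixes a b :: "'a::real_normed_vector"
  assumes "norm a < r" "norm b < r"
  shows "norm (midpoint a b) < r"
proof -
  have "norm (midpoint a b) = norm (a + b) / 2" by (simp add: midpoint_def)
  also have "\<dots> \<le> (norm a + norm b) / 2" by (simp add: norm_triangle_ineq)
  finally show ?thesis using assms by simp
qed

text \<open>If all points of a step stay within distance \<open>1\<close> of \<open>z\<close>, then the midpoint position and momentum
  are bounded, hence so is the mean velocity \<open>A (midpoint q q') w\<close>, whatever the multipliers are. This
  brings every competing solution into the ball in which the fixed point is unique.\<close>

lemma step_slopes_bounded:
  obtains R where "\<And>t z \<mu>0 zm \<mu>1 z'. t \<noteq> 0 \<Longrightarrow> norm z < \<rho> \<Longrightarrow> step t 1 z \<mu>0 zm \<mu>1 z' \<Longrightarrow>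
    \<exists>y. norm y \<le> R \<and> rattle_rel t z y \<mu>0 \<mu>1 z' \<and> zm = minus_state t z y"
proof -
  have "smooth (\<lambda>x. A (fst x) *v snd x)"
    by (intro smooth_matrix_vector_mult smooth_compose[OF smooth_A] smooth_fst smooth_snd smooth_ident)
  moreover have "bounded (ball (0::real^'n) (\<rho> + 1) \<times> ball (0::real^'n) (\<rho> + 1))"
    by (intro bounded_Times bounded_ball)
  ultimately obtain M where M: "M > 0"
      "\<And>x. x \<in> ball (0::real^'n) (\<rho> + 1) \<times> ball (0::real^'n) (\<rho> + 1) \<Longrightarrow> norm (A (fst x) *v snd x) \<le> M"
    by (rule smooth_bounded_on) blast
  show ?thesis
  proof (rule that)
    fix t z \<mu>0 zm \<mu>1 z'
    assume t: "t \<noteq> 0" and z: "norm z < \<rho>" and s: "step t 1 z \<mu>0 zm \<mu>1 z'"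
    obtain y where y: "rattle_rel t z y \<mu>0 \<mu>1 z'" "zm = minus_state t z y"
      "y = ((1 / t) *\<^sub>R (fst z' - fst z), midpoint (snd (kick h t \<mu>0 z)) (snd zm))"
      using step_imp_rattle_rel[OF t s] by blast
    obtain q p q' p' where zz: "z = (q, p)" "z' = (q', p')" by (metis surj_pair)
    obtain v w where vw: "y = (v, w)" by (metis surj_pair)
    have near: "norm x < \<rho> + 1" if "x \<in> ball z 1" for x
      using that z norm_triangle_ineq2[of x z] by (auto simp: dist_norm norm_minus_commute)
    have "kick h t \<mu>0 z \<in> ball z 1" "zm \<in> ball z 1" "z' \<in> ball z 1"
      using s unfolding rattle_step_def by blast+
    then have nz: "norm (kick h t \<mu>0 z) < \<rho> + 1" "norm zm < \<rho> + 1" "norm z' < \<rho> + 1" "norm z < \<rho> + 1"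
      using near z by auto
    have "norm (snd (kick h t \<mu>0 z)) < \<rho> + 1" "norm (snd zm) < \<rho> + 1"
        "norm q' < \<rho> + 1" "norm q < \<rho> + 1"
      using le_less_trans[OF norm_snd_le[of "snd (kick h t \<mu>0 z)" "fst (kick h t \<mu>0 z)"]]
        le_less_trans[OF norm_snd_le[of "snd zm" "fst zm"]]
        le_less_trans[OF norm_fst_le[of q' p']] le_less_trans[OF norm_fst_le[of q p]] nz
      by (simp_all add: zz)
    then have w: "norm w < \<rho> + 1" and qm: "norm (midpoint q q') < \<rho> + 1"
      using y(3) by (auto simp: vw intro: norm_midpoint_less)
    have "midpoint q q' = q + (t / 2) *\<^sub>R v" "v = A (q + (t / 2) *\<^sub>R v) *v w"
      using y(1) by (auto simp: rattle_rel_def zz vw midpoint_def vec_eq_iff field_simps)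
    then have "norm v \<le> M"
      using M(2)[of "(midpoint q q', w)"] w qm by auto
    moreover have "norm y \<le> norm v + norm w"
      unfolding vw by (rule norm_Pair_le)
    ultimately have "norm y \<le> M + (\<rho> + 1)" using w by linarith
    then show "\<exists>y. norm y \<le> M + (\<rho> + 1) \<and> rattle_rel t z y \<mu>0 \<mu>1 z' \<and> zm = minus_state t z y"
      using y(1,2) by blast
  qed
qed

text \<open>Like \<open>\<Theta>\<close> for the endpoint, these slopes express the two intermediate states as \<open>z + t\<close> times a
  smooth function, so that they are close to \<open>z\<close> for small \<open>t\<close>.\<close>

definition minus_slope :: "real \<times> 'n phase \<times> 'n phase \<Rightarrow> 'n phase" where
  "minus_slope = (\<lambda>(t, (q, p), (v, w)). (v, - ((1 / 2) *\<^sub>R BT q (mu0 t q v w) + f (q + (t / 2) *\<^sub>R v, w))))"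

definition kick_slope :: "real \<times> 'n phase \<times> 'n phase \<Rightarrow> 'n phase" where
  "kick_slope = (\<lambda>(t, (q, p), (v, w)). (0, - ((1 / 2) *\<^sub>R BT q (mu0 t q v w))))"

lemma smooth_minus_slope: "smooth minus_slope"
  unfolding minus_slope_def BT_def case_prod_unfold divide_inverse
  by (intro smooth_basic smooth_compose[OF smooth_f] smooth_compose[OF smooth_B] smooth_mu0
      smooth_fst smooth_snd)

lemma smooth_kick_slope: "smooth kick_slope"
  unfolding kick_slope_def BT_def case_prod_unfold divide_inverse
  by (intro smooth_basic smooth_compose[OF smooth_B] smooth_mu0 smooth_fst smooth_snd)

lemma kick_eq: "kick h t (mu0 t (fst z) (fst y) (snd y)) z = z + t *\<^sub>R kick_slope (t, z, y)"
  by (simp add: kick_def kick_slope_def BT_def case_prod_unfold prod_eq_iff)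

lemma minus_state_eq:
  assumes "\<Gamma> (t, z, y) = y"
  shows "minus_state t z y = z + t *\<^sub>R minus_slope (t, z, y)"
proof -
  obtain q p v w where zy: "z = (q, p)" "y = (v, w)" by (metis surj_pair)
  have "w = mid_p t q p v w" using assms by (simp add: \<Gamma>_def zy)
  then have w: "w = p - (t / 2) *\<^sub>R (BT q (mu0 t q v w) + f (q + (t / 2) *\<^sub>R v, w))"
    by (simp add: mid_p_def)
  have "w - (t / 2) *\<^sub>R f (q + (t / 2) *\<^sub>R v, w) =
      p + t *\<^sub>R - ((1 / 2) *\<^sub>R BT q (mu0 t q v w) + f (q + (t / 2) *\<^sub>R v, w))"
    by (subst w) (simp add: vec_eq_iff field_simps)
  then show ?thesis by (simp add: minus_state_def minus_slope_def zy)
qed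

lemma local_flow:
  obtains R \<delta> L Y where "\<delta> > 0" "L > 0"
    "\<And>t z. \<bar>t\<bar> < \<delta> \<Longrightarrow> norm z < \<rho> \<Longrightarrow> norm (Y t z) \<le> R \<and> \<Gamma> (t, z, Y t z) = Y t z"
    "\<And>t z z'. \<bar>t\<bar> < \<delta> \<Longrightarrow> norm z < \<rho> \<Longrightarrow> norm z' < \<rho> \<Longrightarrow> norm (Y t z - Y t z') \<le> L * norm (z - z')"
    "\<And>t z. \<bar>t\<bar> < \<delta> \<Longrightarrow> norm z < \<rho> \<Longrightarrow> \<exists>y'. (Y t has_derivative y') (at z)"
    "\<And>t z. \<bar>t\<bar> < \<delta> \<Longrightarrow> norm z < \<rho> \<Longrightarrow> norm (t *\<^sub>R \<Theta> (t, z, Y t z)) < 1"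
    "\<And>t z. t \<in> {0<..<\<delta>} \<Longrightarrow> norm z < \<rho> \<Longrightarrow> z \<in> C \<Longrightarrow>
      unique_step t 1 z (z + t *\<^sub>R \<Theta> (t, z, Y t z))"
proof -
  obtain R1 where R1: "\<And>t z \<mu>0 zm \<mu>1 z'. t \<noteq> 0 \<Longrightarrow> norm z < \<rho> \<Longrightarrow> step t 1 z \<mu>0 zm \<mu>1 z' \<Longrightarrow>
    \<exists>y. norm y \<le> R1 \<and> rattle_rel t z y \<mu>0 \<mu>1 z' \<and> zm = minus_state t z y"
    by (rule step_slopes_bounded) blast
  have ball: "bounded (ball (0::'n phase) \<rho>)" by simp
  obtain R \<delta>1 L Y where R: "R \<ge> R1" and \<delta>1: "\<delta>1 > 0" and L: "L > 0" and
    Y: "\<And>t z. \<bar>t\<bar> < \<delta>1 \<Longrightarrow> z \<in> ball 0 \<rho> \<Longrightarrow> norm (Y t z) \<le> R \<and> \<Gamma> (t, z, Y t z) = Y t z" and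
    Y_unique: "\<And>t z y. \<bar>t\<bar> < \<delta>1 \<Longrightarrow> z \<in> ball 0 \<rho> \<Longrightarrow> norm y \<le> R \<Longrightarrow> \<Gamma> (t, z, y) = y \<Longrightarrow> y = Y t z" and
    Y_lip: "\<And>t z z'. \<bar>t\<bar> < \<delta>1 \<Longrightarrow> z \<in> ball 0 \<rho> \<Longrightarrow> z' \<in> ball 0 \<rho> \<Longrightarrow> norm (Y t z - Y t z') \<le> L * norm (z - z')" and
    Y_diff: "\<And>t z. \<bar>t\<bar> < \<delta>1 \<Longrightarrow> z \<in> interior (ball 0 \<rho>) \<Longrightarrow> \<exists>y'. (Y t has_derivative y') (at z)"
    by (rule solution[OF ball, of R1]) blast
  define S where "S = {-1..1::real} \<times> ball (0::'n phase) \<rho> \<times> cball (0::'n phase) R"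
  have S: "bounded S" unfolding S_def by (intro bounded_Times) auto
  obtain M1 where M1: "M1 > 0" "\<And>x. x \<in> S \<Longrightarrow> norm (\<Theta> x) \<le> M1"
    using smooth_bounded_on[OF smooth_\<Theta> S] by metis
  obtain M2 where M2: "M2 > 0" "\<And>x. x \<in> S \<Longrightarrow> norm (minus_slope x) \<le> M2"
    using smooth_bounded_on[OF smooth_minus_slope S] by metis
  obtain M3 where M3: "M3 > 0" "\<And>x. x \<in> S \<Longrightarrow> norm (kick_slope x) \<le> M3"
    using smooth_bounded_on[OF smooth_kick_slope S] by metis
  define M where "M = M1 + M2 + M3"
  have M: "M > 0" using M1 M2 M3 by (simp add: M_def)
  define \<delta> where "\<delta> = min \<delta>1 (min 1 (1 / M))"
  have \<delta>: "\<delta> > 0" "\<And>t. \<bar>t\<bar> < \<delta> \<Longrightarrow> \<bar>t\<bar> < \<delta>1" using \<delta>1 M by (auto simp: \<delta>_def)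
  have small: "norm (t *\<^sub>R \<Theta> (t, z, Y t z)) < 1" "norm (t *\<^sub>R minus_slope (t, z, Y t z)) < 1"
      "norm (t *\<^sub>R kick_slope (t, z, Y t z)) < 1" if t: "\<bar>t\<bar> < \<delta>" and z: "norm z < \<rho>" for t z
  proof -
    have t1: "\<bar>t\<bar> < 1" "\<bar>t\<bar> < 1 / M" using t by (auto simp: \<delta>_def)
    have mem: "(t, z, Y t z) \<in> S" using Y[OF \<delta>(2)[OF t]] z t1 by (auto simp: S_def abs_less_iff)
    have "norm (t *\<^sub>R x) < 1" if "norm x \<le> M" for x :: "'n phase"
    proof -
      have "norm (t *\<^sub>R x) \<le> \<bar>t\<bar> * M" using that by (simp add: mult_left_mono)
      also have "\<dots> < 1" using t1(2) M by (simp add: pos_less_divide_eq)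
      finally show ?thesis .
    qed
    moreover have "norm (\<Theta> (t, z, Y t z)) \<le> M" "norm (minus_slope (t, z, Y t z)) \<le> M" "norm (kick_slope (t, z, Y t z)) \<le> M"
      using M1(2)[OF mem] M2(2)[OF mem] M3(2)[OF mem] M1(1) M2(1) M3(1) by (auto simp: M_def)
    ultimately show "norm (t *\<^sub>R \<Theta> (t, z, Y t z)) < 1" "norm (t *\<^sub>R minus_slope (t, z, Y t z)) < 1"
      "norm (t *\<^sub>R kick_slope (t, z, Y t z)) < 1" by blast+
  qed
  show ?thesis
  proof (rule that[OF \<delta>(1) L])
    show "norm (Y t z) \<le> R \<and> \<Gamma> (t, z, Y t z) = Y t z" if "\<bar>t\<bar> < \<delta>" "norm z < \<rho>" for t z
      using Y[OF \<delta>(2)] that by simp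
    show "norm (Y t z - Y t z') \<le> L * norm (z - z')" if "\<bar>t\<bar> < \<delta>" "norm z < \<rho>" "norm z' < \<rho>" for t z z'
      using Y_lip[OF \<delta>(2)] that by simp
    show "\<exists>y'. (Y t has_derivative y') (at z)" if "\<bar>t\<bar> < \<delta>" "norm z < \<rho>" for t z
      using Y_diff[OF \<delta>(2)] that by (simp add: interior_open)
    show "norm (t *\<^sub>R \<Theta> (t, z, Y t z)) < 1" if "\<bar>t\<bar> < \<delta>" "norm z < \<rho>" for t z
      using small that by blast
    fix t z assume t: "t \<in> {0<..<\<delta>}" and z: "norm z < \<rho>" "z \<in> C"
    define y where "y = Y t z"
    have t': "t \<noteq> 0" "\<bar>t\<bar> < \<delta>" using t by auto
    have y: "\<Gamma> (t, z, y) = y" "norm y \<le> R" using Y[OF \<delta>(2)[OF t'(2)]] z by (auto simp: y_def)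
    let ?z' = "z + t *\<^sub>R \<Theta> (t, z, y)"
    let ?\<mu>0 = "mu0 t (fst z) (fst y) (snd y)" and ?\<mu>1 = "mu1 t (fst z) (snd z) (fst y) (snd y)"
    have rel: "rattle_rel t z y ?\<mu>0 ?\<mu>1 ?z'" and C': "?z' \<in> C"
      using fixed_point_imp_rattle_rel[OF y(1)] fixed_point_imp_in_C[OF z(2) y(1)] by auto
    have "reduced_midpoint_step t (kick h t ?\<mu>0 z) (minus_state t z y) \<and> ?z' = kick h t ?\<mu>1 (minus_state t z y)"
      using rattle_rel_imp_rattle_equations[of t z "fst y" "snd y"] rel by simp
    moreover have "kick h t ?\<mu>0 z \<in> ball z 1" "minus_state t z y \<in> ball z 1" "?z' \<in> ball z 1"
      using small[OF t'(2) z(1), folded y_def]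
      by (simp_all add: kick_eq minus_state_eq[OF y(1)] dist_norm)
    ultimately have "step t 1 z ?\<mu>0 (minus_state t z y) ?\<mu>1 ?z'"
      using C' by (simp add: rattle_step_def)
    moreover have "\<mu>0' = ?\<mu>0 \<and> zm' = minus_state t z y \<and> \<mu>1' = ?\<mu>1 \<and> z1' = ?z'"
      if s: "step t 1 z \<mu>0' zm' \<mu>1' z1'" for \<mu>0' zm' \<mu>1' z1'
    proof -
      obtain y' where y': "norm y' \<le> R1" "rattle_rel t z y' \<mu>0' \<mu>1' z1'" "zm' = minus_state t z y'"
        using R1[OF t'(1) z(1) s] by blast
      have z1: "z1' \<in> C" using s unfolding rattle_step_def by blast
      note * = rattle_rel_imp_fixed_point[OF z(2) z1 t'(1) y'(2)]
      have "y' = y" unfolding y_def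
        by (rule Y_unique[OF \<delta>(2)[OF t'(2)] _ _ *(3)]) (use z y'(1) R in auto)
      then show ?thesis using * y'(3) by simp
    qed
    ultimately show "unique_step t 1 z (z + t *\<^sub>R \<Theta> (t, z, Y t z))"
      unfolding y_def unique_step_def by metis
  qed
qed

lemma compact_subset_ball:
  fixes K :: "'a::real_normed_vector set"
  assumes "compact K"
  obtains \<rho> where "\<And>z. z \<in> K \<Longrightarrow> norm z < \<rho>"
  using compact_imp_bounded[OF assms] unfolding bounded_iff by (metis le_less_trans less_add_one)

text \<open>The radius \<open>1\<close> is admissible for every compact set, so a single choice, independent of the
  compact set, defines the integrator.\<close>

lemma integrator_exists: "\<exists>\<Phi>. integrator \<Phi>"
proof -
  define \<Phi> where "\<Phi> t z = (SOME z'. \<exists>\<mu>0 zm \<mu>1. step t 1 z \<mu>0 zm \<mu>1 z')" for t z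
  have "integrator \<Phi>"
    unfolding integrator_def
  proof (intro allI impI)
    fix K assume K: "compact K \<and> K \<subseteq> C"
    obtain \<rho> where \<rho>: "\<And>z. z \<in> K \<Longrightarrow> norm z < \<rho>"
      using K compact_subset_ball by metis
    obtain \<delta> Y where \<delta>: "\<delta> > 0" and flow: "\<And>t z. t \<in> {0<..<\<delta>} \<Longrightarrow> norm z < \<rho> \<Longrightarrow> z \<in> C \<Longrightarrow>
      unique_step t 1 z (z + t *\<^sub>R \<Theta> (t, z, Y t z))"
      by (rule local_flow[of \<rho>]) blast
    have "unique_step t 1 z (\<Phi> t z)" if "t \<in> {0<..<\<delta>}" "z \<in> K" for t z
    proof -
      have ex: "unique_step t 1 z (z + t *\<^sub>R \<Theta> (t, z, Y t z))"
        using flow[of t z] that \<rho> K by blast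
      then have "\<Phi> t z = z + t *\<^sub>R \<Theta> (t, z, Y t z)"
        unfolding \<Phi>_def unique_step_def by (intro some_equality) blast+
      then show ?thesis using ex by simp
    qed
    then show "\<exists>\<delta>>0. \<exists>r>0. \<forall>t\<in>{0<..<\<delta>}. \<forall>z\<in>K. unique_step t r z (\<Phi> t z)"
      using \<delta> zero_less_one[where 'a=real] by blast
  qed
  then show ?thesis by blast
qed

text \<open>The radius in the definition of an integrator may differ from \<open>1\<close>. A solution within the smaller
  of the two radii also solves the equations within the larger one, where solutions are unique, so
  the two agree.\<close>

lemma integrator_flow:
  assumes "integrator \<Phi>"
  obtains R \<delta> L Y where "\<delta> > 0" "L > 0"
    "\<And>t z. \<bar>t\<bar> < \<delta> \<Longrightarrow> norm z < \<rho> \<Longrightarrow> norm (Y t z) \<le> R \<and> \<Gamma> (t, z, Y t z) = Y t z"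
    "\<And>t z z'. \<bar>t\<bar> < \<delta> \<Longrightarrow> norm z < \<rho> \<Longrightarrow> norm z' < \<rho> \<Longrightarrow> norm (Y t z - Y t z') \<le> L * norm (z - z')"
    "\<And>t z. \<bar>t\<bar> < \<delta> \<Longrightarrow> norm z < \<rho> \<Longrightarrow> \<exists>y'. (Y t has_derivative y') (at z)"
    "\<And>t z. \<bar>t\<bar> < \<delta> \<Longrightarrow> norm z < \<rho> \<Longrightarrow> norm (t *\<^sub>R \<Theta> (t, z, Y t z)) < 1"
    "\<And>t z. t \<in> {0<..<\<delta>} \<Longrightarrow> norm z < \<rho> \<Longrightarrow> z \<in> C \<Longrightarrow> \<Phi> t z = z + t *\<^sub>R \<Theta> (t, z, Y t z)"
proof -
  obtain R \<delta>1 L Y where \<delta>1: "\<delta>1 > 0" and L: "L > 0" and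
    Y: "\<And>t z. \<bar>t\<bar> < \<delta>1 \<Longrightarrow> norm z < \<rho> \<Longrightarrow> norm (Y t z) \<le> R \<and> \<Gamma> (t, z, Y t z) = Y t z"
    "\<And>t z z'. \<bar>t\<bar> < \<delta>1 \<Longrightarrow> norm z < \<rho> \<Longrightarrow> norm z' < \<rho> \<Longrightarrow> norm (Y t z - Y t z') \<le> L * norm (z - z')"
    "\<And>t z. \<bar>t\<bar> < \<delta>1 \<Longrightarrow> norm z < \<rho> \<Longrightarrow> \<exists>y'. (Y t has_derivative y') (at z)"
    "\<And>t z. \<bar>t\<bar> < \<delta>1 \<Longrightarrow> norm z < \<rho> \<Longrightarrow> norm (t *\<^sub>R \<Theta> (t, z, Y t z)) < 1" and
    flow: "\<And>t z. t \<in> {0<..<\<delta>1} \<Longrightarrow> norm z < \<rho> \<Longrightarrow> z \<in> C \<Longrightarrow>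
      unique_step t 1 z (z + t *\<^sub>R \<Theta> (t, z, Y t z))"
    by (rule local_flow[of \<rho>]) blast
  let ?K = "C \<inter> cball 0 \<rho>"
  have "compact ?K \<and> ?K \<subseteq> C"
    using closed_C compact_cball closed_Int_compact by blast
  then obtain \<delta>2 r where \<delta>2: "\<delta>2 > 0" and \<Phi>: "\<forall>t\<in>{0<..<\<delta>2}. \<forall>z\<in>?K.
        unique_step t r z (\<Phi> t z)"
    using assms unfolding integrator_def by meson
  have agree: "\<Phi> t z = z + t *\<^sub>R \<Theta> (t, z, Y t z)"
    if t: "t \<in> {0<..<min \<delta>1 \<delta>2}" and z: "norm z < \<rho>" "z \<in> C" for t z
  proof -
    have 1: "unique_step t 1 z (z + t *\<^sub>R \<Theta> (t, z, Y t z))"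
      using flow[of t z] t z by simp
    have 2: "unique_step t r z (\<Phi> t z)"
      using \<Phi> t z by simp
    show ?thesis
    proof (cases "r \<le> 1")
      case True
      then show ?thesis using 1 2 step_mono[of t r _ _ _ _ _ 1] unfolding unique_step_def by metis
    next
      case False
      then have "1 \<le> r" by simp
      then show ?thesis using 1 2 step_mono[of t 1 _ _ _ _ _ r] unfolding unique_step_def by metis
    qed
  qed
  show ?thesis
    by (rule that[of "min \<delta>1 \<delta>2" L, OF _ L Y(1) Y(2) Y(3) Y(4) agree]) (use \<delta>1 \<delta>2 in auto)
qed

end


section \<open>Symplecticity\<close>

lemma has_derivative_transform_nhds:
  assumes "(f has_derivative f') (at x)" "\<forall>\<^sub>F y in nhds x. f y = g y"
  shows "(g has_derivative f') (at x)"
  using has_derivative_transform_eventually[OF assms(1), of g] assms(2)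
  by (simp add: eventually_nhds_conv_at)

context reduced_system
begin

text \<open>\<open>(f, A w)\<close> is the gradient of \<open>Hr\<close>.\<close>

lemma Hessian_symmetric:
  "frechet_derivative f (at x) a \<bullet> fst b + frechet_derivative (\<lambda>x. A (fst x) *v snd x) (at x) a \<bullet> snd b =
   frechet_derivative f (at x) b \<bullet> fst a + frechet_derivative (\<lambda>x. A (fst x) *v snd x) (at x) b \<bullet> snd a"
proof -
  let ?a = "\<lambda>x. A (fst x) *v snd x"
  have sm: "smooth ?a"
    by (intro smooth_matrix_vector_mult smooth_compose[OF smooth_A] smooth_fst smooth_snd smooth_ident)
  have "frechet_derivative (\<lambda>y. frechet_derivative Hr (at y) b) (at x) a =
      frechet_derivative f (at x) a \<bullet> fst b + frechet_derivative ?a (at x) a \<bullet> snd b" for a b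
  proof -
    have eq: "(\<lambda>y. frechet_derivative Hr (at y) b) = (\<lambda>y. f y \<bullet> fst b + ?a y \<bullet> snd b)"
      using Hr_derivative[of "fst y" "snd y" "fst b" "snd b" for y] by (intro ext) simp
    have "((\<lambda>y. f y \<bullet> fst b + ?a y \<bullet> snd b) has_derivative
        (\<lambda>a. frechet_derivative f (at x) a \<bullet> fst b + frechet_derivative ?a (at x) a \<bullet> snd b)) (at x)"
      by (intro has_derivative_add has_derivative_inner_left smooth_has_derivative smooth_f sm)
    from frechet_derivative_at[OF this, symmetric] show ?thesis
      unfolding eq by (rule fun_cong)
  qed
  then show ?thesis using symmetric_second_derivative[OF smooth_Hr, of b x a] by simp
qed

abbreviation constraint_force :: "(real^'n) \<times> (real^'l) \<Rightarrow> real^'n" where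
  "constraint_force \<equiv> \<lambda>x. BT (fst x) (snd x)"

lemma smooth_constraint_force: "smooth constraint_force"
  unfolding BT_def
  by (intro smooth_matrix_vector_mult smooth_transpose smooth_compose[OF smooth_B] smooth_fst
      smooth_snd smooth_ident)

lemma BT_inner: "BT q \<mu> \<bullet> a = \<mu> \<bullet> (B q *v a)"
  by (simp add: BT_def dot_lmul_matrix)

text \<open>For fixed \<open>\<mu>\<close> the constraint force is the gradient of \<open>\<mu> \<cdot> h\<close>, which has a symmetric Hessian. The
  part coming from the variation of \<open>\<mu>\<close> lies in the range of \<open>Dh\<^sup>T\<close> and is orthogonal to the vectors
  annihilated by \<open>Dh\<close>.\<close>

lemma constraint_force_symmetric:
  assumes "B q *v a = 0" "B q *v a' = 0"
  shows "frechet_derivative constraint_force (at (q, \<mu>)) (a', b') \<bullet> a = frechet_derivative constraint_force (at (q, \<mu>)) (a, b) \<bullet> a'"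
proof -
  have *: "frechet_derivative constraint_force (at (q, \<mu>)) (a', b') \<bullet> a =
      \<mu> \<bullet> frechet_derivative (\<lambda>y. frechet_derivative h (at y) a) (at q) a'"
    if a: "B q *v a = 0" for a a' b'
  proof -
    have d1: "((\<lambda>x. constraint_force x \<bullet> a) has_derivative (\<lambda>c. frechet_derivative constraint_force (at (q, \<mu>)) c \<bullet> a)) (at (q, \<mu>))"
      by (intro has_derivative_inner_left smooth_has_derivative smooth_constraint_force)
    have d2: "((\<lambda>x. snd x \<bullet> frechet_derivative h (at (fst x)) a) has_derivative
        (\<lambda>c. snd (q, \<mu>) \<bullet> frechet_derivative (\<lambda>y. frechet_derivative h (at y) a) (at (fst (q, \<mu>))) (fst c)
          + snd c \<bullet> frechet_derivative h (at (fst (q, \<mu>))) a)) (at (q, \<mu>))"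
      by (intro has_derivative_inner has_derivative_snd has_derivative_ident
          has_derivative_compose[where g = "\<lambda>y. frechet_derivative h (at y) a", OF has_derivative_fst[OF has_derivative_ident]]
          smooth_has_derivative smooth_directional smooth_h)
    have eq: "(\<lambda>x. constraint_force x \<bullet> a) = (\<lambda>x. snd x \<bullet> frechet_derivative h (at (fst x)) a)"
      by (simp add: BT_inner jacobian_mult_eq_derivative[OF smooth_h])
    from fun_cong[OF has_derivative_unique[OF d1[unfolded eq] d2], of "(a', b')"] show ?thesis
      using a by (simp add: jacobian_mult_eq_derivative[OF smooth_h])
  qed
  show ?thesis
    unfolding *[OF assms(1)] *[OF assms(2)] symmetric_second_derivative[OF smooth_h, of a q a'] ..
qed

text \<open>All equations of the step hold for every \<open>x\<close> near \<open>z\<close>, also off the constraint set, and can be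
  differentiated. In terms of the variations \<open>Q'\<close>, \<open>W'\<close> of the midpoint, the start and the endpoint
  are symmetric around it, and the change of the two-form is a sum of three antisymmetrized terms: one
  for the Hessian of \<open>Hr\<close> and one for each kick.\<close>

lemma flow_preserves_form:
  fixes Yt :: "'n phase \<Rightarrow> 'n phase"
  assumes Y': "(Yt has_derivative Y') (at z)"
    and fp: "\<forall>\<^sub>F x in nhds z. \<Gamma> (t, x, Yt x) = Yt x"
  obtains \<Psi>' where "((\<lambda>x. x + t *\<^sub>R \<Theta> (t, x, Yt x)) has_derivative \<Psi>') (at z)"
    "\<And>u v. B (fst z) *v fst u = 0 \<Longrightarrow> B (fst z) *v fst v = 0 \<Longrightarrow>
      B (fst (z + t *\<^sub>R \<Theta> (t, z, Yt z))) *v fst (\<Psi>' u) = 0 \<Longrightarrow>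
      B (fst (z + t *\<^sub>R \<Theta> (t, z, Yt z))) *v fst (\<Psi>' v) = 0 \<Longrightarrow>
      dq_wedge_dp (\<Psi>' u) (\<Psi>' v) = dq_wedge_dp u v"
proof -
  let ?a = "\<lambda>x. A (fst x) *v snd x"
  let ?F = "\<lambda>x. f (fst x + (t / 2) *\<^sub>R fst (Yt x), snd (Yt x))"
  define \<Psi> where "\<Psi> x = x + t *\<^sub>R \<Theta> (t, x, Yt x)" for x
  define m0 where "m0 x = mu0 t (fst x) (fst (Yt x)) (snd (Yt x))" for x
  define m1 where "m1 x = mu1 t (fst x) (snd x) (fst (Yt x)) (snd (Yt x))" for x
  have sm: "smooth ?a"
    by (intro smooth_matrix_vector_mult smooth_compose[OF smooth_A] smooth_fst smooth_snd smooth_ident)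
  have comp: "\<exists>\<phi>'. ((\<lambda>x. \<phi> (x, Yt x)) has_derivative \<phi>') (at z)"
    if "smooth \<phi>" for \<phi> :: "'n phase \<times> 'n phase \<Rightarrow> 'b::euclidean_space"
    using has_derivative_compose[OF has_derivative_Pair[OF has_derivative_ident Y']
        smooth_has_derivative[OF that]] by blast
  have "smooth (\<lambda>x::'n phase \<times> 'n phase. mu0 t (fst (fst x)) (fst (snd x)) (snd (snd x)))"
    by (intro smooth_mu0 smooth_const smooth_fst smooth_snd smooth_ident)
  from comp[OF this] obtain m0' where m0': "(m0 has_derivative m0') (at z)"
    unfolding m0_def[abs_def] by auto
  have "smooth (\<lambda>x::'n phase \<times> 'n phase. mu1 t (fst (fst x)) (snd (fst x)) (fst (snd x)) (snd (snd x)))"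
    by (intro smooth_mu1 smooth_const smooth_fst smooth_snd smooth_ident)
  from comp[OF this] obtain m1' where m1': "(m1 has_derivative m1') (at z)"
    unfolding m1_def[abs_def] by auto
  have "smooth (\<lambda>x::'n phase \<times> 'n phase. fst x + t *\<^sub>R \<Theta> (t, x))"
    by (intro smooth_add smooth_scaleR smooth_compose[OF smooth_\<Theta>] smooth_Pair smooth_const smooth_fst smooth_ident)
  from comp[OF this] obtain \<Psi>' where \<Psi>': "(\<Psi> has_derivative \<Psi>') (at z)"
    unfolding \<Psi>_def[abs_def] by auto
  have rel: "\<forall>\<^sub>F x in nhds z. rattle_rel t x (Yt x) (m0 x) (m1 x) (\<Psi> x)"
    using fp by eventually_elim (simp only: m0_def m1_def \<Psi>_def fixed_point_imp_rattle_rel)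
  define V' W' where "V' u = fst (Y' u)" and "W' u = snd (Y' u)" for u
  define Q' where "Q' u = fst u + (t / 2) *\<^sub>R V' u" for u :: "'n phase"
  define F' where "F' u = frechet_derivative f (at (fst z + (t / 2) *\<^sub>R fst (Yt z), snd (Yt z))) (Q' u, W' u)" for u
  define K0 where "K0 u = frechet_derivative constraint_force (at (fst z, m0 z)) (fst u, m0' u)" for u
  define K1 where "K1 u = frechet_derivative constraint_force (at (fst (\<Psi> z), m1 z)) (fst (\<Psi>' u), m1' u)" for u
  have V: "((\<lambda>x. fst (Yt x)) has_derivative V') (at z)" and W: "((\<lambda>x. snd (Yt x)) has_derivative W') (at z)"
    unfolding V'_def W'_def by (intro has_derivative_fst has_derivative_snd Y')+
  have mid: "((\<lambda>x. (fst x + (t / 2) *\<^sub>R fst (Yt x), snd (Yt x))) has_derivative (\<lambda>u. (Q' u, W' u))) (at z)"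
    unfolding Q'_def
    by (intro has_derivative_Pair has_derivative_add has_derivative_scaleR_right V W
        has_derivative_fst has_derivative_ident)
  have F: "(?F has_derivative F') (at z)"
    unfolding F'_def by (rule has_derivative_compose[OF mid smooth_has_derivative[OF smooth_f]])
  have K0: "((\<lambda>x. BT (fst x) (m0 x)) has_derivative K0) (at z)"
    using has_derivative_compose[OF has_derivative_Pair[OF has_derivative_fst[OF has_derivative_ident] m0']
        smooth_has_derivative[OF smooth_constraint_force]] by (simp add: K0_def[abs_def])
  have K1: "((\<lambda>x. BT (fst (\<Psi> x)) (m1 x)) has_derivative K1) (at z)"
    using has_derivative_compose[OF has_derivative_Pair[OF has_derivative_fst[OF \<Psi>'] m1']
        smooth_has_derivative[OF smooth_constraint_force]] by (simp add: K1_def[abs_def])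
  have derivative_eq: "\<alpha>' = \<beta>'"
    if "\<forall>\<^sub>F x in nhds z. \<alpha> x = \<beta> x" "(\<alpha> has_derivative \<alpha>') (at z)" "(\<beta> has_derivative \<beta>') (at z)"
    for \<alpha> \<beta> :: "'n phase \<Rightarrow> real^'n" and \<alpha>' \<beta>'
    using has_derivative_unique[OF has_derivative_transform_nhds[OF that(2,1)] that(3)] .
  have eqV: "V' u = frechet_derivative ?a (at (fst z + (t / 2) *\<^sub>R fst (Yt z), snd (Yt z))) (Q' u, W' u)" for u
  proof -
    have ev: "\<forall>\<^sub>F x in nhds z. fst (Yt x) = ?a (fst x + (t / 2) *\<^sub>R fst (Yt x), snd (Yt x))"
      using rel by eventually_elim (auto simp: rattle_rel_def case_prod_unfold)
    show ?thesis
      by (rule fun_cong[OF derivative_eq[OF ev V has_derivative_compose[OF mid smooth_has_derivative[OF sm]]]])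
  qed
  have eqW: "W' u = snd u - (t / 2) *\<^sub>R (K0 u + F' u)" for u
  proof -
    have ev: "\<forall>\<^sub>F x in nhds z. snd (Yt x) = snd x - (t / 2) *\<^sub>R (BT (fst x) (m0 x) + ?F x)"
      using rel by eventually_elim (auto simp: rattle_rel_def case_prod_unfold)
    have d: "((\<lambda>x. snd x - (t / 2) *\<^sub>R (BT (fst x) (m0 x) + ?F x)) has_derivative
        (\<lambda>u. snd u - (t / 2) *\<^sub>R (K0 u + F' u))) (at z)"
      by (intro has_derivative_diff has_derivative_add has_derivative_scaleR_right K0 F
          has_derivative_snd has_derivative_ident)
    show ?thesis by (rule fun_cong[OF derivative_eq[OF ev W d]])
  qed
  have eqQ1: "fst (\<Psi>' u) = fst u + t *\<^sub>R V' u" for u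
  proof -
    have ev: "\<forall>\<^sub>F x in nhds z. fst (\<Psi> x) = fst x + t *\<^sub>R fst (Yt x)"
      using rel by eventually_elim (auto simp: rattle_rel_def case_prod_unfold)
    have d: "((\<lambda>x. fst x + t *\<^sub>R fst (Yt x)) has_derivative (\<lambda>u. fst u + t *\<^sub>R V' u)) (at z)"
      by (intro has_derivative_add has_derivative_scaleR_right V has_derivative_fst has_derivative_ident)
    show ?thesis by (rule fun_cong[OF derivative_eq[OF ev has_derivative_fst[OF \<Psi>'] d]])
  qed
  have eqP1: "snd (\<Psi>' u) = W' u - (t / 2) *\<^sub>R (K1 u + F' u)" for u
  proof -
    have ev: "\<forall>\<^sub>F x in nhds z. snd (\<Psi> x) = snd (Yt x) - (t / 2) *\<^sub>R (BT (fst (\<Psi> x)) (m1 x) + ?F x)"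
      using rel by eventually_elim (auto simp: rattle_rel_def case_prod_unfold)
    have d: "((\<lambda>x. snd (Yt x) - (t / 2) *\<^sub>R (BT (fst (\<Psi> x)) (m1 x) + ?F x)) has_derivative
        (\<lambda>u. W' u - (t / 2) *\<^sub>R (K1 u + F' u))) (at z)"
      by (intro has_derivative_diff has_derivative_add has_derivative_scaleR_right K1 F W)
    show ?thesis by (rule fun_cong[OF derivative_eq[OF ev has_derivative_snd[OF \<Psi>'] d]])
  qed
  show ?thesis
  proof (rule that)
    show "((\<lambda>x. x + t *\<^sub>R \<Theta> (t, x, Yt x)) has_derivative \<Psi>') (at z)"
      using \<Psi>' unfolding \<Psi>_def[abs_def] .
    fix u v
    assume tan: "B (fst z) *v fst u = 0" "B (fst z) *v fst v = 0"
      "B (fst (z + t *\<^sub>R \<Theta> (t, z, Yt z))) *v fst (\<Psi>' u) = 0"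
      "B (fst (z + t *\<^sub>R \<Theta> (t, z, Yt z))) *v fst (\<Psi>' v) = 0"
    have S: "F' u \<bullet> Q' v + V' u \<bullet> W' v = F' v \<bullet> Q' u + V' v \<bullet> W' u"
      using Hessian_symmetric[of _ "(Q' u, W' u)" "(Q' v, W' v)"] by (simp add: F'_def eqV)
    have k0: "K0 v \<bullet> fst u = K0 u \<bullet> fst v"
      unfolding K0_def by (rule constraint_force_symmetric[OF tan(1,2)])
    have k1: "K1 v \<bullet> fst (\<Psi>' u) = K1 u \<bullet> fst (\<Psi>' v)"
      unfolding K1_def by (rule constraint_force_symmetric) (use tan(3,4) in \<open>simp_all add: \<Psi>_def\<close>)
    have e: "fst u = Q' u - (t / 2) *\<^sub>R V' u" "fst (\<Psi>' u) = Q' u + (t / 2) *\<^sub>R V' u"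
        "snd u = W' u + (t / 2) *\<^sub>R (K0 u + F' u)" for u
      by (simp_all add: eqQ1 Q'_def eqW vec_eq_iff field_simps)
    have "dq_wedge_dp (\<Psi>' u) (\<Psi>' v) - dq_wedge_dp u v =
        t * ((F' u \<bullet> Q' v + V' u \<bullet> W' v) - (F' v \<bullet> Q' u + V' v \<bullet> W' u))
        - (t / 2) * (K1 v \<bullet> fst (\<Psi>' u) - K1 u \<bullet> fst (\<Psi>' v))
        - (t / 2) * (K0 v \<bullet> fst u - K0 u \<bullet> fst v)"
      unfolding dq_wedge_dp_def eqP1 e[of u] e[of v]
      by (simp add: inner_add_left inner_add_right inner_diff_left inner_diff_right
          inner_commute field_simps)
    then show "dq_wedge_dp (\<Psi>' u) (\<Psi>' v) = dq_wedge_dp u v" using S k0 k1 by simp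
  qed
qed

lemma tangent_space_C:
  assumes "u \<in> tangent_space C z"
  shows "B (fst z) *v fst u = 0"
proof -
  obtain \<gamma> where \<gamma>: "\<gamma> 0 = z" "\<forall>\<^sub>F s in nhds 0. \<gamma> s \<in> C" "(\<gamma> has_vector_derivative u) (at (0::real))"
    using assms by (auto simp: tangent_space_def)
  have 1: "((\<lambda>s. h (fst (\<gamma> s))) has_derivative (\<lambda>s. frechet_derivative h (at (fst z)) (fst (s *\<^sub>R u)))) (at 0)"
    using has_derivative_compose[OF has_derivative_fst[OF \<gamma>(3)[unfolded has_vector_derivative_def]]
        smooth_has_derivative[OF smooth_h]] by (simp add: \<gamma>(1))
  have "\<forall>\<^sub>F s in nhds 0. h (fst (\<gamma> s)) = 0"
    using \<gamma>(2) by eventually_elim (auto simp: C_def)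
  then have "((\<lambda>s. h (fst (\<gamma> s))) has_derivative (\<lambda>s. 0)) (at 0)"
    by (intro has_derivative_transform_nhds[OF has_derivative_const[of 0]]) (auto elim: eventually_mono)
  from fun_cong[OF has_derivative_unique[OF 1 this], of 1] show ?thesis
    by (simp add: jacobian_mult_eq_derivative[OF smooth_h])
qed

lemma tangent_space_image:
  assumes u: "u \<in> tangent_space C z"
    and D: "(\<phi> has_derivative \<phi>') (at z)"
    and inC: "\<forall>\<^sub>F x in nhds z. x \<in> C \<longrightarrow> \<phi> x \<in> C"
  shows "\<phi>' u \<in> tangent_space C (\<phi> z)"
proof -
  obtain \<gamma> where \<gamma>: "\<gamma> 0 = z" "\<forall>\<^sub>F s in nhds 0. \<gamma> s \<in> C" "(\<gamma> has_vector_derivative u) (at (0::real))"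
    using u by (auto simp: tangent_space_def)
  have "((\<lambda>s. \<phi> (\<gamma> s)) has_derivative (\<lambda>s. \<phi>' (s *\<^sub>R u))) (at 0)"
    using has_derivative_compose[OF \<gamma>(3)[unfolded has_vector_derivative_def]] D \<gamma>(1) by blast
  then have d: "((\<lambda>s. \<phi> (\<gamma> s)) has_vector_derivative \<phi>' u) (at 0)"
    by (simp add: has_vector_derivative_def linear_scale[OF has_derivative_linear[OF D]])
  have "isCont \<gamma> 0"
    using \<gamma>(3) has_vector_derivative_continuous by blast
  then have "filterlim \<gamma> (nhds z) (nhds 0)"
    using \<gamma>(1) by (metis continuous_at_imp_continuous_on isCont_def tendsto_nhds_iff)
  then have "\<forall>\<^sub>F s in nhds 0. \<gamma> s \<in> C \<longrightarrow> \<phi> (\<gamma> s) \<in> C"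
    using inC unfolding filterlim_iff by blast
  then have "\<forall>\<^sub>F s in nhds 0. \<phi> (\<gamma> s) \<in> C"
    using \<gamma>(2) by eventually_elim blast
  then show ?thesis
    unfolding tangent_space_def using d \<gamma>(1) by (auto intro!: exI[of _ "\<lambda>s. \<phi> (\<gamma> s)"])
qed

theorem integrator_symplectic:
  assumes "integrator \<Phi>"
  shows "symplectic_integrator_on C \<Phi>"
  unfolding symplectic_integrator_on_def
proof (intro allI impI)
  fix K assume K: "compact K \<and> K \<subseteq> C"
  obtain \<rho> where \<rho>: "\<And>z. z \<in> K \<Longrightarrow> norm z < \<rho>"
    using K compact_subset_ball by metis
  obtain R \<delta> Y where \<delta>: "\<delta> > 0" and
    Y: "\<And>t z. \<bar>t\<bar> < \<delta> \<Longrightarrow> norm z < \<rho> \<Longrightarrow> norm (Y t z) \<le> R \<and> \<Gamma> (t, z, Y t z) = Y t z" and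
    Y_diff: "\<And>t z. \<bar>t\<bar> < \<delta> \<Longrightarrow> norm z < \<rho> \<Longrightarrow> \<exists>y'. (Y t has_derivative y') (at z)" and
    \<Phi>: "\<And>t z. t \<in> {0<..<\<delta>} \<Longrightarrow> norm z < \<rho> \<Longrightarrow> z \<in> C \<Longrightarrow> \<Phi> t z = z + t *\<^sub>R \<Theta> (t, z, Y t z)"
    by (rule integrator_flow[OF assms, of \<rho>]) blast
  have "\<Phi> t z \<in> C \<and> symplectic_at C (\<Phi> t) z" if t: "t \<in> {0<..<\<delta>}" and "z \<in> K" for t z
  proof -
    have t': "\<bar>t\<bar> < \<delta>" using t by auto
    have z: "z \<in> C" "norm z < \<rho>" using that K \<rho> by auto
    let ?\<Psi> = "\<lambda>x. x + t *\<^sub>R \<Theta> (t, x, Y t x)"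
    have near: "\<forall>\<^sub>F x in nhds z. norm x < \<rho>"
      using eventually_nhds_in_open[of "ball 0 \<rho>" z] z by simp
    have fp: "\<forall>\<^sub>F x in nhds z. \<Gamma> (t, x, Y t x) = Y t x"
      using near by eventually_elim (use Y[OF t'] in blast)
    obtain Y' where "(Y t has_derivative Y') (at z)" using Y_diff[OF t' z(2)] by blast
    then obtain \<Psi>' where \<Psi>': "(?\<Psi> has_derivative \<Psi>') (at z)"
      and form: "\<And>u v. B (fst z) *v fst u = 0 \<Longrightarrow> B (fst z) *v fst v = 0 \<Longrightarrow>
        B (fst (?\<Psi> z)) *v fst (\<Psi>' u) = 0 \<Longrightarrow> B (fst (?\<Psi> z)) *v fst (\<Psi>' v) = 0 \<Longrightarrow>
        dq_wedge_dp (\<Psi>' u) (\<Psi>' v) = dq_wedge_dp u v"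
      by (rule flow_preserves_form[OF _ fp]) blast
    have inC: "\<forall>\<^sub>F x in nhds z. x \<in> C \<longrightarrow> ?\<Psi> x \<in> C"
      using fp by eventually_elim (use fixed_point_imp_in_C in blast)
    have tan: "B (fst (?\<Psi> z)) *v fst (\<Psi>' u) = 0" if "u \<in> tangent_space C z" for u
      by (rule tangent_space_C[OF tangent_space_image[OF that \<Psi>' inC]])
    have "\<forall>\<^sub>F x in at z within C. ?\<Psi> x = \<Phi> t x"
      using near unfolding eventually_at_filter by eventually_elim (use \<Phi>[OF t] in auto)
    then have "(\<Phi> t has_derivative \<Psi>') (at z within C)"
      using has_derivative_transform_eventually[OF has_derivative_at_withinI[OF \<Psi>']] \<Phi>[OF t z(2,1)] z(1)
      by auto
    moreover have "\<forall>u\<in>tangent_space C z. \<forall>v\<in>tangent_space C z.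
        dq_wedge_dp (\<Psi>' u) (\<Psi>' v) = dq_wedge_dp u v"
      using form tan tangent_space_C by blast
    moreover have "\<Phi> t z \<in> C"
      using inC[THEN eventually_nhds_x_imp_x] z \<Phi>[OF t z(2,1)] by simp
    ultimately show ?thesis unfolding symplectic_at_def by blast
  qed
  then show "\<exists>\<delta>>0. \<forall>t\<in>{0<..<\<delta>}. \<forall>z\<in>K. \<Phi> t z \<in> C \<and> symplectic_at C (\<Phi> t) z"
    using \<delta> by blast
qed

end


section \<open>Second order convergence\<close>

lemma vector_differentiable_bound:
  fixes g :: "real \<Rightarrow> 'a::real_normed_vector"
  assumes ab: "a \<le> b"
    and g: "\<And>r. r \<in> {a..b} \<Longrightarrow> (g has_vector_derivative g' r) (at r within {a..b})"
    and bound: "\<And>r. r \<in> {a..b} \<Longrightarrow> norm (g' r) \<le> c"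
  shows "norm (g b - g a) \<le> c * (b - a)"
proof -
  have "norm (g b - g a) \<le> c * norm (b - a)"
  proof (rule differentiable_bound[where S = "{a..b}"])
    show "(g has_derivative (\<lambda>h. h *\<^sub>R g' r)) (at r within {a..b})" if "r \<in> {a..b}" for r
      using g[OF that] by (simp add: has_vector_derivative_def)
    show "onorm (\<lambda>h. h *\<^sub>R g' r) \<le> c" if "r \<in> {a..b}" for r
      by (rule onorm_le) (use bound[OF that] in \<open>simp add: mult.commute[of c] mult_left_mono\<close>)
  qed (use ab in auto)
  then show ?thesis using ab by simp
qed

lemma smooth_has_vector_derivative_compose:
  assumes "smooth \<phi>" "(z has_vector_derivative z') (at t within S)"
  shows "((\<lambda>t. \<phi> (z t)) has_vector_derivative frechet_derivative \<phi> (at (z t)) z') (at t within S)"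
  using has_derivative_compose[OF assms(2)[unfolded has_vector_derivative_def] smooth_has_derivative[OF assms(1)]]
  by (simp add: has_vector_derivative_def linear_scale[OF has_derivative_linear[OF smooth_has_derivative[OF assms(1)]]])

text \<open>Differentiating \<open>X (z t)\<close> twice along the solution gives \<open>X3 (z t)\<close>, which is bounded; three
  applications of the mean value inequality lead back to \<open>z\<close>.\<close>

lemma autonomous_ode_taylor:
  fixes X :: "'a::euclidean_space \<Rightarrow> 'a"
  assumes X: "smooth X"
    and z: "\<And>t. t \<in> {0..T} \<Longrightarrow> (z has_vector_derivative X (z t)) (at t within {0..T})"
  obtains M where "M > 0" "\<And>s t. 0 \<le> s \<Longrightarrow> 0 \<le> t \<Longrightarrow> s + t \<le> T \<Longrightarrow>
    norm (z (s + t) - (z s + t *\<^sub>R X (z s) + (t\<^sup>2 / 2) *\<^sub>R frechet_derivative X (at (z s)) (X (z s)))) \<le> M * t ^ 3"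
proof -
  define X2 where "X2 x = frechet_derivative X (at x) (X x)" for x
  have X2: "smooth X2"
    unfolding X2_def[abs_def] by (intro smooth_derivative_pair X smooth_ident)
  define X3 where "X3 x = frechet_derivative X2 (at x) (X x)" for x
  have X3: "smooth X3"
    unfolding X3_def[abs_def] by (intro smooth_derivative_pair X X2 smooth_ident)
  have "continuous_on {0..T} z"
    using z has_vector_derivative_continuous continuous_on_eq_continuous_within by blast
  then have "bounded (z ` {0..T})"
    by (intro compact_imp_bounded compact_continuous_image) auto
  then obtain M where M: "M > 0" "\<And>x. x \<in> z ` {0..T} \<Longrightarrow> norm (X3 x) \<le> M"
    using smooth_bounded_on[OF X3] by metis
  show ?thesis
  proof (rule that[OF M(1)])
    fix s t :: real assume st: "0 \<le> s" "0 \<le> t" "s + t \<le> T"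
    have d: "((\<lambda>r. \<phi> (z r)) has_vector_derivative frechet_derivative \<phi> (at (z r)) (X (z r))) (at r within {s..b})"
      if "smooth \<phi>" "r \<in> {s..b}" "b \<le> s + t" for \<phi> :: "'a \<Rightarrow> 'a" and r b
    proof -
      have sub: "{s..b} \<subseteq> {0..T}" and r: "r \<in> {0..T}" using that st by auto
      show ?thesis
        by (rule smooth_has_vector_derivative_compose[OF that(1) has_vector_derivative_within_subset[OF z[OF r] sub]])
    qed
    have e2: "norm (X2 (z b) - X2 (z s)) \<le> M * t" if b: "b \<in> {s..s+t}" for b
    proof -
      have "norm (X2 (z b) - X2 (z s)) \<le> M * (b - s)"
        by (rule vector_differentiable_bound[of s b "\<lambda>r. X2 (z r)" "\<lambda>r. X3 (z r)" M])
           (use b st d[OF X2] M(2) in \<open>auto simp: X3_def\<close>)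
      also have "\<dots> \<le> M * t" using b M(1) by (intro mult_left_mono) auto
      finally show ?thesis .
    qed
    have e1: "norm (X (z b) - X (z s) - (b - s) *\<^sub>R X2 (z s)) \<le> M * t\<^sup>2" if b: "b \<in> {s..s+t}" for b
    proof -
      have "norm ((X (z b) - (b - s) *\<^sub>R X2 (z s)) - (X (z s) - (s - s) *\<^sub>R X2 (z s))) \<le> (M * t) * (b - s)"
      proof (rule vector_differentiable_bound[of s b "\<lambda>r. X (z r) - (r - s) *\<^sub>R X2 (z s)" "\<lambda>r. X2 (z r) - X2 (z s)"])
        show "((\<lambda>r. X (z r) - (r - s) *\<^sub>R X2 (z s)) has_vector_derivative X2 (z r) - X2 (z s)) (at r within {s..b})"
          if r: "r \<in> {s..b}" for r
        proof -
          have "((\<lambda>r. (r - s) *\<^sub>R X2 (z s)) has_vector_derivative X2 (z s)) (at r within {s..b})"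
            by (auto intro!: derivative_eq_intros simp: has_vector_derivative_def algebra_simps)
          from has_vector_derivative_diff[OF d[OF X r] this] b show ?thesis by (simp add: X2_def)
        qed
      qed (use b e2 in auto)
      also have "\<dots> \<le> (M * t) * t" using b M(1) st by (intro mult_left_mono) auto
      finally show ?thesis by (simp add: power2_eq_square algebra_simps)
    qed
    have "norm ((z (s + t) - (s + t - s) *\<^sub>R X (z s) - ((s + t - s)\<^sup>2 / 2) *\<^sub>R X2 (z s)) -
        (z s - (s - s) *\<^sub>R X (z s) - ((s - s)\<^sup>2 / 2) *\<^sub>R X2 (z s))) \<le> (M * t\<^sup>2) * (s + t - s)"
    proof (rule vector_differentiable_bound[of s "s + t" "\<lambda>r. z r - (r - s) *\<^sub>R X (z s) - ((r - s)\<^sup>2 / 2) *\<^sub>R X2 (z s)"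
          "\<lambda>r. X (z r) - X (z s) - (r - s) *\<^sub>R X2 (z s)"])
      show "((\<lambda>r. z r - (r - s) *\<^sub>R X (z s) - ((r - s)\<^sup>2 / 2) *\<^sub>R X2 (z s)) has_vector_derivative
          X (z r) - X (z s) - (r - s) *\<^sub>R X2 (z s)) (at r within {s..s + t})" if r: "r \<in> {s..s + t}" for r
      proof -
        have "{s..s + t} \<subseteq> {0..T}" "r \<in> {0..T}" using st r by auto
        then have 1: "(z has_vector_derivative X (z r)) (at r within {s..s + t})"
          using z has_vector_derivative_within_subset by blast
        have 2: "((\<lambda>r. (r - s) *\<^sub>R X (z s)) has_vector_derivative X (z s)) (at r within {s..s + t})"
          by (auto intro!: derivative_eq_intros simp: has_vector_derivative_def algebra_simps)
        have "((\<lambda>r. (r - s)\<^sup>2 / 2) has_real_derivative (r - s)) (at r within {s..s + t})"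
          by (auto intro!: derivative_eq_intros)
        from has_vector_derivative_scaleR[OF this has_vector_derivative_const[of "X2 (z s)"]]
        have 3: "((\<lambda>r. ((r - s)\<^sup>2 / 2) *\<^sub>R X2 (z s)) has_vector_derivative (r - s) *\<^sub>R X2 (z s)) (at r within {s..s + t})"
          by simp
        show ?thesis by (intro has_vector_derivative_diff 1 2 3)
      qed
    qed (use st e1 in auto)
    then show "norm (z (s + t) - (z s + t *\<^sub>R X (z s) + (t\<^sup>2 / 2) *\<^sub>R frechet_derivative X (at (z s)) (X (z s)))) \<le> M * t ^ 3"
      by (simp add: X2_def algebra_simps power2_eq_square power3_eq_cube)
  qed
qed

text \<open>The induction step of a discrete Gronwall estimate.\<close>

lemma one_step_error_propagation:
  fixes E :: "nat \<Rightarrow> real"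
  assumes "a \<ge> 0" "C \<ge> 0" and step: "E (Suc j) \<le> (1 + a) * E j + C" and E: "E j \<le> real j * C * exp (a * real j)"
  shows "E (Suc j) \<le> real (Suc j) * C * exp (a * real (Suc j))"
proof -
  have "E (Suc j) \<le> (1 + a) * (real j * C * exp (a * real j)) + C"
    using mult_left_mono[OF E, of "1 + a"] step assms(1) by linarith
  also have "\<dots> \<le> exp a * (real j * C * exp (a * real j)) + C * exp (a * real (Suc j))"
  proof (rule add_mono)
    show "(1 + a) * (real j * C * exp (a * real j)) \<le> exp a * (real j * C * exp (a * real j))"
      using assms(2) by (intro mult_right_mono exp_ge_add_one_self) auto
    show "C \<le> C * exp (a * real (Suc j))"
      using assms(1,2) mult_left_mono[of 1 "exp (a * real (Suc j))" C] by simp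
  qed
  also have "\<dots> = real (Suc j) * C * exp (a * real (Suc j))"
    by (simp add: algebra_simps exp_add)
  finally show ?thesis .
qed

context reduced_system
begin

text \<open>The slope of the step at \<open>t = 0\<close>, with the fixed point inserted. On \<open>C\<close> it is the vector field of
  the constrained system.\<close>

definition X :: "'n phase \<Rightarrow> 'n phase" where
  "X z = \<Theta> (0, z, \<Gamma> (0, z, 0))"

lemma smooth_X: "smooth X"
  unfolding X_def[abs_def]
  by (intro smooth_compose[OF smooth_\<Theta>] smooth_\<Gamma>_compose smooth_Pair smooth_const smooth_ident)

text \<open>At \<open>t = 0\<close> the second multiplier is twice the multiplier of the constrained system minus the first
  one, so that only the mean of the two, which enters \<open>\<Theta>\<close>, has to be known.\<close>

lemma X_eq:
  assumes "h q = 0"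
  shows "X (q, p) = (A q *v p, - f (q, p) -
    BT q (E q *v (frechet_derivative BA (at q) (A q *v p) *v p - BA q *v f (q, p))))"
proof -
  define v where "v = A q *v p"
  define m where "m = mu0 0 q v p"
  define y where "y = frechet_derivative BA (at q) v *v p"
  have "mu1 0 q p v p = E q *v (2 *\<^sub>R y - BA q *v (BT q m + 2 *\<^sub>R f (q, p)))"
    by (simp add: mu1_def m_def divided_difference_zero y_def)
  also have "\<dots> = 2 *\<^sub>R (E q *v (y - BA q *v f (q, p))) - m"
    using E_cancel[OF assms, of m] by (simp add: matrix_vector_algebra vec_eq_iff algebra_simps)
  finally have m1: "mu1 0 q p v p = 2 *\<^sub>R (E q *v (y - BA q *v f (q, p))) - m" .
  have "(1 / 2) *\<^sub>R (BT q m + BT q (2 *\<^sub>R x - m)) = BT q x" for x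
    unfolding BT_def by (simp add: matrix_vector_algebra del: transpose_matrix_vector)
  then show ?thesis
    by (simp add: X_def \<Gamma>_at_zero \<Theta>_def v_def[symmetric] m_def[symmetric] m1 y_def)
qed

text \<open>Differentiating \<open>h (q t) = 0\<close> once gives the secondary constraint, and differentiating that gives
  a linear equation for the multiplier, which \<open>E\<close> solves.\<close>

lemma exact_solution_vector_field:
  assumes T: "T > 0"
    and q: "\<And>t. t \<in> {0..T} \<Longrightarrow> (q has_vector_derivative A (q t) *v p t) (at t within {0..T})"
    and p: "\<And>t. t \<in> {0..T} \<Longrightarrow>
      (p has_vector_derivative - f (q t, p t) - BT (q t) (lam t)) (at t within {0..T})"
    and hq: "\<And>t. t \<in> {0..T} \<Longrightarrow> h (q t) = 0"
    and t: "t \<in> {0..T}"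
  shows "(q t, p t) \<in> C" "((\<lambda>t. (q t, p t)) has_vector_derivative X (q t, p t)) (at t within {0..T})"
proof -
  have zero: "d = 0" if g: "(g has_vector_derivative d) (at t within {0..T})"
    "\<And>t. t \<in> {0..T} \<Longrightarrow> g t = 0" "t \<in> {0..T}" for g :: "real \<Rightarrow> real^'l" and d t
  proof -
    have "(g has_vector_derivative 0) (at t within {0..T})"
      by (rule has_vector_derivative_transform[OF g(3) _ has_vector_derivative_const[of 0]])
         (use g(2) in simp)
    then show ?thesis
      using vector_derivative_unique_within_closed_interval[OF T, of t g d 0] g(1,3) by simp
  qed
  have BA0: "BA (q t) *v p t = 0" if "t \<in> {0..T}" for t
    using zero[OF smooth_has_vector_derivative_compose[OF smooth_h q[OF that]] hq that]
    by (simp add: BA_def matrix_vector_mul_assoc[symmetric] jacobian_mult_eq_derivative[OF smooth_h])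
  show "(q t, p t) \<in> C" using BA0[OF t] hq[OF t] by (simp add: C_def)
  have "((\<lambda>t. BA (q t) *v p t) has_vector_derivative
      BA (q t) *v (- f (q t, p t) - BT (q t) (lam t)) +
      frechet_derivative BA (at (q t)) (A (q t) *v p t) *v p t) (at t within {0..T})"
    by (rule bounded_bilinear.has_vector_derivative[OF bounded_bilinear_matrix_vector_mult
          smooth_has_vector_derivative_compose[OF smooth_BA q[OF t]] p[OF t]])
  from zero[OF this BA0 t]
  have "BA (q t) *v BT (q t) (lam t) = frechet_derivative BA (at (q t)) (A (q t) *v p t) *v p t
      - BA (q t) *v f (q t, p t)"
    by (simp add: matrix_vector_algebra algebra_simps)
  then have "lam t = E (q t) *v (frechet_derivative BA (at (q t)) (A (q t) *v p t) *v p t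
      - BA (q t) *v f (q t, p t))"
    using E_cancel[OF hq[OF t], of "lam t"] by simp
  then have "X (q t, p t) = (A (q t) *v p t, - f (q t, p t) - BT (q t) (lam t))"
    by (simp add: X_eq[OF hq[OF t]])
  then show "((\<lambda>t. (q t, p t)) has_vector_derivative X (q t, p t)) (at t within {0..T})"
    using has_vector_derivative_Pair[OF q[OF t] p[OF t]] by simp
qed

text \<open>The reversed step has the same slopes \<open>y\<close>, and it is again a fixed point because both endpoints
  lie in \<open>C\<close>.\<close>

lemma reversibility:
  assumes z: "z \<in> C" and t: "t \<noteq> 0" and y: "\<Gamma> (t, z, y) = y"
  shows "\<Gamma> (- t, z + t *\<^sub>R \<Theta> (t, z, y), y) = y"
    "\<Theta> (- t, z + t *\<^sub>R \<Theta> (t, z, y), y) = \<Theta> (t, z, y)"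
proof -
  let ?z' = "z + t *\<^sub>R \<Theta> (t, z, y)"
  have z': "?z' \<in> C" by (rule fixed_point_imp_in_C[OF z y])
  have mt: "- t \<noteq> 0" using t by simp
  note r = rattle_rel_imp_fixed_point[OF z' z mt rattle_rel_symmetric[OF fixed_point_imp_rattle_rel[OF y]]]
  show "\<Gamma> (- t, ?z', y) = y" by (rule r(3))
  have "t *\<^sub>R \<Theta> (- t, ?z', y) = t *\<^sub>R \<Theta> (t, z, y)"
    using r(4) by (simp add: algebra_simps)
  then show "\<Theta> (- t, ?z', y) = \<Theta> (t, z, y)" using t by simp
qed

text \<open>Let \<open>z1 = z + t \<theta>\<close> be the endpoint of the step from \<open>z\<close>. Expanding the common slope \<open>\<theta>\<close> of the
  step and of its reverse around \<open>z\<close> and around \<open>z1\<close> gives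
  \<open>X z + t D z = X z1 - t D z1 + O(t\<^sup>2)\<close>. Dividing by \<open>t\<close> and letting \<open>t\<close> tend to \<open>0\<close> proves the
  claim.\<close>

lemma second_order_coefficient:
  assumes D: "smooth D" and \<Theta>2: "smooth \<Theta>2"
    and exp: "\<And>t z y. y = \<Gamma> (t, z, y) \<Longrightarrow> \<Theta> (t, z, y) = X z + t *\<^sub>R D z + t\<^sup>2 *\<^sub>R \<Theta>2 (t, z, y)"
    and z: "z \<in> C"
  shows "frechet_derivative X (at z) (X z) = 2 *\<^sub>R D z"
proof -
  obtain R \<delta> Y where \<delta>: "\<delta> > 0" and
    Y: "\<And>t z'. \<bar>t\<bar> < \<delta> \<Longrightarrow> norm z' < norm z + 1 \<Longrightarrow> norm (Y t z') \<le> R \<and> \<Gamma> (t, z', Y t z') = Y t z'" and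
    small: "\<And>t z'. \<bar>t\<bar> < \<delta> \<Longrightarrow> norm z' < norm z + 1 \<Longrightarrow> norm (t *\<^sub>R \<Theta> (t, z', Y t z')) < 1"
    by (rule local_flow[of "norm z + 1"]) blast
  define y where "y t = Y t z" for t
  define \<theta> where "\<theta> t = \<Theta> (t, z, y t)" for t
  define z1 where "z1 t = z + t *\<^sub>R \<theta> t" for t
  have y: "norm (y t) \<le> R" "\<Gamma> (t, z, y t) = y t" "norm (z1 t) \<le> norm z + 1" if "\<bar>t\<bar> < \<delta>" for t
    using Y[OF that, of z] small[OF that, of z] norm_triangle_ineq[of z "t *\<^sub>R \<theta> t"]
    by (auto simp: y_def \<theta>_def z1_def)
  define S where "S = {-1..1::real} \<times> cball (0::'n phase) (norm z + 1) \<times> cball (0::'n phase) R"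
  have S: "bounded S" unfolding S_def by (intro bounded_Times) auto
  obtain M where M: "M > 0" "\<And>x. x \<in> S \<Longrightarrow> norm (\<Theta>2 x) \<le> M"
    using smooth_bounded_on[OF \<Theta>2 S] by metis
  define b where "b t = \<Theta>2 (t, z, y t)" for t
  define b' where "b' t = \<Theta>2 (- t, z1 t, y t)" for t
  have small_t: "\<forall>\<^sub>F t in at_right 0. 0 < t \<and> t < min 1 \<delta>"
    using \<delta> eventually_at_right[of 0 "1::real"] by (intro eventually_at_rightI[of 0 "min 1 \<delta>"]) auto
  have bb: "\<forall>\<^sub>F t in at_right 0. norm (b t) \<le> M \<and> norm (b' t) \<le> M"
    using small_t
  proof eventually_elim
    case (elim t)
    then have "(t, z, y t) \<in> S" "(- t, z1 t, y t) \<in> S" using y[of t] by (auto simp: S_def)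
    then show ?case using M(2) by (simp add: b_def b'_def)
  qed
  have null: "((\<lambda>t. t *\<^sub>R \<beta> t) \<longlongrightarrow> 0) (at_right 0)"
    if "\<forall>\<^sub>F t in at_right 0. norm (\<beta> t) \<le> c" for \<beta> :: "real \<Rightarrow> 'n phase" and c
  proof (rule Lim_null_comparison)
    show "\<forall>\<^sub>F t in at_right 0. norm (t *\<^sub>R \<beta> t) \<le> \<bar>t\<bar> * c"
      using that by eventually_elim (simp add: mult_left_mono)
    have "((\<lambda>t. \<bar>t\<bar> * c) \<longlongrightarrow> \<bar>0\<bar> * c) (at_right 0)" by (intro tendsto_intros)
    then show "((\<lambda>t. \<bar>t\<bar> * c) \<longlongrightarrow> 0) (at_right 0)" by simp
  qed
  have id: "((\<lambda>t. t) \<longlongrightarrow> (0::real)) (at_right 0)" by (rule tendsto_ident_at)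
  have \<theta>_lim: "(\<theta> \<longlongrightarrow> X z) (at_right 0)"
  proof -
    have "((\<lambda>t. X z + t *\<^sub>R D z + t *\<^sub>R (t *\<^sub>R b t)) \<longlongrightarrow> X z + 0 *\<^sub>R D z + 0 *\<^sub>R 0) (at_right 0)"
      by (intro tendsto_intros null[of b M]) (use bb in \<open>auto elim: eventually_mono\<close>)
    moreover have "\<forall>\<^sub>F t in at_right 0. X z + t *\<^sub>R D z + t *\<^sub>R (t *\<^sub>R b t) = \<theta> t"
      using small_t by eventually_elim
        (use y(2) exp in \<open>simp add: \<theta>_def b_def power2_eq_square\<close>)
    ultimately show ?thesis using tendsto_cong by fastforce
  qed
  have z1_lim: "(z1 \<longlongrightarrow> z) (at_right 0)"
    unfolding z1_def[abs_def] using tendsto_add[OF tendsto_const tendsto_scaleR[OF id \<theta>_lim], of z] by simp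
  have contD: "isCont D z"
    using smooth_continuous_on[OF D, of UNIV] continuous_on_eq_continuous_at[OF open_UNIV] by blast
  have D_lim: "((\<lambda>t. D (z1 t)) \<longlongrightarrow> D z) (at_right 0)"
    by (rule isCont_tendsto_compose[OF contD z1_lim])
  have "isCont (divided_difference X) x" for x
    using smooth_continuous_on[OF smooth_divided_difference[OF smooth_X], of UNIV]
      continuous_on_eq_continuous_at[OF open_UNIV] by blast
  from isCont_tendsto_compose[OF this tendsto_Pair[OF id tendsto_Pair[OF tendsto_const \<theta>_lim]], of z]
  have lhs: "((\<lambda>t. divided_difference X (t, z, \<theta> t)) \<longlongrightarrow> frechet_derivative X (at z) (X z)) (at_right 0)"
    by (simp add: divided_difference_zero)
  have "((\<lambda>t. D z + D (z1 t) + t *\<^sub>R (b t - b' t)) \<longlongrightarrow> D z + D z + 0) (at_right 0)"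
  proof (intro tendsto_add tendsto_const D_lim null[of _ "2 * M"])
    show "\<forall>\<^sub>F t in at_right 0. norm (b t - b' t) \<le> 2 * M"
      using bb
    proof eventually_elim
      case (elim t)
      then show ?case using norm_triangle_ineq4[of "b t" "b' t"] by linarith
    qed
  qed
  moreover have "\<forall>\<^sub>F t in at_right 0. D z + D (z1 t) + t *\<^sub>R (b t - b' t) = divided_difference X (t, z, \<theta> t)"
    using small_t
  proof eventually_elim
    case (elim t)
    then have t: "\<bar>t\<bar> < \<delta>" "t \<noteq> 0" by auto
    note r = reversibility[OF z t(2) y(2)[OF t(1)], folded \<theta>_def z1_def]
    have "X (z1 t) - t *\<^sub>R D (z1 t) + t\<^sup>2 *\<^sub>R b' t = X z + t *\<^sub>R D z + t\<^sup>2 *\<^sub>R b t"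
      using exp[OF r(1)[symmetric]] exp[OF y(2)[OF t(1), symmetric]] r(2)
      by (simp add: b_def b'_def \<theta>_def)
    then have "t *\<^sub>R (D z + D (z1 t) + t *\<^sub>R (b t - b' t)) = X (z1 t) - X z"
      by (simp add: algebra_simps power2_eq_square)
    also have "\<dots> = t *\<^sub>R divided_difference X (t, z, \<theta> t)"
      unfolding z1_def by (subst divided_difference_eq[OF smooth_X]) simp
    finally show ?case using t(2) by simp
  qed
  ultimately have "((\<lambda>t. divided_difference X (t, z, \<theta> t)) \<longlongrightarrow> D z + D z + 0) (at_right 0)"
    by (rule Lim_transform_eventually)
  from tendsto_unique[OF _ lhs this] show ?thesis by (simp add: scaleR_2)
qed

text \<open>The error estimate of the induction also keeps the numerical solution within distance \<open>1\<close> of the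
  exact one, and so inside the ball on which stability and consistency hold uniformly.\<close>

theorem integrator_second_order:
  assumes "integrator \<Phi>" and T: "T > 0"
    and z: "\<And>t. t \<in> {0..T} \<Longrightarrow> (z has_vector_derivative X (z t)) (at t within {0..T})"
    and zC: "\<And>t. t \<in> {0..T} \<Longrightarrow> z t \<in> C"
  shows "\<exists>Bd. \<exists>\<delta>>0. \<forall>t\<in>{0<..<\<delta>}. \<forall>j::nat. real j * t \<le> T \<longrightarrow>
    (\<Phi> t ^^ j) (z 0) \<in> C \<and> dist ((\<Phi> t ^^ j) (z 0)) (z (real j * t)) \<le> Bd * t ^ 2"
proof -
  have "continuous_on {0..T} z"
    using z has_vector_derivative_continuous continuous_on_eq_continuous_within by blast
  then have "compact (z ` {0..T})" by (intro compact_continuous_image) auto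
  then obtain \<rho>0 where "\<And>x. x \<in> z ` {0..T} \<Longrightarrow> norm x < \<rho>0" using compact_subset_ball by metis
  then have \<rho>0: "\<And>t. t \<in> {0..T} \<Longrightarrow> norm (z t) < \<rho>0" by blast
  define \<rho> where "\<rho> = \<rho>0 + 1"
  obtain R \<delta>1 L Y where \<delta>1: "\<delta>1 > 0" and L: "L > 0" and
    Y: "\<And>t z. \<bar>t\<bar> < \<delta>1 \<Longrightarrow> norm z < \<rho> \<Longrightarrow> norm (Y t z) \<le> R \<and> \<Gamma> (t, z, Y t z) = Y t z" and
    Y_lip: "\<And>t z z'. \<bar>t\<bar> < \<delta>1 \<Longrightarrow> norm z < \<rho> \<Longrightarrow> norm z' < \<rho> \<Longrightarrow> norm (Y t z - Y t z') \<le> L * norm (z - z')" and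
    \<Phi>: "\<And>t z. t \<in> {0<..<\<delta>1} \<Longrightarrow> norm z < \<rho> \<Longrightarrow> z \<in> C \<Longrightarrow> \<Phi> t z = z + t *\<^sub>R \<Theta> (t, z, Y t z)"
    by (rule integrator_flow[OF assms(1), of \<rho>]) blast
  obtain D \<Theta>2 where D: "smooth D" and \<Theta>2: "smooth \<Theta>2" and
    exp: "\<And>t z y. y = \<Gamma> (t, z, y) \<Longrightarrow> \<Theta> (t, z, y) = X z + t *\<^sub>R D z + t\<^sup>2 *\<^sub>R \<Theta>2 (t, z, y)"
    by (rule expansion[OF smooth_\<Theta>, folded X_def]) blast
  define S where "S = {-1..1::real} \<times> ball (0::'n phase) \<rho> \<times> cball (0::'n phase) R"
  have S: "bounded S" unfolding S_def by (intro bounded_Times) auto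
  have mem: "(t, x, Y t x) \<in> S" if "0 < t" "t < min 1 \<delta>1" "norm x < \<rho>" for t x
    using that Y[of t x] by (auto simp: S_def)
  obtain L' where L': "L' > 0" "\<And>x y. x \<in> S \<Longrightarrow> y \<in> S \<Longrightarrow> norm (\<Theta> x - \<Theta> y) \<le> L' * norm (x - y)"
    using smooth_lipschitz_on_bounded[OF smooth_\<Theta> S] by metis
  obtain M2 where M2: "M2 > 0" "\<And>x. x \<in> S \<Longrightarrow> norm (\<Theta>2 x) \<le> M2"
    using smooth_bounded_on[OF \<Theta>2 S] by metis
  obtain M where M: "M > 0" "\<And>s t. 0 \<le> s \<Longrightarrow> 0 \<le> t \<Longrightarrow> s + t \<le> T \<Longrightarrow>
    norm (z (s + t) - (z s + t *\<^sub>R X (z s) + (t\<^sup>2 / 2) *\<^sub>R frechet_derivative X (at (z s)) (X (z s)))) \<le> M * t ^ 3"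
    using autonomous_ode_taylor[OF smooth_X z] by metis
  \<comment> \<open>\<open>\<Lambda>\<close> is a Lipschitz constant of the slope, with \<open>y\<close> depending on \<open>z\<close>; \<open>c t\<^sup>3\<close> bounds the local error.\<close>
  define \<Lambda> where "\<Lambda> = L' * (1 + L)"
  define c where "c = M + M2"
  have pos: "\<Lambda> > 0" "c > 0" using L L' M M2 by (auto simp: \<Lambda>_def c_def)
  have stable: "norm (\<Phi> t x - \<Phi> t x') \<le> (1 + \<Lambda> * t) * norm (x - x')"
    if t: "0 < t" "t < min 1 \<delta>1" and x: "x \<in> C" "norm x < \<rho>" "x' \<in> C" "norm x' < \<rho>" for t x x'
  proof -
    have "norm ((t, x, Y t x) - (t, x', Y t x')) \<le> norm (x - x') + norm (Y t x - Y t x')"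
      using norm_Pair_le[of "x - x'" "Y t x - Y t x'"] by (simp add: norm_Pair[of 0])
    also have "\<dots> \<le> (1 + L) * norm (x - x')"
      using Y_lip[of t x x'] t x by (simp add: algebra_simps)
    finally have "L' * norm ((t, x, Y t x) - (t, x', Y t x')) \<le> \<Lambda> * norm (x - x')"
      using L' by (simp add: \<Lambda>_def mult.assoc)
    then have "norm (\<Theta> (t, x, Y t x) - \<Theta> (t, x', Y t x')) \<le> \<Lambda> * norm (x - x')"
      using L'(2)[OF mem[OF t x(2)] mem[OF t x(4)]] by linarith
    then have n: "norm (t *\<^sub>R (\<Theta> (t, x, Y t x) - \<Theta> (t, x', Y t x'))) \<le> t * (\<Lambda> * norm (x - x'))"
      using t by (simp add: mult_left_mono)
    have eq: "\<Phi> t x - \<Phi> t x' = (x - x') + t *\<^sub>R (\<Theta> (t, x, Y t x) - \<Theta> (t, x', Y t x'))"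
      using \<Phi>[of t x] \<Phi>[of t x'] t x by (simp add: algebra_simps)
    have "(1 + \<Lambda> * t) * norm (x - x') = norm (x - x') + t * (\<Lambda> * norm (x - x'))"
      by (simp add: algebra_simps)
    then show ?thesis
      unfolding eq using n norm_triangle_ineq[of "x - x'" "t *\<^sub>R (\<Theta> (t, x, Y t x) - \<Theta> (t, x', Y t x'))"]
      by linarith
  qed
  have local: "norm (\<Phi> t (z s) - z (s + t)) \<le> c * t ^ 3"
    if t: "0 < t" "t < min 1 \<delta>1" and s: "0 \<le> s" "s + t \<le> T" for s t
  proof -
    have sT: "s \<in> {0..T}" using s t by auto
    have zs: "norm (z s) < \<rho>" "z s \<in> C" using \<rho>0[OF sT] zC[OF sT] by (auto simp: \<rho>_def)
    let ?y = "Y t (z s)" and ?d = "frechet_derivative X (at (z s)) (X (z s))"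
    have "\<Theta> (t, z s, ?y) = X (z s) + t *\<^sub>R D (z s) + t\<^sup>2 *\<^sub>R \<Theta>2 (t, z s, ?y)"
      using exp[of ?y t "z s"] Y[of t "z s"] t zs by simp
    then have "\<Phi> t (z s) = z s + t *\<^sub>R X (z s) + t\<^sup>2 *\<^sub>R D (z s) + t ^ 3 *\<^sub>R \<Theta>2 (t, z s, ?y)"
      using \<Phi>[of t "z s"] t zs by (simp add: scaleR_add_right power2_eq_square power3_eq_cube)
    moreover have "t\<^sup>2 *\<^sub>R D (z s) = (t\<^sup>2 / 2) *\<^sub>R ?d"
      using second_order_coefficient[OF D \<Theta>2 exp zs(2)] by simp
    ultimately have "\<Phi> t (z s) - z (s + t) = t ^ 3 *\<^sub>R \<Theta>2 (t, z s, ?y) -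
        (z (s + t) - (z s + t *\<^sub>R X (z s) + (t\<^sup>2 / 2) *\<^sub>R ?d))"
      by simp
    then have "norm (\<Phi> t (z s) - z (s + t)) \<le> norm (t ^ 3 *\<^sub>R \<Theta>2 (t, z s, ?y)) +
        norm (z (s + t) - (z s + t *\<^sub>R X (z s) + (t\<^sup>2 / 2) *\<^sub>R ?d))"
      by (simp only: norm_triangle_ineq4)
    also have "\<dots> \<le> M2 * t ^ 3 + M * t ^ 3"
      using M(2)[of s t] M2(2)[OF mem[OF t zs(1)]] s t by (intro add_mono) (auto simp: mult_left_mono mult.commute)
    finally show ?thesis by (simp add: c_def algebra_simps)
  qed
  define Bd where "Bd = T * c * exp (\<Lambda> * T)"
  have Bd: "Bd > 0" using T pos by (simp add: Bd_def)
  \<comment> \<open>\<open>t < 1 / Bd\<close> and \<open>t < 1\<close> ensure that the error bound \<open>Bd t\<^sup>2\<close> stays below \<open>1\<close>.\<close>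
  define \<delta> where "\<delta> = min (min 1 \<delta>1) (1 / Bd)"
  have "(\<Phi> t ^^ j) (z 0) \<in> C \<and> norm ((\<Phi> t ^^ j) (z 0) - z (real j * t)) \<le> Bd * t\<^sup>2"
    if t: "t \<in> {0<..<\<delta>}" and j: "real j * t \<le> T" for t j
  proof -
    have t': "0 < t" "t < min 1 \<delta>1" "t < 1 / Bd" using t by (auto simp: \<delta>_def)
    have bound: "real i * (c * t ^ 3) * exp ((\<Lambda> * t) * real i) \<le> Bd * t\<^sup>2" if "real i * t \<le> T" for i
    proof -
      have "real i * (c * t ^ 3) * exp ((\<Lambda> * t) * real i) = (real i * t) * (c * t\<^sup>2) * exp (\<Lambda> * (real i * t))"
        by (simp add: power2_eq_square power3_eq_cube mult_ac)
      also have "\<dots> \<le> T * (c * t\<^sup>2) * exp (\<Lambda> * T)"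
        using that t' pos T by (intro mult_mono) auto
      finally show ?thesis by (simp add: Bd_def mult_ac)
    qed
    have "real i * t \<le> T \<Longrightarrow> (\<Phi> t ^^ i) (z 0) \<in> C \<and>
        norm ((\<Phi> t ^^ i) (z 0) - z (real i * t)) \<le> real i * (c * t ^ 3) * exp ((\<Lambda> * t) * real i)" for i
    proof (induction i)
      case 0
      then show ?case using zC[of 0] T by simp
    next
      case (Suc i)
      let ?x = "(\<Phi> t ^^ i) (z 0)"
      have iT: "real i * t \<le> T" "real i * t + t \<le> T" using Suc.prems t' by (auto simp: algebra_simps)
      have xC: "?x \<in> C" and err: "norm (?x - z (real i * t)) \<le> real i * (c * t ^ 3) * exp ((\<Lambda> * t) * real i)"
        using Suc.IH[OF iT(1)] by auto
      have tT: "real i * t \<in> {0..T}" using iT t' by auto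
      have "norm (?x - z (real i * t)) \<le> Bd * t\<^sup>2" using err bound[OF iT(1)] by linarith
      also have "\<dots> \<le> Bd * t" using t' Bd by (simp add: power2_eq_square mult_left_le_one_le)
      also have "\<dots> < 1" using t'(3) Bd by (simp add: pos_less_divide_eq mult.commute)
      finally have "norm ?x < \<rho>"
        using \<rho>0[OF tT] norm_triangle_ineq2[of ?x "z (real i * t)"] by (simp add: \<rho>_def)
      then have x: "norm ?x < \<rho>" .
      have zi: "norm (z (real i * t)) < \<rho>" "z (real i * t) \<in> C" using \<rho>0[OF tT] zC[OF tT] by (auto simp: \<rho>_def)
      have "\<Phi> t ?x \<in> C"
        using \<Phi>[OF _ x xC] fixed_point_imp_in_C[OF xC] Y[OF _ x] t' by simp
      moreover have "norm (\<Phi> t ?x - z (real (Suc i) * t)) \<le>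
          (1 + \<Lambda> * t) * norm (?x - z (real i * t)) + c * t ^ 3"
      proof -
        have "norm (\<Phi> t ?x - z (real i * t + t)) \<le> norm (\<Phi> t ?x - \<Phi> t (z (real i * t))) +
            norm (\<Phi> t (z (real i * t)) - z (real i * t + t))"
          using norm_triangle_ineq[of "\<Phi> t ?x - \<Phi> t (z (real i * t))" "\<Phi> t (z (real i * t)) - z (real i * t + t)"]
          by simp
        also have "\<dots> \<le> (1 + \<Lambda> * t) * norm (?x - z (real i * t)) + c * t ^ 3"
          using tT iT(2) by (intro add_mono stable local t' xC x zi) auto
        finally show ?thesis by (simp add: algebra_simps)
      qed
      ultimately show ?case
        using one_step_error_propagation[of "\<Lambda> * t" "c * t ^ 3"
            "\<lambda>i. norm ((\<Phi> t ^^ i) (z 0) - z (real i * t))" i] err t' pos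
        by simp
    qed
    from this[OF j] bound[OF j] show ?thesis by auto
  qed
  moreover have "\<delta> > 0" using \<delta>1 Bd by (simp add: \<delta>_def)
  ultimately show ?thesis unfolding dist_norm by blast
qed

end


section \<open>Elimination of the velocity multipliers\<close>

lemma grad_eqI:
  fixes f :: "real^'m \<Rightarrow> real"
  assumes "(f has_derivative (\<lambda>u. c \<bullet> u)) (at x)"
  shows "grad f x = c"
  using frechet_derivative_at[OF assms, symmetric] by (simp add: grad_def vec_eq_iff inner_axis)

lemma quadratic_form_has_derivative:
  fixes N :: "real^'n^'n"
  assumes sym: "\<And>x y. (N *v x) \<bullet> y = x \<bullet> (N *v y)" and e: "(e has_derivative e') (at x within S)"
  shows "((\<lambda>x. 1 / 2 * (e x \<bullet> (N *v e x))) has_derivative (\<lambda>u. (N *v e x) \<bullet> e' u)) (at x within S)"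
proof -
  have "((\<lambda>x. 1 / 2 * (e x \<bullet> (N *v e x))) has_derivative
      (\<lambda>u. 1 / 2 * (e x \<bullet> (N *v e' u) + e' u \<bullet> (N *v e x)))) (at x within S)"
    by (intro has_derivative_mult_right has_derivative_inner e
        bounded_linear.has_derivative[OF matrix_vector_mul_bounded_linear])
  moreover have eq: "1 / 2 * (e x \<bullet> (N *v e' u) + e' u \<bullet> (N *v e x)) = (N *v e x) \<bullet> e' u" for u
    using sym[of "e x" "e' u"] by (simp add: inner_commute)
  ultimately show ?thesis unfolding eq by blast
qed

text \<open>The elimination works with the quadratic form \<open>N = M\<^sup>-\<^sup>1\<close> and the matrix \<open>G q\<close> with columns
  \<open>g i q\<close>.\<close>

locale constrained_mechanical_system =
  fixes M :: "real^'n^'n"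
    and V :: "real^'n \<Rightarrow> real"
    and g :: "'k::finite \<Rightarrow> real^'n \<Rightarrow> real^'n"
    and h :: "real^'n \<Rightarrow> real^'l"
    and H :: "('n, 'k, 'l) hamiltonian"
  assumes M_symmetric: "transpose M = M"
    and M_nonsingular: "invertible M"
    and V_smooth: "smooth V"
    and g_smooth: "\<And>i. smooth (g i)"
    and h_smooth: "smooth h"
    and H: "H = (\<lambda>q p lam lamh.
        1 / 2 * ((p + (\<Sum>i\<in>UNIV. lam $ i *\<^sub>R g i q)) \<bullet>
          (matrix_inv M *v (p + (\<Sum>i\<in>UNIV. lam $ i *\<^sub>R g i q))))
        + V q + (\<Sum>i\<in>UNIV. lamh $ i * h q $ i))"
    and lam_unique: "\<And>q p. \<exists>!lam. D_lam H q p lam 0 = 0"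
    and nondegenerate: "\<And>q p. (q, p) \<in> constraint_manifold H h \<Longrightarrow>
        invertible (jacobian h (at q) ** H_tilde_pp H q p ** transpose (jacobian h (at q)))"
begin

definition N :: "real^'n^'n" where "N = matrix_inv M"

definition G :: "real^'n \<Rightarrow> real^'k^'n" where "G q = (\<chi> a i. g i q $ a)"

lemma smooth_G: "smooth G"
  unfolding G_def by (intro smooth_vec) (simp add: smooth_vec_nth g_smooth)

lemma G_mult: "G q *v lam = (\<Sum>i\<in>UNIV. lam $ i *\<^sub>R g i q)"
  by (simp add: vec_eq_iff G_def matrix_vector_mult_def mult.commute)

lemma N_symmetric: "(N *v x) \<bullet> y = x \<bullet> (N *v y)"
proof -
  have M: "M *v (N *v v) = v" for v
    by (simp add: N_def matrix_vector_mul_assoc matrix_inv_works[OF M_nonsingular])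
  have "(N *v x) \<bullet> y = (N *v x) \<bullet> (M *v (N *v y))" by (simp add: M)
  also have "\<dots> = (transpose M *v (N *v x)) \<bullet> (N *v y)" by (simp add: dot_lmul_matrix)
  also have "\<dots> = x \<bullet> (N *v y)" unfolding M_symmetric by (simp add: M)
  finally show ?thesis .
qed

lemma H_eq: "H q p lam lamh =
    1 / 2 * ((p + G q *v lam) \<bullet> (N *v (p + G q *v lam))) + V q + lamh \<bullet> h q"
  by (simp add: H N_def G_mult inner_vec_def)

lemma transpose_inner: "(transpose X *v a) \<bullet> b = a \<bullet> (X *v b)" for X :: "real^'b^'a"
  by (simp add: dot_lmul_matrix)

lemma D_p_eq: "D_p H q p lam lamh = N *v (p + G q *v lam)"
  unfolding D_p_def
proof (rule grad_eqI)
  have "((\<lambda>x. x + G q *v lam) has_derivative (\<lambda>u. u)) (at p)"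
    by (auto intro!: derivative_eq_intros)
  from quadratic_form_has_derivative[OF N_symmetric this]
  have "((\<lambda>x. 1 / 2 * ((x + G q *v lam) \<bullet> (N *v (x + G q *v lam))) + V q + lamh \<bullet> h q) has_derivative
      (\<lambda>u. (N *v (p + G q *v lam)) \<bullet> u + 0 + 0)) (at p)"
    by (intro has_derivative_add has_derivative_const)
  then show "((\<lambda>x. H q x lam lamh) has_derivative (\<lambda>u. (N *v (p + G q *v lam)) \<bullet> u)) (at p)"
    by (simp add: H_eq)
qed

lemma D_lam_eq: "D_lam H q p lam lamh = transpose (G q) *v (N *v (p + G q *v lam))"
  unfolding D_lam_def
proof (rule grad_eqI)
  have "((\<lambda>x. p + G q *v x) has_derivative (\<lambda>u. 0 + G q *v u)) (at lam)"
    by (intro has_derivative_add has_derivative_const bounded_linear.has_derivative[OF matrix_vector_mul_bounded_linear]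
        has_derivative_ident)
  from quadratic_form_has_derivative[OF N_symmetric this]
  have "((\<lambda>x. 1 / 2 * ((p + G q *v x) \<bullet> (N *v (p + G q *v x))) + V q + lamh \<bullet> h q) has_derivative
      (\<lambda>u. (N *v (p + G q *v lam)) \<bullet> (0 + G q *v u) + 0 + 0)) (at lam)"
    by (intro has_derivative_add has_derivative_const)
  then show "((\<lambda>x. H q p x lamh) has_derivative
      (\<lambda>u. (transpose (G q) *v (N *v (p + G q *v lam))) \<bullet> u)) (at lam)"
    by (simp add: H_eq transpose_inner del: transpose_matrix_vector)
qed

lemma D_lamh_eq: "D_lamh H q p lam lamh = h q"
  unfolding D_lamh_def
proof (rule grad_eqI)
  have "((\<lambda>x. 1 / 2 * ((p + G q *v lam) \<bullet> (N *v (p + G q *v lam))) + V q + x \<bullet> h q) has_derivative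
      (\<lambda>u. 0 + 0 + u \<bullet> h q)) (at lamh)"
    by (intro has_derivative_add has_derivative_const has_derivative_inner_left has_derivative_ident)
  then show "((\<lambda>x. H q p lam x) has_derivative (\<lambda>u. h q \<bullet> u)) (at lamh)"
    by (simp add: H_eq inner_commute)
qed

definition S :: "real^'n \<Rightarrow> real^'k^'k" where "S q = transpose (G q) ** N ** G q"

text \<open>At \<open>p = 0\<close> the equation \<open>H\<^sub>\<lambda> = 0\<close> is the homogeneous equation \<open>S q *v lam = 0\<close>.\<close>

lemma S_invertible: "invertible (S q)"
proof -
  have "lam = 0" if "S q *v lam = 0" for lam
  proof -
    have "D_lam H q 0 lam 0 = 0" "D_lam H q 0 0 0 = 0"
      using that by (simp_all add: D_lam_eq S_def matrix_vector_mul_assoc matrix_mul_assoc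
          del: transpose_matrix_vector)
    then show ?thesis using lam_unique[of q 0] by blast
  qed
  then show ?thesis
    using matrix_left_invertible_ker[of "S q"] invertible_left_inverse by blast
qed

definition lam_sol :: "real^'n \<Rightarrow> real^'n \<Rightarrow> real^'k" where
  "lam_sol q p = - (matrix_inv (S q) *v (transpose (G q) *v (N *v p)))"

lemma lam_sol_solves: "transpose (G q) *v (N *v (p + G q *v lam_sol q p)) = 0"
proof -
  have "transpose (G q) *v (N *v (p + G q *v lam_sol q p)) = transpose (G q) *v (N *v p) + S q *v lam_sol q p"
    by (simp add: matrix_vector_algebra S_def matrix_vector_mul_assoc matrix_mul_assoc
        del: transpose_matrix_vector)
  also have "S q *v lam_sol q p = - (transpose (G q) *v (N *v p))"
  proof -
    have "S q *v (matrix_inv (S q) *v y) = y" for y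
      by (simp add: matrix_vector_mul_assoc matrix_inv_works[OF S_invertible])
    then show ?thesis by (simp only: lam_sol_def matrix_vector_algebra)
  qed
  finally show ?thesis by simp
qed

lemma D_lam_zero_iff: "D_lam H q p lam lamh = 0 \<longleftrightarrow> lam = lam_sol q p"
proof -
  have "D_lam H q p (lam_sol q p) 0 = 0" by (simp only: D_lam_eq lam_sol_solves)
  moreover have "D_lam H q p lam lamh = D_lam H q p lam 0" by (simp add: D_lam_eq)
  ultimately show ?thesis using lam_unique[of q p] by metis
qed

lemma lam_tilde_eq: "lam_tilde H q p = lam_sol q p"
  unfolding lam_tilde_def by (simp add: D_lam_zero_iff)

definition A :: "real^'n \<Rightarrow> real^'n^'n" where
  "A q = N - N ** G q ** matrix_inv (S q) ** transpose (G q) ** N"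

lemma A_mult: "A q *v p = N *v (p + G q *v lam_sol q p)"
  by (simp add: A_def lam_sol_def matrix_vector_algebra matrix_vector_mul_assoc matrix_mul_assoc
      del: transpose_matrix_vector)

lemma D_p_lam_sol: "D_p H q p (lam_sol q p) lamh = A q *v p"
  by (simp only: D_p_eq A_mult)

lemma smooth_S: "smooth S"
  unfolding S_def by (intro smooth_matrix_matrix_mult smooth_transpose smooth_G smooth_const)

lemma smooth_S_inv: "smooth (\<lambda>q. matrix_inv (S q))"
  by (rule smooth_matrix_inv[OF smooth_S S_invertible])

lemma smooth_A: "smooth A"
  unfolding A_def
  by (intro smooth_diff smooth_matrix_matrix_mult smooth_transpose smooth_G smooth_const smooth_S_inv)

lemma A_ortho: "(G q *v lam) \<bullet> (A q *v p) = 0"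
  using lam_sol_solves[of q p] transpose_inner[of "G q" "A q *v p" lam]
  by (simp add: A_mult inner_commute del: transpose_matrix_vector)

lemma A_symmetric: "(A q *v x) \<bullet> y = x \<bullet> (A q *v y)"
proof -
  have *: "a \<bullet> (A q *v b) = (a + G q *v lam_sol q a) \<bullet> (N *v (b + G q *v lam_sol q b))" for a b
    using A_ortho[of q "lam_sol q a" b] by (simp add: inner_add_left A_mult[symmetric])
  show ?thesis
    using *[of x y] *[of y x] N_symmetric[of "x + G q *v lam_sol q x" "y + G q *v lam_sol q y"]
    by (simp add: inner_commute)
qed

definition Hr :: "'n phase \<Rightarrow> real" where
  "Hr z = 1 / 2 * (snd z \<bullet> (A (fst z) *v snd z)) + V (fst z)"

lemma smooth_Hr: "smooth Hr"
  unfolding Hr_def[abs_def]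
  by (intro smooth_add smooth_mult smooth_inner smooth_matrix_vector_mult smooth_const
      smooth_compose[OF smooth_A] smooth_compose[OF V_smooth] smooth_fst smooth_snd smooth_ident)

text \<open>As a function of \<open>lam\<close>, \<open>H\<close> is quadratic with critical point \<open>lam_sol q p\<close>. The square vanishes to
  second order there, which is why the gradient of \<open>H\<close> at the solved multiplier is that of \<open>Hr\<close>.\<close>

lemma H_complete_square: "H q p lam lamh = Hr (q, p)
    + 1 / 2 * ((G q *v (lam - lam_sol q p)) \<bullet> (N *v (G q *v (lam - lam_sol q p)))) + lamh \<bullet> h q"
proof -
  let ?e = "G q *v (lam - lam_sol q p)" and ?x = "p + G q *v lam_sol q p"
  have 1: "p + G q *v lam = ?x + ?e" by (simp add: matrix_vector_algebra)
  have 2: "(?x + ?e) \<bullet> (N *v (?x + ?e)) = ?x \<bullet> (N *v ?x) + 2 * (?e \<bullet> (N *v ?x)) + ?e \<bullet> (N *v ?e)"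
    using N_symmetric[of ?x ?e]
    by (simp only: bounded_bilinear.add_right[OF bounded_bilinear_matrix_vector_mult]
        inner_add_left inner_add_right) (simp add: inner_commute)
  have 3: "?x \<bullet> (N *v ?x) = p \<bullet> (A q *v p)" "?e \<bullet> (N *v ?x) = 0"
    using A_ortho[of q] by (simp_all only: A_mult[symmetric] inner_add_left add_0_right)
  show ?thesis
    unfolding H_eq 1 2 3 Hr_def by simp
qed

lemma H_tilde_eq: "H_tilde H q p = Hr (q, p)"
  by (simp add: H_tilde_def lam_tilde_eq H_complete_square)

lemma Hr_p_derivative: "((\<lambda>x. Hr (q, x)) has_derivative (\<lambda>u. (A q *v p) \<bullet> u)) (at p)"
proof -
  have "((\<lambda>x. 1 / 2 * (x \<bullet> (A q *v x)) + V q) has_derivative (\<lambda>u. (A q *v p) \<bullet> u + 0)) (at p)"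
    by (intro has_derivative_add has_derivative_const
        quadratic_form_has_derivative[OF A_symmetric] has_derivative_ident)
  then show ?thesis by (simp add: Hr_def)
qed

lemma H_tilde_p_eq: "H_tilde_p H q p = A q *v p"
  unfolding H_tilde_p_def H_tilde_eq by (rule grad_eqI[OF Hr_p_derivative])

lemma H_tilde_pp_eq: "H_tilde_pp H q p = A q"
proof -
  have "frechet_derivative (\<lambda>x. A q *v x) (at p) = (\<lambda>x. A q *v x)"
    by (rule frechet_derivative_at[symmetric]) (rule bounded_linear_imp_has_derivative[OF matrix_vector_mul_bounded_linear])
  then show ?thesis by (simp add: H_tilde_pp_def H_tilde_p_eq jacobian_def matrix_of_matrix_vector_mul)
qed

definition f :: "'n phase \<Rightarrow> real^'n" where
  "f z = (\<chi> i. frechet_derivative Hr (at z) (axis i 1, 0))"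

lemma smooth_f: "smooth f"
  unfolding f_def[abs_def] by (intro smooth_vec) (simp add: smooth_directional smooth_Hr)

lemma Hr_derivative: "frechet_derivative Hr (at (q, p)) (u, w) = f (q, p) \<bullet> u + (A q *v p) \<bullet> w"
proof -
  let ?D = "frechet_derivative Hr (at (q, p))"
  have D: "(Hr has_derivative ?D) (at (q, p))" by (rule smooth_has_derivative[OF smooth_Hr])
  have lin: "linear ?D" by (rule has_derivative_linear[OF D])
  have "?D (u, 0) = ?D (\<Sum>i\<in>UNIV. (u $ i) *\<^sub>R (axis i 1, 0))"
  proof -
    have "(u, 0) = (\<Sum>i\<in>UNIV. (u $ i) *\<^sub>R (axis i 1 :: real^'n, 0 :: real^'n))"
      using basis_expansion[of u] by (simp add: prod_eq_iff fst_sum snd_sum scalar_mult_eq_scaleR)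
    then show ?thesis by simp
  qed
  also have "\<dots> = f (q, p) \<bullet> u"
    by (simp only: linear_sum[OF lin] linear_scale[OF lin]) (simp add: f_def inner_vec_def mult.commute)
  finally have u: "?D (u, 0) = f (q, p) \<bullet> u" .
  have "((\<lambda>x. Hr (q, x)) has_derivative (\<lambda>w. ?D (0, w))) (at p)"
    using has_derivative_compose[OF has_derivative_Pair[OF has_derivative_const has_derivative_ident] D] by simp
  from fun_cong[OF has_derivative_unique[OF this Hr_p_derivative], of w]
  have w: "?D (0, w) = (A q *v p) \<bullet> w" .
  have "?D (u, w) = ?D ((u, 0) + (0, w))" by simp
  also have "\<dots> = ?D (u, 0) + ?D (0, w)" by (rule linear_add[OF lin])
  finally show ?thesis by (simp add: u w)
qed

lemma D_q_eq: "D_q H q p (lam_sol q p) lamh = f (q, p) + transpose (jacobian h (at q)) *v lamh"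
  unfolding D_q_def
proof (rule grad_eqI)
  let ?e = "\<lambda>x. G x *v (lam_sol q p - lam_sol x p)"
  have sm: "smooth ?e"
    unfolding lam_sol_def
    by (intro smooth_matrix_vector_mult smooth_diff smooth_minus smooth_transpose smooth_G smooth_S_inv smooth_const)
  have "?e q = 0" by (simp add: matrix_vector_algebra)
  then have "(N *v ?e q) \<bullet> w = 0" for w by (simp only: matrix_vector_algebra inner_zero_left)
  then have e: "((\<lambda>x. 1 / 2 * (?e x \<bullet> (N *v ?e x))) has_derivative (\<lambda>u. 0)) (at q)"
    using quadratic_form_has_derivative[OF N_symmetric smooth_has_derivative[OF sm, of q]] by (simp only:)
  have Hq: "((\<lambda>x. Hr (x, p)) has_derivative (\<lambda>u. f (q, p) \<bullet> u)) (at q)"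
    using has_derivative_compose[OF has_derivative_Pair[OF has_derivative_ident has_derivative_const]
        smooth_has_derivative[OF smooth_Hr]] by (simp add: Hr_derivative)
  have "((\<lambda>x. Hr (x, p) + 1 / 2 * (?e x \<bullet> (N *v ?e x)) + lamh \<bullet> h x) has_derivative
      (\<lambda>u. f (q, p) \<bullet> u + 0 + lamh \<bullet> frechet_derivative h (at q) u)) (at q)"
    by (intro has_derivative_add Hq e has_derivative_inner_right smooth_has_derivative h_smooth)
  moreover have "f (q, p) \<bullet> u + 0 + lamh \<bullet> frechet_derivative h (at q) u =
      (f (q, p) + transpose (jacobian h (at q)) *v lamh) \<bullet> u" for u
    by (simp add: inner_add_left transpose_inner jacobian_mult_eq_derivative[OF h_smooth]
        del: transpose_matrix_vector)
  ultimately show "((\<lambda>x. H x p (lam_sol q p) lamh) has_derivative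
      (\<lambda>u. (f (q, p) + transpose (jacobian h (at q)) *v lamh) \<bullet> u)) (at q)"
    by (simp add: H_complete_square)
qed

definition W :: "real^'n \<Rightarrow> real^'l^'l" where
  "W q = jacobian h (at q) ** A q ** transpose (jacobian h (at q))"

text \<open>The momentum \<open>p = 0\<close> satisfies the secondary constraint at every \<open>q\<close>, so that the nondegeneracy
  assumption applies to all \<open>q\<close> with \<open>h q = 0\<close>.\<close>

lemma W_invertible: "h q = 0 \<Longrightarrow> invertible (W q)"
  using nondegenerate[of q 0] by (simp add: constraint_manifold_def H_tilde_p_eq H_tilde_pp_eq W_def)

text \<open>Positive definite everywhere: the first summand where \<open>h q = 0\<close>, and the second one elsewhere. This
  gives the globally smooth \<open>E\<close> that inverts \<open>W\<close> on the constraint set.\<close>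

definition P :: "real^'n \<Rightarrow> real^'l^'l" where
  "P q = transpose (W q) ** W q + (h q \<bullet> h q) *\<^sub>R mat 1"

lemma P_invertible: "invertible (P q)"
proof -
  have "x = 0" if "P q *v x = 0" for x
  proof -
    have "P q *v x = transpose (W q) *v (W q *v x) + (h q \<bullet> h q) *\<^sub>R x"
      by (simp add: P_def matrix_vector_algebra matrix_vector_mul_assoc del: transpose_matrix_vector)
    then have "(P q *v x) \<bullet> x = (W q *v x) \<bullet> (W q *v x) + (h q \<bullet> h q) * (x \<bullet> x)"
      by (simp only: inner_add_left transpose_inner inner_scaleR_left)
    then have sum: "(W q *v x) \<bullet> (W q *v x) + (h q \<bullet> h q) * (x \<bullet> x) = 0" using that by simp
    have nonneg: "(W q *v x) \<bullet> (W q *v x) \<ge> 0" "(h q \<bullet> h q) * (x \<bullet> x) \<ge> 0" by auto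
    have 1: "W q *v x = 0" using sum nonneg by (metis add_nonneg_eq_0_iff inner_eq_zero_iff)
    have 2: "h q = 0 \<or> x = 0" using sum nonneg by (metis add_nonneg_eq_0_iff inner_eq_zero_iff mult_eq_0_iff)
    show "x = 0"
    proof (cases "h q = 0")
      case True
      then have "matrix_inv (W q) *v (W q *v x) = x"
        by (simp add: matrix_vector_mul_assoc matrix_inv_works[OF W_invertible])
      then show ?thesis using 1 by (simp add: matrix_vector_algebra)
    qed (use 2 in blast)
  qed
  then show ?thesis
    using matrix_left_invertible_ker[of "P q"] invertible_left_inverse by blast
qed

definition E :: "real^'n \<Rightarrow> real^'l^'l" where
  "E q = matrix_inv (P q) ** transpose (W q)"

lemma smooth_E: "smooth E"
proof -
  have W: "smooth W"
    unfolding W_def[abs_def]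
    by (intro smooth_matrix_matrix_mult smooth_transpose smooth_jacobian h_smooth smooth_A)
  then have "smooth P"
    unfolding P_def[abs_def]
    by (intro smooth_add smooth_matrix_matrix_mult smooth_transpose smooth_scaleR smooth_inner h_smooth smooth_const)
  then show ?thesis
    unfolding E_def[abs_def]
    by (intro smooth_matrix_matrix_mult smooth_transpose W smooth_matrix_inv P_invertible)
qed

lemma E_inverse: "h q = 0 \<Longrightarrow> E q ** W q = mat 1"
  using matrix_inv_works(2)[OF P_invertible[of q]]
  by (simp add: E_def P_def matrix_mul_assoc[symmetric])

sublocale reduced_system Hr f A h E
  by unfold_locales
    (use smooth_Hr smooth_f smooth_A h_smooth smooth_E Hr_derivative E_inverse in \<open>auto simp: W_def\<close>)

lemma constraint_manifold_eq: "constraint_manifold H h = C"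
  by (simp add: constraint_manifold_def C_def H_tilde_p_eq BA_def matrix_vector_mul_assoc)

lemma midpoint_step_eq: "midpoint_step H = reduced_midpoint_step"
  unfolding midpoint_step_def reduced_midpoint_step_def
  by (intro ext) (auto simp: D_lam_zero_iff D_p_lam_sol D_q_eq matrix_vector_algebra)

lemma rattle_midpoint_integrator_iff: "rattle_midpoint_integrator H h \<Phi> \<longleftrightarrow> integrator \<Phi>"
  unfolding rattle_midpoint_integrator_def integrator_def unique_step_def Let_def
    constraint_manifold_eq midpoint_step_eq ..

lemma second_order_convergentI:
  assumes "integrator \<Phi>"
  shows "second_order_convergent H C \<Phi>"
  unfolding second_order_convergent_def
proof (intro allI impI)
  fix T :: real and q p lam lamh
  assume T: "0 < T" and "exact_solution H T q p lam lamh \<and> (q 0, p 0) \<in> C"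
  then have ex: "exact_solution H T q p lam lamh" by simp
  have q: "(q has_vector_derivative A (q t) *v p t) (at t within {0..T})"
    and p: "(p has_vector_derivative - f (q t, p t) - BT (q t) (lamh t)) (at t within {0..T})"
    and h: "h (q t) = 0" if "t \<in> {0..T}" for t
  proof -
    have eqs: "(q has_vector_derivative D_p H (q t) (p t) (lam t) (lamh t)) (at t within {0..T})"
      "(p has_vector_derivative - D_q H (q t) (p t) (lam t) (lamh t)) (at t within {0..T})"
      "D_lam H (q t) (p t) (lam t) (lamh t) = 0" "D_lamh H (q t) (p t) (lam t) (lamh t) = 0"
      using ex that unfolding exact_solution_def by blast+
    then have lam: "lam t = lam_sol (q t) (p t)" by (simp only: D_lam_zero_iff)
    show "(q has_vector_derivative A (q t) *v p t) (at t within {0..T})"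
      using eqs(1) unfolding lam D_p_lam_sol .
    have "- f (q t, p t) - BT (q t) (lamh t) = - D_q H (q t) (p t) (lam t) (lamh t)"
      unfolding lam D_q_eq BT_def by simp
    then show "(p has_vector_derivative - f (q t, p t) - BT (q t) (lamh t)) (at t within {0..T})"
      using eqs(2) by simp
    show "h (q t) = 0" using eqs(4) by (simp only: D_lamh_eq)
  qed
  show "\<exists>B. \<exists>\<delta>>0. \<forall>dt\<in>{0<..<\<delta>}. \<forall>j::nat. real j * dt \<le> T \<longrightarrow>
           (\<Phi> dt ^^ j) (q 0, p 0) \<in> C \<and>
           dist ((\<Phi> dt ^^ j) (q 0, p 0)) (q (real j * dt), p (real j * dt)) \<le> B * dt ^ 2"
    by (rule integrator_second_order[OF assms T, of "\<lambda>t. (q t, p t)"])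
       (rule exact_solution_vector_field[OF T q p h]; assumption)+
qed

end

theorem proposition7:
  fixes M :: "real^'n^'n"
    and V :: "real^'n \<Rightarrow> real"
    and g :: "'k::finite \<Rightarrow> real^'n \<Rightarrow> real^'n"
    and h :: "real^'n \<Rightarrow> real^'l"
    and H :: "('n, 'k, 'l) hamiltonian"
  assumes M_symmetric: "transpose M = M"
    and M_nonsingular: "invertible M"
    and V_smooth: "smooth V"
    and g_smooth: "\<And>i. smooth (g i)"
    and h_smooth: "smooth h"
    and H: "H = (\<lambda>q p lam lamh.
        1 / 2 * ((p + (\<Sum>i\<in>UNIV. lam $ i *\<^sub>R g i q)) \<bullet>
          (matrix_inv M *v (p + (\<Sum>i\<in>UNIV. lam $ i *\<^sub>R g i q))))
        + V q + (\<Sum>i\<in>UNIV. lamh $ i * h q $ i))"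
    and g_independent: "\<And>q. inj (\<lambda>i. g i q) \<and> independent (range (\<lambda>i. g i q))"
    and lam_unique: "\<And>q p. \<exists>!lam. D_lam H q p lam 0 = 0"
    and nondegenerate: "\<And>q p. (q, p) \<in> constraint_manifold H h \<Longrightarrow>
        invertible (jacobian h (at q) ** H_tilde_pp H q p ** transpose (jacobian h (at q)))"
  shows "(\<exists>\<Phi>. rattle_midpoint_integrator H h \<Phi>) \<and>
    (\<forall>\<Phi>. rattle_midpoint_integrator H h \<Phi> \<longrightarrow>
       symplectic_integrator_on (constraint_manifold H h) \<Phi> \<and>
       second_order_convergent H (constraint_manifold H h) \<Phi>)"
proof -
  interpret constrained_mechanical_system M V g h H
    by (unfold_locales) (rule assms; assumption?)+
  show ?thesis
    unfolding rattle_midpoint_integrator_iff constraint_manifold_eq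
    using integrator_exists integrator_symplectic second_order_convergentI by blast
qed

end
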